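(* Consider a finite stochastic partial monitoring game with loss matrix $L\in\mathbb{R}^{N\times M}$, feedback matrix $H\in[A]^{N\times M}$ and opponent strategy $p^*\in\mathcal{P}_M$, globally observable, with action $1$ the unique optimal action under $p^*$. Assume the regularity conditions: (1) the set $\mathcal{R}^*_1(p^*,\{S_ip^*,0\})$ is a singleton; (2) with $\mathcal{S}_\delta=\{q\in\mathcal{P}_M:D(S_1p^*\Vert S_1q)\le\delta\}$, one has $\mathrm{cl}(\mathrm{int}(\mathcal{C}_1^c)\cap\mathcal{S}_\delta)=\mathrm{cl}(\mathrm{cl}(\mathcal{C}_1^c)\cap\mathcal{S}_\delta)$ for all $\delta\ge0$ in some neighborhood of $0$. Then the algorithm PM-DMED-Hinge (with any parameters $a,b,c>0$) satisfies $$\mathbb{E}[\mathrm{Regret}(T)]\le C_1(p^*,\{S_ip^*\})\log T+\mathrm{o}(\log T).$$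
   Context: Game: at each round $t$ the learner chooses $i(t)\in[N]$, the outcome $j(t)$ is i.i.d. from $p^*\in\mathcal{P}_M$ (distributions on $[M]$), the loss $l_{i(t),j(t)}$ is unobserved and only $h_{i(t),j(t)}\in[A]$ is observed. $L_i$ = $i$-th row of $L$; $1=\arg\min_iL_i^\top p^*$ uniquely; $\Delta_i=(L_i-L_1)^\top p^*$; $\mathrm{Regret}(T)=\sum_{t=1}^T\Delta_{i(t)}$. $S_i\in\{0,1\}^{A\times M}$ with $(S_i)_{k,j}=1$ iff $h_{i,j}=k$. Global observability: $L_i-L_j\in\bigoplus_k\mathrm{Im}\,S_k^\top$ for all $i,j$. $\mathcal{C}_j=\{q\in\mathcal{P}_M:\forall i\ne j,(L_j-L_i)^\top q\le0\}$, $\mathcal{C}_j^c=\mathcal{P}_M\setminus\mathcal{C}_j$; $\mathcal{C}_{j,\alpha}=\{p\in\mathcal{P}_M:L_j^\top p+\alpha\le\min_{i\ne j}L_i^\top p\}$; $\mathrm{cl},\mathrm{int}$ denote closure and interior (in $\mathcal{P}_M$). $D$ is the KL divergence ($0\log(0/0)=0$), $(x)_+=\max(x,0)$. For distributions $p_i$ on $[A]$ and $\delta_i\ge0$: $\mathcal{R}_j(\{p_i,\delta_i\})=\{\{r_i\}_{i\ne j}\in[0,\infty)^{N-1}:\inf_{q\in\mathrm{cl}(\mathcal{C}_j^c):D(p_j\Vert S_jq)\le\delta_j}\sum_{i\ne j}r_i(D(p_i\Vert S_iq)-\delta_i)_+\ge1\}$; $C_j(p,\{p_i,\delta_i\})=\inf_{\{r_i\}\in\mathcal{R}_j(\{p_i,\delta_i\})}\sum_{i\ne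 j}r_i(L_i-L_j)^\top p$; $\mathcal{R}^*_j(p,\{p_i,\delta_i\})$ = set of $\{r_i\}\in\mathcal{R}_j(\{p_i,\delta_i\})$ attaining this infimum. Write $C_j(p,\{p_i\})=C_j(p,\{p_i,0\})$. $N_i(t)$ = number of rounds before $t$ in which $i$ was chosen; $\hat p_i(t)$ = empirical distribution on $[A]$ of symbols observed when playing $i$ before round $t$. PM-DMED-Hinge (parameters $c>0$, $f(n)=bn^{-1/2}$, $\alpha(t)=a/\log\log t$ with $a,b>0$). Main routine: select each action once; set $Z_C,Z_R\leftarrow[N]$, $Z_N\leftarrow\emptyset$; while $t\le T$: for each $i(t)\in Z_C$ in an arbitrary fixed order, select $i(t)$ and observe the symbol, set $Z_R\leftarrow Z_R\setminus\{i(t)\}$, run the subroutine below (which adds actions to $Z_N$ without duplication), and set $t\leftarrow t+1$; after the for-loop set $Z_C,Z_R\leftarrow Z_N$, $Z_N\leftarrow\emptyset$. Subroutine: (i) compute any $\hat p(t)\in\arg\min_q\sum_iN_i(t)(D(\hat p_i(t)\Vert S_iq)-f(N_i(t)))_+$ and let $\hat i(t)=\arg\min_iL_i^\top\hat p(t)$; (ii) if $\hat i(t)\notin Z_R$ put $\hat i(t)$ into $Z_N$; (iii) if $\hat p(t)\notin\mathcal{C}_{\hat i(t),\alpha(t)}$ or some $i$ has $D(\hat p_i(t)\Vert S_i\hat p(t))>f(N_i(t))$, put all $i\notin Z_R$ into $Z_N$; (iv) if some $i$ has $N_i(t)<c\sqrt{\log t}$, put all actions not in $Z_R$ into $Z_N$;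 (v) if $\{N_i(t)/\log t\}_{i\ne\hat i(t)}\notin\mathcal{R}_{\hat i(t)}(\{\hat p_i(t),f(N_i(t))\})$, compute some $\{r_i^*\}\in\mathcal{R}^*_{\hat i(t)}(\hat p(t),\{\hat p_i(t),f(N_i(t))\})$ and put all $i\notin Z_R$ with $r_i^*>N_i(t)/\log t$ into $Z_N$; if no such $\{r_i^*\}$ exists, put all $i\notin Z_R$ into $Z_N$. *)

theory Defs
  imports "HOL-Analysis.Analysis" "HOL-Probability.Probability"
begin

text \<open>Finite stochastic partial monitoring. Actions are a finite type 'n, outcomes a finite
 type 'm, feedback symbols a finite type 'a. The loss matrix is L :: real^'m^'n (row L$i = L_i),
 the feedback matrix H :: 'a^'m^'n.\<close>

definition probsimplex :: "(real^'m) set" where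
  "probsimplex = {q. (\<forall>j. 0 \<le> q$j) \<and> (\<Sum>j\<in>UNIV. q$j) = 1}"

definition pvec :: "'m pmf \<Rightarrow> real^'m" where
  "pvec P = (\<chi> j. pmf P j)"

definition Smat :: "'a::finite^'m^'n \<Rightarrow> 'n \<Rightarrow> real^'m^'a" where
  "Smat H i = (\<chi> k j. if H$i$j = k then 1 else 0)"

definition KL :: "real^'a \<Rightarrow> real^'a \<Rightarrow> ereal" where
  "KL p q = (\<Sum>k\<in>UNIV. if p$k = 0 then 0 else if q$k = 0 then \<infinity>
                       else ereal (p$k * ln (p$k / q$k)))"

definition hinge :: "ereal \<Rightarrow> ereal" where
  "hinge x = max 0 x"

definition glob_obs :: "real^'m^'n \<Rightarrow> 'a::finite^'m^'n \<Rightarrow> bool" where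
  "glob_obs L H \<longleftrightarrow>
     (\<forall>i j. L$i - L$j \<in> {\<Sum>k\<in>UNIV. transpose (Smat H k) *v (z$k) | z. True})"

definition cell :: "real^'m^'n \<Rightarrow> 'n \<Rightarrow> (real^'m) set" where
  "cell L j = {q \<in> probsimplex. \<forall>i. i \<noteq> j \<longrightarrow> (L$j - L$i) \<bullet> q \<le> 0}"

definition cellc :: "real^'m^'n \<Rightarrow> 'n \<Rightarrow> (real^'m) set" where
  "cellc L j = probsimplex - cell L j"

definition cell_margin :: "real^'m^'n \<Rightarrow> 'n \<Rightarrow> real \<Rightarrow> (real^'m) set" where
  "cell_margin L j \<alpha> = {p \<in> probsimplex. \<forall>i. i \<noteq> j \<longrightarrow> L$j \<bullet> p + \<alpha> \<le> L$i \<bullet> p}"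

definition clP :: "(real^'m) set \<Rightarrow> (real^'m) set" where
  "clP X = (top_of_set probsimplex) closure_of X"

definition intP :: "(real^'m) set \<Rightarrow> (real^'m) set" where
  "intP X = (top_of_set probsimplex) interior_of X"

text \<open>R_j({p_i, delta_i}); the vector {r_i}_{i ~= j} is represented by r :: real^'n with r$j = 0.\<close>
definition Rset :: "'a::finite^'m^'n \<Rightarrow> real^'m^'n \<Rightarrow> 'n \<Rightarrow> ('n \<Rightarrow> real^'a) \<Rightarrow> ('n \<Rightarrow> real)
                    \<Rightarrow> (real^'n) set" where
  "Rset H L j ps \<delta> = {r. r$j = 0 \<and> (\<forall>i. 0 \<le> r$i) \<and>
     (INF q \<in> {q \<in> clP (cellc L j). KL (ps j) (Smat H j *v q) \<le> ereal (\<delta> j)}.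
        \<Sum>i\<in>UNIV - {j}. ereal (r$i) * hinge (KL (ps i) (Smat H i *v q) - ereal (\<delta> i))) \<ge> 1}"

definition Cval :: "'a::finite^'m^'n \<Rightarrow> real^'m^'n \<Rightarrow> 'n \<Rightarrow> real^'m \<Rightarrow> ('n \<Rightarrow> real^'a)
                    \<Rightarrow> ('n \<Rightarrow> real) \<Rightarrow> ereal" where
  "Cval H L j p ps \<delta> =
     (INF r \<in> Rset H L j ps \<delta>. ereal (\<Sum>i\<in>UNIV - {j}. r$i * ((L$i - L$j) \<bullet> p)))"

definition Ropt :: "'a::finite^'m^'n \<Rightarrow> real^'m^'n \<Rightarrow> 'n \<Rightarrow> real^'m \<Rightarrow> ('n \<Rightarrow> real^'a)
                    \<Rightarrow> ('n \<Rightarrow> real) \<Rightarrow> (real^'n) set" where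
  "Ropt H L j p ps \<delta> = {r \<in> Rset H L j ps \<delta>.
       ereal (\<Sum>i\<in>UNIV - {j}. r$i * ((L$i - L$j) \<bullet> p)) = Cval H L j p ps \<delta>}"

definition Sdelta :: "'a::finite^'m^'n \<Rightarrow> 'n \<Rightarrow> real^'m \<Rightarrow> real \<Rightarrow> (real^'m) set" where
  "Sdelta H j p \<delta> = {q \<in> probsimplex. KL (Smat H j *v p) (Smat H j *v q) \<le> ereal \<delta>}"

text \<open>A history is the list of (chosen action, observed symbol) of the past rounds, in order.\<close>

definition Ncount :: "('n \<times> 'a) list \<Rightarrow> 'n \<Rightarrow> nat" where
  "Ncount h i = length (filter (\<lambda>x. fst x = i) h)"

definition emp :: "('n \<times> 'a::finite) list \<Rightarrow> 'n \<Rightarrow> real^'a" where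
  "emp h i = (\<chi> k. real (count_list h (i, k)) / real (Ncount h i))"

definition fexp :: "real \<Rightarrow> nat \<Rightarrow> real" where
  "fexp b n = b / sqrt (real n)"

definition alpha :: "real \<Rightarrow> nat \<Rightarrow> real" where
  "alpha a t = a / ln (ln (real t))"

definition pm_obj :: "'a::finite^'m^'n \<Rightarrow> real \<Rightarrow> ('n \<times> 'a) list \<Rightarrow> real^'m \<Rightarrow> ereal" where
  "pm_obj H b h q = (\<Sum>i\<in>UNIV. ereal (real (Ncount h i)) *
        hinge (KL (emp h i) (Smat H i *v q) - ereal (fexp b (Ncount h i))))"

text \<open>Admissible choices for the non-deterministic steps: selP picks p-hat(t) in the argmin,
 selI picks i-hat(t) in the argmin, selR picks r* in R* (None iff R* is empty).
 They may depend on the round t and the whole past history.\<close>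
definition valid_sel :: "'a::finite^'m^'n \<Rightarrow> real^'m^'n \<Rightarrow> real
    \<Rightarrow> (nat \<Rightarrow> ('n \<times> 'a) list \<Rightarrow> real^'m) \<Rightarrow> (nat \<Rightarrow> ('n \<times> 'a) list \<Rightarrow> 'n)
    \<Rightarrow> (nat \<Rightarrow> ('n \<times> 'a) list \<Rightarrow> (real^'n) option) \<Rightarrow> bool" where
  "valid_sel H L b selP selI selR \<longleftrightarrow>
     (\<forall>t h. selP t h \<in> probsimplex \<and> (\<forall>q \<in> probsimplex. pm_obj H b h (selP t h) \<le> pm_obj H b h q)) \<and>
     (\<forall>t h i. L$(selI t h) \<bullet> selP t h \<le> L$i \<bullet> selP t h) \<and>
     (\<forall>t h. (case selR t h of
               None \<Rightarrow> Ropt H L (selI t h) (selP t h) (emp h) (\<lambda>i. fexp b (Ncount h i)) = {}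
             | Some r \<Rightarrow> r \<in> Ropt H L (selI t h) (selP t h) (emp h) (\<lambda>i. fexp b (Ncount h i))))"

text \<open>The subroutine at round t; h is the history of rounds before t, ZR the current Z_R
 (already without i(t)), ZN the current Z_N. Returns the new Z_N.\<close>
definition subroutine :: "'a::finite^'m^'n \<Rightarrow> real^'m^'n \<Rightarrow> real \<Rightarrow> real \<Rightarrow> real
    \<Rightarrow> (nat \<Rightarrow> ('n \<times> 'a) list \<Rightarrow> real^'m) \<Rightarrow> (nat \<Rightarrow> ('n \<times> 'a) list \<Rightarrow> 'n)
    \<Rightarrow> (nat \<Rightarrow> ('n \<times> 'a) list \<Rightarrow> (real^'n) option)
    \<Rightarrow> nat \<Rightarrow> ('n \<times> 'a) list \<Rightarrow> 'n set \<Rightarrow> 'n set \<Rightarrow> 'n set" where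
  "subroutine H L a b c selP selI selR t h ZR ZN =
    (let ph = selP t h; j = selI t h; \<delta> = (\<lambda>i. fexp b (Ncount h i)); notR = UNIV - ZR;
         Z1 = (if j \<notin> ZR then ZN \<union> {j} else ZN);
         Z2 = (if ph \<notin> cell_margin L j (alpha a t)
                  \<or> (\<exists>i. KL (emp h i) (Smat H i *v ph) > ereal (\<delta> i))
               then Z1 \<union> notR else Z1);
         Z3 = (if \<exists>i. real (Ncount h i) < c * sqrt (ln (real t)) then Z2 \<union> notR else Z2);
         rv = (\<chi> i. if i = j then 0 else real (Ncount h i) / ln (real t))
     in (if rv \<notin> Rset H L j (emp h) \<delta> then
           (case selR t h of
              None \<Rightarrow> Z3 \<union> notR
            | Some r \<Rightarrow> Z3 \<union> {i \<in> notR. r$i > real (Ncount h i) / ln (real t)})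
         else Z3))"

text \<open>One round t of the main loop; state = (remaining part of Z_C in the fixed order, Z_R, Z_N,
 history). When the for-loop over Z_C is finished, Z_C, Z_R := Z_N and Z_N := {}.
 omega t is the outcome j(t) of round t.\<close>
definition alg_step :: "'n list \<Rightarrow> 'a::finite^'m^'n \<Rightarrow> real^'m^'n \<Rightarrow> real \<Rightarrow> real \<Rightarrow> real
    \<Rightarrow> (nat \<Rightarrow> ('n \<times> 'a) list \<Rightarrow> real^'m) \<Rightarrow> (nat \<Rightarrow> ('n \<times> 'a) list \<Rightarrow> 'n)
    \<Rightarrow> (nat \<Rightarrow> ('n \<times> 'a) list \<Rightarrow> (real^'n) option) \<Rightarrow> (nat \<Rightarrow> 'm) \<Rightarrow> nat
    \<Rightarrow> 'n list \<times> 'n set \<times> 'n set \<times> ('n \<times> 'a) list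
    \<Rightarrow> 'n list \<times> 'n set \<times> 'n set \<times> ('n \<times> 'a) list" where
  "alg_step ordr H L a b c selP selI selR \<omega> t st =
    (case st of (Q0, ZR0, ZN0, h) \<Rightarrow>
      (let (Q, ZR, ZN) = (if Q0 = [] then (filter (\<lambda>i. i \<in> ZN0) ordr, ZN0, {}) else (Q0, ZR0, ZN0));
           i = hd Q;
           ZR' = ZR - {i};
           ZN' = subroutine H L a b c selP selI selR t h ZR' ZN
       in (tl Q, ZR', ZN', h @ [(i, H$i$(\<omega> t))])))"

text \<open>State after N + n rounds (N = number of actions); the first N rounds select each action
 once, in the fixed order ordr.\<close>
primrec alg_state :: "'n list \<Rightarrow> 'a::finite^'m^'n \<Rightarrow> real^'m^'n \<Rightarrow> real \<Rightarrow> real \<Rightarrow> real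
    \<Rightarrow> (nat \<Rightarrow> ('n \<times> 'a) list \<Rightarrow> real^'m) \<Rightarrow> (nat \<Rightarrow> ('n \<times> 'a) list \<Rightarrow> 'n)
    \<Rightarrow> (nat \<Rightarrow> ('n \<times> 'a) list \<Rightarrow> (real^'n) option) \<Rightarrow> (nat \<Rightarrow> 'm) \<Rightarrow> nat
    \<Rightarrow> 'n list \<times> 'n set \<times> 'n set \<times> ('n \<times> 'a) list" where
  "alg_state ordr H L a b c selP selI selR \<omega> 0 =
     (ordr, UNIV, {}, map (\<lambda>k. (ordr ! k, H$(ordr ! k)$(\<omega> (Suc k)))) [0..<length ordr])"
| "alg_state ordr H L a b c selP selI selR \<omega> (Suc n) =
     alg_step ordr H L a b c selP selI selR \<omega> (length ordr + 1 + n)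
       (alg_state ordr H L a b c selP selI selR \<omega> n)"

definition alg_hist :: "'n list \<Rightarrow> 'a::finite^'m^'n \<Rightarrow> real^'m^'n \<Rightarrow> real \<Rightarrow> real \<Rightarrow> real
    \<Rightarrow> (nat \<Rightarrow> ('n \<times> 'a) list \<Rightarrow> real^'m) \<Rightarrow> (nat \<Rightarrow> ('n \<times> 'a) list \<Rightarrow> 'n)
    \<Rightarrow> (nat \<Rightarrow> ('n \<times> 'a) list \<Rightarrow> (real^'n) option) \<Rightarrow> (nat \<Rightarrow> 'm) \<Rightarrow> nat
    \<Rightarrow> ('n \<times> 'a) list" where
  "alg_hist ordr H L a b c selP selI selR \<omega> T =
     take T (snd (snd (snd (alg_state ordr H L a b c selP selI selR \<omega> (T - length ordr)))))"

definition regret :: "real^'m^'n \<Rightarrow> 'n \<Rightarrow> real^'m \<Rightarrow> ('n \<times> 'a) list \<Rightarrow> real" where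
  "regret L i1 p h = (\<Sum>x\<leftarrow>h. (L$(fst x) - L$i1) \<bullet> p)"

end

theory Submission
  imports Defs "HOL-Real_Asymp.Real_Asymp"
begin

text \<open>
  Write \<open>V\<^sub>i\<close> for the likelihood ratio \<open>exp (N\<^sub>i D (emp\<^sub>i || S\<^sub>i p)) / (N\<^sub>i + 1) ^ A\<close>. It is a
  nonnegative supermartingale under any adaptive choice of actions, so Markov's and Ville's
  inequalities control all empirical deviations without union bounds over sample sizes.

  Call an addition of a suboptimal action \<open>k\<close> to \<open>Z\<^sub>N\<close> bad if \<open>N\<^sub>k\<close> already exceeds
  \<open>(r\<^sub>k + \<epsilon>) ln T\<close>, with \<open>r\<close> the unique optimal rate vector; up to a constant, \<open>N\<^sub>k\<close> is at most
  this threshold plus the number of bad additions. When all actions are explored and all empirical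
  distributions are within half the hinge radius, the problem solved by the algorithm is a small
  perturbation of the true one, whose optimal rates are at most \<open>r + \<epsilon>\<close>, so no bad addition occurs.
  The remaining rounds split into four groups. (1) Some \<open>N\<^sub>i < c sqrt (ln t)\<close>: only
  \<open>O (sqrt (ln T))\<close> rounds, since every listed action is played within two passes of the list.
  (2) An action with a deviating empirical distribution is itself listed: \<open>O(1)\<close> rounds in
  expectation. (3) Some empirical distribution deviates and the rates are insufficient: each such
  round lists an action with \<open>N\<^sub>i = O (ln T (ln ln T) ^ 3)\<close>, because \<open>\<alpha>(t)\<close> decays so slowly, while
  the deviation has superpolylogarithmically small probability. (4) A suboptimal action appears
  optimal with sufficient rates: as the true outcome distribution is then feasible,
  \<open>ln t \<le> \<Sum>\<^sub>i N\<^sub>i (D (emp\<^sub>i || S\<^sub>i p) - f (N\<^sub>i))\<^sub>+\<close>, which has probability \<open>o (1 / t)\<close>.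
\<close>

section \<open>Kullback-Leibler divergence on the simplex\<close>

text \<open>The hinge radius is split in two. Deviations are measured against half of
  \<open>f\<close>, so without a deviation the true distribution meets the divergence constraints
  with strict slack, which is what provides Slater points. With a deviation, \<open>N * D\<close>
  still exceeds \<open>b * sqrt N / 2\<close>, which beats the polynomial normaliser of the
  likelihood ratio. The obstacle in the perturbation step is that divergences are not continuous
  where symbols have probability 0. Two one-sided limits replace continuity: enlarged rates
  \<open>c *\<^sub>R rstar\<close> with \<open>c > 1\<close> stay feasible under small
  perturbations, by lower semicontinuity; and limits of rates feasible for perturbed problems are
  feasible for the true one. The second limit is where the closure condition enters: it allows
  constraints to be tested at points off the boundary of the cell, which can be moved towards the
  true distribution until all divergences are finite. Uniqueness then identifies the limit of
  optimal rates. Rounds are counted by sample sizes instead of time: a listed action can stay at one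
  sample size for only boundedly many rounds.\<close>

text \<open>Because \<open>x / 0 = 0\<close>, \<open>klr\<close> agrees with \<^const>\<open>KL\<close> only under \<open>ac\<close>.\<close>

definition klr :: "real^'a \<Rightarrow> real^'a \<Rightarrow> real" where
  "klr p q = (\<Sum>k\<in>UNIV. p$k * ln (p$k / q$k))"

definition ac :: "real^'a \<Rightarrow> real^'a \<Rightarrow> bool" where
  "ac p q \<longleftrightarrow> (\<forall>k. p$k \<noteq> 0 \<longrightarrow> q$k \<noteq> 0)"

lemma KL_eq_klr: "ac p q \<Longrightarrow> KL p q = ereal (klr p q)"
  unfolding KL_def klr_def ac_def sum_ereal[symmetric]
  by (intro sum.cong) auto

lemma KL_not_ac:
  assumes "\<not> ac p q" shows "KL p q = \<infinity>"
proof -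
  obtain k where k: "p$k \<noteq> 0" "q$k = 0" using assms by (auto simp: ac_def)
  show ?thesis
    unfolding KL_def sum_Pinfty using k by (intro conjI bexI[of _ k]) auto
qed

lemma KL_le_iff: "KL p q \<le> ereal x \<longleftrightarrow> ac p q \<and> klr p q \<le> x"
  by (cases "ac p q") (simp_all add: KL_eq_klr KL_not_ac)

lemma KL_less_iff: "KL p q < ereal x \<longleftrightarrow> ac p q \<and> klr p q < x"
  by (cases "ac p q") (simp_all add: KL_eq_klr KL_not_ac)

lemma probsimplex_nonneg: "q \<in> probsimplex \<Longrightarrow> 0 \<le> q$j"
  by (simp add: probsimplex_def)

lemma probsimplex_sum: "q \<in> probsimplex \<Longrightarrow> (\<Sum>j\<in>UNIV. q$j) = 1"
  by (simp add: probsimplex_def)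

lemma probsimplex_le_1: "q \<in> probsimplex \<Longrightarrow> q$j \<le> 1"
  using member_le_sum[of j UNIV "\<lambda>j. q$j"] by (simp add: probsimplex_def)

text \<open>Apply \<open>ln x \<le> x - 1\<close> at \<open>sqrt (q / p)\<close>. For two
  probability vectors the lower bounds add up to the squared Hellinger distance.\<close>

lemma kl_term_ge:
  fixes p q :: real
  assumes "0 \<le> p" "0 \<le> q" "p \<noteq> 0 \<longrightarrow> q \<noteq> 0"
  shows "p * ln (p / q) \<ge> 2 * p - 2 * sqrt (p * q)"
proof (cases "p = 0")
  case False
  then have pq: "p > 0" "q > 0" using assms by auto
  have "ln (sqrt (q / p)) \<le> sqrt (q / p) - 1"
    by (rule ln_le_minus_one) (use pq in simp)
  moreover have "ln (sqrt (q / p)) = - ln (p / q) / 2"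
    using pq by (simp add: ln_sqrt ln_div)
  ultimately have "ln (p / q) \<ge> 2 - 2 * sqrt (q / p)" by simp
  then have "p * ln (p / q) \<ge> p * (2 - 2 * sqrt (q / p))"
    using pq by (intro mult_left_mono) auto
  also have "p * sqrt (q / p) = sqrt (p * q)"
    using pq by (simp add: real_sqrt_divide real_sqrt_mult field_simps) 
  hence "p * (2 - 2 * sqrt (q / p)) = 2 * p - 2 * sqrt (p * q)" by (simp add: algebra_simps)
  finally show ?thesis by simp
qed (use assms in auto)

text \<open>A Pinsker-type inequality through the Hellinger distance: \<open>p - q\<close> factors
  as \<open>(x + y) * (x - y)\<close> with square roots \<open>x\<close>, \<open>y\<close>, and
  \<open>x + y \<le> 2\<close>.\<close>

lemma klr_ge_norm:
  assumes p: "p \<in> probsimplex" and q: "q \<in> probsimplex" and "ac p q"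
  shows "klr p q \<ge> (norm (p - q))\<^sup>2 / 4"
proof -
  have "(norm (p - q))\<^sup>2 = (\<Sum>k\<in>UNIV. (p$k - q$k)\<^sup>2)"
    by (simp add: norm_vec_def L2_set_def sum_nonneg)
  also have "\<dots> \<le> (\<Sum>k\<in>UNIV. 4 * (p$k + q$k - 2 * sqrt (p$k * q$k)))"
  proof (rule sum_mono)
    fix k
    define x where "x = sqrt (p$k)" define y where "y = sqrt (q$k)"
    have x: "x \<ge> 0" "x^2 = p$k" "x \<le> 1" and y: "y \<ge> 0" "y^2 = q$k" "y \<le> 1"
      using probsimplex_nonneg[OF p, of k] probsimplex_nonneg[OF q, of k]
        probsimplex_le_1[OF p, of k] probsimplex_le_1[OF q, of k]
      by (auto simp: x_def y_def)
    have "(x + y)^2 \<le> 2^2" using x y by (intro power_mono) auto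
    then have "(x + y)^2 * (x - y)^2 \<le> 4 * (x - y)^2"
      by (intro mult_right_mono) auto
    moreover have "p$k - q$k = (x + y) * (x - y)" using x y by (simp add: algebra_simps power2_eq_square)
    moreover have "p$k + q$k - 2 * sqrt (p$k * q$k) = (x - y)^2"
      using x(1) y(1) unfolding real_sqrt_mult x_def[symmetric] y_def[symmetric] x(2)[symmetric] y(2)[symmetric]
      by (simp add: power2_eq_square algebra_simps)
    ultimately show "(p$k - q$k)\<^sup>2 \<le> 4 * (p$k + q$k - 2 * sqrt (p$k * q$k))"
      by (simp add: power_mult_distrib)
  qed
  also have "\<dots> = 4 * (\<Sum>k\<in>UNIV. 2 * p$k - 2 * sqrt (p$k * q$k))"
    unfolding sum_distrib_left[symmetric] sum_subtractf sum.distrib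
    using probsimplex_sum[OF p] probsimplex_sum[OF q] by simp
  also have "(\<Sum>k\<in>UNIV. 2 * p$k - 2 * sqrt (p$k * q$k)) \<le> klr p q"
    unfolding klr_def
    by (intro sum_mono kl_term_ge) (use assms in \<open>auto simp: ac_def probsimplex_def\<close>)
  finally show ?thesis by simp
qed

lemma klr_nonneg:
  "p \<in> probsimplex \<Longrightarrow> q \<in> probsimplex \<Longrightarrow> ac p q \<Longrightarrow> 0 \<le> klr p q"
  using klr_ge_norm[of p q] by (smt (verit) divide_nonneg_nonneg zero_le_power2)

lemma klr_self: "klr p p = 0" and ac_self: "ac p p"
  unfolding klr_def ac_def by (auto intro!: sum.neutral)

text \<open>The support of a mixture contains the support of each part of positive weight, so one
  dominating endpoint is enough. Divergences are made finite in this way, by a short move along a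
  segment.\<close>

lemma ac_mix:
  assumes "\<And>k. 0 \<le> q$k" "\<And>k. 0 \<le> q'$k" "0 \<le> s" "s \<le> 1"
    "(s < 1 \<and> ac p q) \<or> (0 < s \<and> ac p q')"
  shows "ac p ((1 - s) *\<^sub>R q + s *\<^sub>R q')"
  unfolding ac_def
proof (intro allI impI)
  fix k assume k: "p$k \<noteq> 0"
  have "0 < (1-s) * q$k \<or> 0 < s * q'$k"
    using assms k unfolding ac_def
    by (metis diff_gt_0_iff_gt less_eq_real_def zero_less_mult_iff)
  moreover have "0 \<le> (1-s) * q$k" "0 \<le> s * q'$k" using assms by auto
  ultimately show "((1 - s) *\<^sub>R q + s *\<^sub>R q') $ k \<noteq> 0" by auto
qed

lemma klr_mix_le:
  assumes q: "\<And>k. 0 \<le> q$k" "\<And>k. 0 \<le> q'$k" and p: "\<And>k. 0 \<le> p$k"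
    and s: "0 \<le> s" "s \<le> 1" and "ac p q" "ac p q'"
  shows "klr p ((1 - s) *\<^sub>R q + s *\<^sub>R q') \<le> (1 - s) * klr p q + s * klr p q'"
proof -
  have "p$k * ln (p$k / ((1-s) * q$k + s * q'$k))
      \<le> (1-s) * (p$k * ln (p$k / q$k)) + s * (p$k * ln (p$k / q'$k))" for k
  proof (cases "p$k = 0")
    case False
    then have pos: "p$k > 0" "q$k > 0" "q'$k > 0"
      using p[of k] q(1)[of k] q(2)[of k] assms(6,7) by (auto simp: ac_def less_le)
    have pos': "(1-s) * q$k + s * q'$k > 0"
      using pos s by (smt (verit) mult_nonneg_nonneg mult_pos_pos)
    have "convex_on {0<..} (\<lambda>x. - ln x :: real)"
      using ln_concave by (simp add: concave_on_def)
    from convex_onD[OF this s, of "q$k" "q'$k"] pos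
    have "(1-s) * ln (q$k) + s * ln (q'$k) \<le> ln ((1-s) * q$k + s * q'$k)" by simp
    then have "ln (p$k / ((1-s) * q$k + s * q'$k)) \<le> (1-s) * ln (p$k / q$k) + s * ln (p$k / q'$k)"
      using pos pos' by (simp add: ln_div algebra_simps)
    then have "p$k * ln (p$k / ((1-s) * q$k + s * q'$k)) \<le> p$k * ((1-s) * ln (p$k / q$k) + s * ln (p$k / q'$k))"
      using pos by (intro mult_left_mono) auto
    then show ?thesis by (simp add: algebra_simps)
  qed auto
  then have "klr p ((1 - s) *\<^sub>R q + s *\<^sub>R q') \<le>
     (\<Sum>k\<in>UNIV. (1-s) * (p$k * ln (p$k / q$k)) + s * (p$k * ln (p$k / q'$k)))"
    unfolding klr_def by (intro sum_mono) simp
  then show ?thesis by (simp add: klr_def sum.distrib sum_distrib_left)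
qed

text \<open>The bound \<open>2 p - 2 sqrt (p q)\<close> on a single term tends to the correct limit whenever
  \<open>p\<close> tends to 0, with no restriction on the limit of \<open>q\<close>.\<close>

lemma klr_lsc:
  fixes p q :: "real^'a::finite"
  assumes pn: "p' \<longlonglongrightarrow> p" and qn: "q' \<longlonglongrightarrow> q" and xn: "x' \<longlonglongrightarrow> x"
    and nonneg: "\<And>n k. 0 \<le> p' n $ k" "\<And>n k. 0 \<le> q' n $ k"
    and ac: "\<And>n. ac (p' n) (q' n)" and le: "\<And>n. klr (p' n) (q' n) \<le> x' n"
  shows "ac p q \<and> klr p q \<le> x"
proof -
  have pk: "(\<lambda>n. p' n $ k) \<longlonglongrightarrow> p$k" and qk: "(\<lambda>n. q' n $ k) \<longlonglongrightarrow> q$k" for k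
    using pn qn by (auto intro: tendsto_vec_nth)
  have p0: "0 \<le> p$k" and q0: "0 \<le> q$k" for k
    using LIMSEQ_le_const[OF pk, of 0] LIMSEQ_le_const[OF qk, of 0] nonneg by auto
  define t where "t n k = p' n $ k * ln (p' n $ k / q' n $ k)" for n k
  define u where "u n k = 2 * p' n $ k - 2 * sqrt (p' n $ k * q' n $ k)" for n k
  have tu: "u n k \<le> t n k" for n k
    unfolding u_def t_def using nonneg ac by (intro kl_term_ge) (auto simp: ac_def)
  have u_lim: "(\<lambda>n. u n k) \<longlonglongrightarrow> 2 * p$k - 2 * sqrt (p$k * q$k)" for k
    unfolding u_def by (intro tendsto_intros pk qk)
  have acpq: "ac p q"
    unfolding ac_def
  proof (intro allI impI notI)
    fix k assume k: "p$k \<noteq> 0" and q: "q$k = 0"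
    \<comment> \<open>The \<open>k\<close>-th term is at most \<open>B n\<close>, because the other
      terms are bounded below by the convergent \<open>u\<close>. Solving for
      \<open>q' n $ k\<close> then keeps it away from 0.\<close>
    define B where "B n = x' n - (\<Sum>l\<in>UNIV - {k}. u n l)" for n
    define B0 where "B0 = x - (\<Sum>l\<in>UNIV - {k}. 2 * p$l - 2 * sqrt (p$l * q$l))"
    have B_lim: "B \<longlonglongrightarrow> B0"
      unfolding B_def B0_def by (intro tendsto_intros xn u_lim)
    have pos: "p$k > 0" using k p0[of k] by auto
    have "eventually (\<lambda>n. p' n $ k > 0) sequentially"
      using order_tendstoD(1)[OF pk pos] .
    then have ev: "eventually (\<lambda>n. p' n $ k * exp (- B n / p' n $ k) \<le> q' n $ k) sequentially"
    proof eventually_elim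
      case (elim n)
      have qp: "q' n $ k > 0" using elim ac[of n] nonneg(2)[of n k] by (auto simp: ac_def less_le)
      have "klr (p' n) (q' n) = t n k + (\<Sum>l\<in>UNIV - {k}. t n l)"
        unfolding klr_def t_def by (subst sum.remove[of _ k]) auto
      then have "t n k \<le> B n"
        using le[of n] sum_mono[of "UNIV - {k}" "u n" "t n", OF tu] by (simp add: B_def)
      then have "ln (p' n $ k / q' n $ k) \<le> B n / p' n $ k"
        using elim by (simp add: t_def field_simps)
      then have "p' n $ k / q' n $ k \<le> exp (B n / p' n $ k)"
        using elim qp by (metis divide_pos_pos exp_le_cancel_iff exp_ln)
      then show ?case using qp by (simp add: exp_minus field_simps)
    qed
    have "(\<lambda>n. p' n $ k * exp (- B n / p' n $ k)) \<longlonglongrightarrow> p$k * exp (- B0 / p$k)"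
      using k by (intro tendsto_intros pk B_lim)
    from tendsto_le[OF trivial_limit_sequentially qk this ev]
    have "p$k * exp (- B0 / p$k) \<le> 0" using q by simp
    then show False using pos by (simp add: mult_le_0_iff)
  qed
  \<comment> \<open>Terms with \<open>p$k = 0\<close> are replaced by their lower bounds
    \<open>u\<close>, which tend to 0; the others converge because \<open>q$k\<close> is nonzero
    there.\<close>
  define w where "w n k = (if p$k = 0 then u n k else t n k)" for n k
  have "(\<lambda>n. w n k) \<longlonglongrightarrow> p$k * ln (p$k / q$k)" for k
  proof (cases "p$k = 0")
    case True
    then show ?thesis using u_lim[of k] by (simp add: w_def)
  next
    case False
    then have "q$k \<noteq> 0" using acpq by (auto simp: ac_def)
    then show ?thesis using False p0[of k] q0[of k] unfolding w_def t_def
      by (simp) (intro tendsto_intros pk qk, auto)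
  qed
  then have "(\<lambda>n. \<Sum>k\<in>UNIV. w n k) \<longlonglongrightarrow> klr p q"
    unfolding klr_def by (intro tendsto_sum)
  moreover have "(\<Sum>k\<in>UNIV. w n k) \<le> x' n" for n
  proof -
    have "(\<Sum>k\<in>UNIV. w n k) \<le> (\<Sum>k\<in>UNIV. t n k)"
      by (intro sum_mono) (use tu in \<open>auto simp: w_def\<close>)
    also have "\<dots> \<le> x' n" using le[of n] by (simp add: klr_def t_def)
    finally show ?thesis .
  qed
  ultimately have "klr p q \<le> x" using xn by (intro LIMSEQ_le) auto
  then show ?thesis using acpq by simp
qed

text \<open>Absolute continuity with respect to the limit makes the terms with
  \<open>p$k = 0\<close> vanish for every \<open>n\<close>, so only terms with positive limit have
  to converge.\<close>

lemma klr_tendsto_left: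
  assumes pn: "p' \<longlonglongrightarrow> p" and "\<And>n. ac (p' n) p" "ac p q"
    and nonneg: "\<And>k. 0 \<le> p$k" "\<And>k. 0 \<le> q$k"
  shows "(\<lambda>n. klr (p' n) q) \<longlonglongrightarrow> klr p q"
  unfolding klr_def
proof (intro tendsto_sum)
  fix k
  have pk: "(\<lambda>n. p' n $ k) \<longlonglongrightarrow> p$k" using pn by (auto intro: tendsto_vec_nth)
  show "(\<lambda>n. p' n $ k * ln (p' n $ k / q $ k)) \<longlonglongrightarrow> p $ k * ln (p $ k / q $ k)"
  proof (cases "p$k = 0")
    case True
    then have "p' n $ k = 0" for n using assms(2)[of n] by (auto simp: ac_def)
    then show ?thesis using True by simp
  next
    case False
    then have "q$k \<noteq> 0" using assms(3) by (auto simp: ac_def)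
    then show ?thesis using False nonneg(1)[of k] nonneg(2)[of k]
      by (intro tendsto_intros pk) auto
  qed
qed

lemma klr_tendsto_right:
  assumes qn: "q' \<longlonglongrightarrow> q" and "ac p q" and nonneg: "\<And>k. 0 \<le> p$k" "\<And>k. 0 \<le> q$k"
  shows "(\<lambda>n. klr p (q' n)) \<longlonglongrightarrow> klr p q" "eventually (\<lambda>n. ac p (q' n)) sequentially"
proof -
  have qk: "(\<lambda>n. q' n $ k) \<longlonglongrightarrow> q$k" for k using qn by (auto intro: tendsto_vec_nth)
  show "(\<lambda>n. klr p (q' n)) \<longlonglongrightarrow> klr p q"
    unfolding klr_def
  proof (intro tendsto_sum)
    fix k
    show "(\<lambda>n. p $ k * ln (p $ k / q' n $ k)) \<longlonglongrightarrow> p $ k * ln (p $ k / q $ k)"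
    proof (cases "p$k = 0")
      case False
      then have "q$k \<noteq> 0" using assms(2) by (auto simp: ac_def)
      then show ?thesis using False nonneg(1)[of k] nonneg(2)[of k]
        by (intro tendsto_intros qk) auto
    qed auto
  qed
  have "eventually (\<lambda>n. p$k \<noteq> 0 \<longrightarrow> q' n $ k \<noteq> 0) sequentially" for k
  proof (cases "p$k = 0")
    case False
    then have "q$k \<noteq> 0" using assms(2) by (auto simp: ac_def)
    from tendsto_imp_eventually_ne[OF qk this] show ?thesis
      by (auto elim: eventually_mono)
  qed auto
  then show "eventually (\<lambda>n. ac p (q' n)) sequentially"
    unfolding ac_def by (simp add: eventually_all_finite)
qed

section \<open>Global observability and the feasible set of rates\<close>

lemma Smat_nth: "(Smat H i *v q) $ k = (\<Sum>j\<in>UNIV. if H$i$j = k then q$j else 0)"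
  unfolding matrix_vector_mult_def Smat_def
  by (simp add: if_distrib[of "\<lambda>x. x * _"] cong: if_cong)

lemma Smat_probsimplex:
  assumes "q \<in> probsimplex" shows "Smat H i *v q \<in> probsimplex"
proof -
  have "(\<Sum>k\<in>UNIV. (Smat H i *v q) $ k) = (\<Sum>j\<in>UNIV. \<Sum>k\<in>UNIV. if H$i$j = k then q$j else 0)"
    unfolding Smat_nth by (rule sum.swap)
  also have "\<dots> = 1" using assms by (simp add: probsimplex_def)
  finally show ?thesis using assms by (simp add: probsimplex_def Smat_nth sum_nonneg)
qed

text \<open>By observability a loss difference is a linear functional of the symbol distributions,
  hence Lipschitz in them; \<open>K\<close> dominates the coefficients \<open>z\<close> of all pairs
  at once. Loss differences can thus be estimated although \<open>q\<close> itself need not be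
  identifiable.\<close>

lemma glob_obs_bound:
  fixes L :: "real^'m::finite^'n::finite" and H :: "'a::finite^'m^'n"
  assumes "glob_obs L H"
  obtains K where "K > 0"
    "\<And>i j q q'. \<bar>(L$i - L$j) \<bullet> (q - q')\<bar> \<le> K * (\<Sum>k\<in>UNIV. norm (Smat H k *v q - Smat H k *v q'))"
proof -
  have "\<forall>i j. \<exists>z :: real^'a^'n. L$i - L$j = (\<Sum>k\<in>UNIV. transpose (Smat H k) *v (z$k))"
    using assms unfolding glob_obs_def by blast
  then obtain z :: "'n \<Rightarrow> 'n \<Rightarrow> real^'a^'n"
    where z: "\<And>i j. L$i - L$j = (\<Sum>k\<in>UNIV. transpose (Smat H k) *v (z i j$k))" by metis
  define K where "K = 1 + (\<Sum>i\<in>UNIV. \<Sum>j\<in>UNIV. \<Sum>k\<in>UNIV. norm (z i j $ k))"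
  have zK: "norm (z i j $ k) \<le> K" for i j k
  proof -
    have "norm (z i j $ k) \<le> (\<Sum>k\<in>UNIV. norm (z i j $ k))"
      by (rule member_le_sum) auto
    also have "\<dots> \<le> (\<Sum>j\<in>UNIV. \<Sum>k\<in>UNIV. norm (z i j $ k))"
      by (rule member_le_sum[of _ _ "\<lambda>j. \<Sum>k\<in>UNIV. norm (z i j $ k)"]) (auto intro: sum_nonneg)
    also have "\<dots> \<le> (\<Sum>i\<in>UNIV. \<Sum>j\<in>UNIV. \<Sum>k\<in>UNIV. norm (z i j $ k))"
      by (rule member_le_sum[of _ _ "\<lambda>i. \<Sum>j\<in>UNIV. \<Sum>k\<in>UNIV. norm (z i j $ k)"])
        (auto intro!: sum_nonneg)
    finally show ?thesis by (simp add: K_def)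
  qed
  show ?thesis
  proof
    show "K > 0" unfolding K_def by (intro add_pos_nonneg sum_nonneg) auto
    fix i j and q q' :: "real^'m"
    have "(L$i - L$j) \<bullet> (q - q') = (\<Sum>k\<in>UNIV. (z i j $ k) \<bullet> (Smat H k *v (q - q')))"
      unfolding z[of i j] by (simp add: inner_sum_left transpose_matrix_vector dot_lmul_matrix)
    also have "\<bar>\<dots>\<bar> \<le> (\<Sum>k\<in>UNIV. \<bar>(z i j $ k) \<bullet> (Smat H k *v (q - q'))\<bar>)"
      by (rule sum_abs)
    also have "\<dots> \<le> (\<Sum>k\<in>UNIV. K * norm (Smat H k *v (q - q')))"
    proof (rule sum_mono)
      fix k
      have "\<bar>(z i j $ k) \<bullet> (Smat H k *v (q - q'))\<bar> \<le> norm (z i j $ k) * norm (Smat H k *v (q - q'))"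
        by (rule Cauchy_Schwarz_ineq2)
      also have "\<dots> \<le> K * norm (Smat H k *v (q - q'))"
        by (intro mult_right_mono zK) auto
      finally show "\<bar>(z i j $ k) \<bullet> (Smat H k *v (q - q'))\<bar> \<le> K * norm (Smat H k *v (q - q'))" .
    qed
    finally show "\<bar>(L$i - L$j) \<bullet> (q - q')\<bar> \<le> K * (\<Sum>k\<in>UNIV. norm (Smat H k *v q - Smat H k *v q'))"
      by (simp add: sum_distrib_left matrix_vector_mult_diff_distrib)
  qed
qed

lemma probsimplex_norm_le_1: "q \<in> probsimplex \<Longrightarrow> norm q \<le> 1"
  using norm_le_l1_cart[of q] by (simp add: probsimplex_def)

lemma closed_probsimplex: "closed (probsimplex :: (real^'m::finite) set)"
proof -
  have *: "probsimplex = (\<Inter>j. {q :: real^'m. 0 \<le> q$j}) \<inter> {q. (\<Sum>j\<in>UNIV. q$j) = 1}"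
    by (auto simp: probsimplex_def)
  show ?thesis
    by (subst *) (intro closed_Int closed_INT ballI closed_Collect_le closed_Collect_eq continuous_intros)
qed

lemma probsimplex_mix:
  assumes "q \<in> probsimplex" "q' \<in> probsimplex" "0 \<le> s" "s \<le> 1"
  shows "(1 - s) *\<^sub>R q + s *\<^sub>R q' \<in> probsimplex"
  using assms unfolding probsimplex_def
  by (auto simp: sum.distrib sum_distrib_left[symmetric])

section \<open>Cells in the simplex and a real-valued form of the feasible set\<close>

lemma clP_eq: "clP X = probsimplex \<inter> closure (probsimplex \<inter> X)"
  by (simp add: clP_def closure_of_subtopology)

lemma clP_superset: "X \<subseteq> probsimplex \<Longrightarrow> X \<subseteq> clP X"
  unfolding clP_eq using closure_subset by fastforce

lemma cellc_subset: "cellc L j \<subseteq> probsimplex"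
  by (auto simp: cellc_def)

lemma cellc_iff: "q \<in> cellc L j \<longleftrightarrow> q \<in> probsimplex \<and> (\<exists>i. i \<noteq> j \<and> (L$j - L$i) \<bullet> q > 0)"
  by (auto simp: cellc_def cell_def not_le)

text \<open>The complement of a cell is a finite union of half-space slices, and closure commutes
  with finite unions. The point \<open>q0\<close> of the same slice is kept as a direction in which
  a boundary point can be pushed into the complement.\<close>

lemma clP_cellcE:
  fixes L :: "real^'m::finite^'n::finite"
  assumes "q \<in> clP (cellc L j)"
  obtains i q0 where "q \<in> probsimplex" "i \<noteq> j" "(L$j - L$i) \<bullet> q \<ge> 0"
    "q0 \<in> probsimplex" "(L$j - L$i) \<bullet> q0 > 0"
proof -
  define C where "C i = {q \<in> probsimplex. (L$j - L$i) \<bullet> q > 0}" for i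
  have "cellc L j = (\<Union>i\<in>UNIV - {j}. C i)" by (force simp: cellc_iff C_def)
  then have "q \<in> closure (\<Union>i\<in>UNIV - {j}. C i)" and q: "q \<in> probsimplex"
    using assms cellc_subset[of L j] by (auto simp: clP_eq Int_absorb1)
  then have "q \<in> (\<Union>i\<in>UNIV - {j}. closure (C i))"
    using closure_of_Union[of "C ` (UNIV - {j})" euclidean] by simp
  then obtain i where i: "i \<noteq> j" "q \<in> closure (C i)" by auto
  have "closure (C i) \<subseteq> {q. (L$j - L$i) \<bullet> q \<ge> 0}"
    by (rule closure_minimal) (auto simp: C_def closed_Collect_le continuous_intros)
  moreover obtain q0 where "q0 \<in> C i" using i(2) by fastforce
  ultimately show ?thesis using i q by (intro that[of i q0]) (auto simp: C_def)
qed

text \<open>It represents the extended-valued objective of \<open>Rset\<close> only where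
  \<open>ac\<close> holds for every action of positive rate.\<close>

definition wsum :: "'a::finite^'m^'n \<Rightarrow> 'n \<Rightarrow> ('n \<Rightarrow> real^'a) \<Rightarrow> ('n \<Rightarrow> real) \<Rightarrow> real^'n \<Rightarrow> real^'m \<Rightarrow> real" where
  "wsum H j ps \<delta> r q = (\<Sum>i\<in>UNIV - {j}. r$i * max 0 (klr (ps i) (Smat H i *v q) - \<delta> i))"

lemma hinge_KL:
  "hinge (KL p q - ereal d) = (if ac p q then ereal (max 0 (klr p q - d)) else \<infinity>)"
  by (cases "ac p q")
    (simp_all add: hinge_def KL_eq_klr KL_not_ac zero_ereal_def[symmetric] max_def)

text \<open>An infinite objective satisfies the bound trivially, and
  \<open>0 * \<infinity> = 0\<close> removes the actions of rate 0. So the constraint binds only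
  where every action of positive rate has finite divergence.\<close>

lemma Rset_iff:
  "r \<in> Rset H L j ps \<delta> \<longleftrightarrow> r$j = 0 \<and> (\<forall>i. 0 \<le> r$i) \<and>
     (\<forall>q\<in>clP (cellc L j). ac (ps j) (Smat H j *v q) \<longrightarrow> klr (ps j) (Smat H j *v q) \<le> \<delta> j \<longrightarrow>
        (\<forall>i. i \<noteq> j \<and> 0 < r$i \<longrightarrow> ac (ps i) (Smat H i *v q)) \<longrightarrow> 1 \<le> wsum H j ps \<delta> r q)"
proof (cases "\<forall>i. 0 \<le> r$i")
  case nn: True
  define E where "E q = (\<Sum>i\<in>UNIV - {j}. ereal (r$i) * hinge (KL (ps i) (Smat H i *v q) - ereal (\<delta> i)))" for q
  have "1 \<le> E q \<longleftrightarrow> ((\<forall>i. i \<noteq> j \<and> 0 < r$i \<longrightarrow> ac (ps i) (Smat H i *v q)) \<longrightarrow> 1 \<le> wsum H j ps \<delta> r q)" for q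
  proof (cases "\<forall>i. i \<noteq> j \<and> 0 < r$i \<longrightarrow> ac (ps i) (Smat H i *v q)")
    case True
    have "E q = (\<Sum>i\<in>UNIV - {j}. ereal (r$i * max 0 (klr (ps i) (Smat H i *v q) - \<delta> i)))"
      unfolding E_def
    proof (intro sum.cong refl)
      fix i assume i: "i \<in> UNIV - {j}"
      show "ereal (r$i) * hinge (KL (ps i) (Smat H i *v q) - ereal (\<delta> i)) =
        ereal (r$i * max 0 (klr (ps i) (Smat H i *v q) - \<delta> i))"
        using True i nn unfolding hinge_KL
        by (cases "r$i = 0") (auto simp: less_le zero_ereal_def[symmetric] max_def)
    qed
    then show ?thesis using True by (simp add: wsum_def one_ereal_def)
  next
    case False
    then obtain i where i: "i \<noteq> j" "0 < r$i" "\<not> ac (ps i) (Smat H i *v q)" by auto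
    have "ereal (r$i) * hinge (KL (ps i) (Smat H i *v q) - ereal (\<delta> i)) = \<infinity>"
      using i by (simp add: hinge_KL)
    then have "E q = \<infinity>" unfolding E_def sum_Pinfty using i(1) by (intro conjI bexI[of _ i]) auto
    then show ?thesis using False by auto
  qed
  moreover have "r \<in> Rset H L j ps \<delta> \<longleftrightarrow> r$j = 0 \<and>
      (\<forall>q\<in>clP (cellc L j). ac (ps j) (Smat H j *v q) \<longrightarrow> klr (ps j) (Smat H j *v q) \<le> \<delta> j \<longrightarrow> 1 \<le> E q)"
    using nn unfolding Rset_def by (auto simp: le_INF_iff KL_le_iff E_def)
  ultimately show ?thesis using nn by simp
next
  case False
  then show ?thesis by (auto simp: Rset_def)
qed

lemma wsum_mono:
  "(\<And>i. r$i \<le> r'$i) \<Longrightarrow> wsum H j ps \<delta> r q \<le> wsum H j ps \<delta> r' q"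
  unfolding wsum_def by (intro sum_mono mult_right_mono) auto

lemma Rset_upward:
  assumes "r \<in> Rset H L j ps \<delta>" "r'$j = 0" "\<And>i. r$i \<le> r'$i"
  shows "r' \<in> Rset H L j ps \<delta>"
  unfolding Rset_iff
proof (intro conjI allI ballI impI)
  fix i show "0 \<le> r'$i" using assms order_trans unfolding Rset_iff by metis
next
  fix q assume "q \<in> clP (cellc L j)" "ac (ps j) (Smat H j *v q)" "klr (ps j) (Smat H j *v q) \<le> \<delta> j"
    and *: "\<forall>i. i \<noteq> j \<and> 0 < r'$i \<longrightarrow> ac (ps i) (Smat H i *v q)"
  moreover from * have "\<forall>i. i \<noteq> j \<and> 0 < r$i \<longrightarrow> ac (ps i) (Smat H i *v q)"
    using assms(3) less_le_trans by blast
  ultimately have "1 \<le> wsum H j ps \<delta> r q" using assms(1) unfolding Rset_iff by blast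
  then show "1 \<le> wsum H j ps \<delta> r' q" using wsum_mono[OF assms(3)] by (rule order_trans)
qed (use assms in simp)

definition cost :: "real^'m^'n \<Rightarrow> 'n \<Rightarrow> real^'m \<Rightarrow> real^'n \<Rightarrow> real" where
  "cost L j p r = (\<Sum>i\<in>UNIV - {j}. r$i * ((L$i - L$j) \<bullet> p))"

lemma Ropt_iff:
  "r \<in> Ropt H L j p ps \<delta> \<longleftrightarrow> r \<in> Rset H L j ps \<delta> \<and> (\<forall>r'\<in>Rset H L j ps \<delta>. cost L j p r \<le> cost L j p r')"
proof (cases "r \<in> Rset H L j ps \<delta>")
  case True
  then have "Cval H L j p ps \<delta> \<le> ereal (cost L j p r)"
    unfolding Cval_def cost_def by (rule INF_lower)
  then have "ereal (cost L j p r) = Cval H L j p ps \<delta> \<longleftrightarrow> ereal (cost L j p r) \<le> Cval H L j p ps \<delta>"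
    by auto
  also have "\<dots> \<longleftrightarrow> (\<forall>r'\<in>Rset H L j ps \<delta>. cost L j p r \<le> cost L j p r')"
    unfolding Cval_def cost_def by (simp add: le_INF_iff)
  finally show ?thesis using True by (simp add: Ropt_def cost_def)
qed (simp add: Ropt_def)

section \<open>Explicit bounds on rates under a margin\<close>

lemma norm_le_of_klr:
  assumes "p \<in> probsimplex" "q \<in> probsimplex" "ac p q" "klr p q \<le> d"
  shows "norm (p - q) \<le> 2 * sqrt d"
proof -
  have "(norm (p - q))\<^sup>2 \<le> 4 * d" using klr_ge_norm[OF assms(1-3)] assms(4) by simp
  then have "norm (p - q) \<le> sqrt (4 * d)" by (rule real_le_rsqrt)
  then show ?thesis by (simp add: real_sqrt_mult)
qed

text \<open>A point of the closed complement must differ from \<open>p\<close> by order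
  \<open>\<alpha> / (K * N)\<close> in some symbol distribution, \<open>N\<close> being the number
  of actions. As each \<open>ps i\<close> is within \<open>B = \<alpha>\<^sup>2 / \<kappa>\<close>
  of \<open>p\<close> in divergence, some action other than \<open>j\<close> has divergence at least
  \<open>2 * B\<close>; subtracting its tolerance leaves \<open>B\<close>, the reciprocal of the
  uniform rate. The constant 64 makes \<open>8 * K * N * sqrt B\<close> equal to
  \<open>\<alpha>\<close>.\<close>

lemma uniform_in_Rset:
  fixes L :: "real^'m::finite^'n::finite" and H :: "'a::finite^'m^'n"
  assumes "K > 0"
    and K: "\<And>i j q q'. \<bar>(L$i - L$j) \<bullet> (q - q')\<bar> \<le> K * (\<Sum>k\<in>UNIV. norm (Smat H k *v q - Smat H k *v q'))"
    and \<kappa>: "\<kappa> = 64 * (K * real CARD('n))\<^sup>2"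
    and p: "p \<in> cell_margin L j \<alpha>" and "\<alpha> > 0"
    and ps: "\<And>i. ps i \<in> probsimplex" and KL: "\<And>i. KL (ps i) (Smat H i *v p) \<le> ereal (\<delta> i)"
    and \<delta>: "\<And>i. \<delta> i \<le> \<alpha>\<^sup>2 / \<kappa>"
  shows "(\<chi> i. if i = j then 0 else \<kappa> / \<alpha>\<^sup>2) \<in> Rset H L j ps \<delta>"
proof -
  define n where "n = real CARD('n)"
  have n: "n > 0" by (simp add: n_def)
  have \<kappa>0: "\<kappa> > 0" unfolding \<kappa> using \<open>K > 0\<close> by auto
  define B where "B = \<alpha>\<^sup>2 / \<kappa>"
  have B0: "B > 0" using \<open>\<alpha> > 0\<close> \<kappa>0 by (simp add: B_def)
  have sqB: "8 * K * n * sqrt B = \<alpha>"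
  proof -
    have "sqrt \<kappa> = 8 * (K * n)" unfolding \<kappa> n_def[symmetric] using \<open>K > 0\<close> n
      by (simp add: real_sqrt_mult)
    then show ?thesis unfolding B_def using \<open>\<alpha> > 0\<close> n \<open>K > 0\<close> by (simp add: real_sqrt_divide field_simps)
  qed
  have pp: "p \<in> probsimplex" using p by (simp add: cell_margin_def)
  define r where "r = (\<chi> i. if i = j then 0 else \<kappa> / \<alpha>\<^sup>2)"
  have rpos: "0 < r$i" if "i \<noteq> j" for i using that \<kappa>0 \<open>\<alpha> > 0\<close> by (simp add: r_def)
  have "r \<in> Rset H L j ps \<delta>"
    unfolding Rset_iff
  proof (intro conjI allI ballI impI)
    show "r$j = 0" "0 \<le> r$i" for i using rpos[of i] by (auto simp: r_def less_imp_le)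
    fix q assume q: "q \<in> clP (cellc L j)" and acj: "ac (ps j) (Smat H j *v q)"
      and lej: "klr (ps j) (Smat H j *v q) \<le> \<delta> j"
      and "\<forall>i. i \<noteq> j \<and> 0 < r$i \<longrightarrow> ac (ps i) (Smat H i *v q)"
    then have ac: "ac (ps i) (Smat H i *v q)" for i using rpos by (cases "i = j") auto
    from clP_cellcE[OF q] obtain i0 where qp: "q \<in> probsimplex" and i0: "i0 \<noteq> j" "0 \<le> (L$j - L$i0) \<bullet> q"
      by metis
    have a1: "\<alpha> \<le> (L$i0 - L$j) \<bullet> (p - q)"
      using p i0 by (auto simp: cell_margin_def inner_diff_left inner_diff_right)
    \<comment> \<open>Otherwise all divergences are at most \<open>2 * B\<close>, for
      \<open>j\<close> by its own constraint. The symbol distributions then differ by at most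
      \<open>2 * sqrt B + 3 * sqrt B\<close> each, short of the \<open>8 * sqrt B\<close> that the
      margin demands on average.\<close>
    have "\<exists>i. i \<noteq> j \<and> klr (ps i) (Smat H i *v q) \<ge> 2 * B"
    proof (rule ccontr)
      assume "\<not> ?thesis"
      then have lt: "klr (ps i) (Smat H i *v q) \<le> 2 * B" for i
        using lej \<delta>[of j] B0 unfolding B_def[symmetric]
        by (cases "i = j") (auto simp: not_le intro: less_imp_le)
      have "norm (Smat H k *v p - Smat H k *v q) \<le> 5 * sqrt B" for k
      proof -
        have "norm (ps k - Smat H k *v p) \<le> 2 * sqrt B"
          using KL[of k] \<delta>[of k] by (intro norm_le_of_klr ps Smat_probsimplex pp) (auto simp: KL_le_iff B_def)
        moreover have "norm (ps k - Smat H k *v q) \<le> 2 * sqrt (2 * B)"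
          by (intro norm_le_of_klr ps Smat_probsimplex qp ac lt)
        moreover have "sqrt (2 * B) \<le> (3/2) * sqrt B"
          by (rule real_le_lsqrt) (use B0 in \<open>auto simp: power_mult_distrib power2_eq_square\<close>)
        ultimately show ?thesis
          using norm_triangle_ineq4[of "ps k - Smat H k *v q" "ps k - Smat H k *v p"] by simp
      qed
      then have "(\<Sum>k\<in>UNIV. norm (Smat H k *v p - Smat H k *v q)) \<le> (\<Sum>k\<in>(UNIV :: 'n set). 5 * sqrt B)"
        by (intro sum_mono) auto
      also have "\<dots> = n * (5 * sqrt B)" by (simp add: n_def)
      finally have "K * (\<Sum>k\<in>UNIV. norm (Smat H k *v p - Smat H k *v q)) \<le> K * (n * (5 * sqrt B))"
        using \<open>K > 0\<close> by (intro mult_left_mono) auto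
      then have "\<alpha> \<le> K * (n * (5 * sqrt B))" using a1 K[of i0 j p q] by linarith
      moreover have "K * (n * (3 * sqrt B)) > 0" using B0 n \<open>K > 0\<close> by simp
      ultimately show False unfolding sqB[symmetric] by (simp add: algebra_simps)
    qed
    then obtain i where i: "i \<noteq> j" "klr (ps i) (Smat H i *v q) \<ge> 2 * B" by auto
    have "1 = r$i * B" using i \<kappa>0 \<open>\<alpha> > 0\<close> by (simp add: r_def B_def)
    also have "\<dots> \<le> r$i * max 0 (klr (ps i) (Smat H i *v q) - \<delta> i)"
      using i \<delta>[of i] rpos[of i] by (intro mult_left_mono) (auto simp: B_def)
    also have "\<dots> \<le> wsum H j ps \<delta> r q"
      unfolding wsum_def
      by (rule member_le_sum) (use i rpos in \<open>auto simp: less_imp_le\<close>)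
    finally show "1 \<le> wsum H j ps \<delta> r q" .
  qed
  then show ?thesis by (simp only: r_def)
qed

text \<open>Every cost coefficient is at least \<open>\<alpha>\<close>, and optimal rates cost no
  more than the uniform ones. Passing from cost to single rates loses one further factor
  \<open>1 / \<alpha>\<close>.\<close>

lemma Ropt_le:
  fixes L :: "real^'m::finite^'n::finite" and H :: "'a::finite^'m^'n"
  assumes r: "r \<in> Ropt H L j p ps \<delta>" and p: "p \<in> cell_margin L j \<alpha>" and "\<alpha> > 0" and "u \<ge> 0"
    and u: "(\<chi> i. if i = j then 0 else u) \<in> Rset H L j ps \<delta>"
    and Lm: "\<And>i. (L$i - L$j) \<bullet> p \<le> Lm"
    and "k \<noteq> j"
  shows "r$k \<le> real CARD('n) * u * Lm / \<alpha>"
proof -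
  have r0: "0 \<le> r$i" for i using r by (simp add: Ropt_iff Rset_iff)
  have gap: "\<alpha> \<le> (L$i - L$j) \<bullet> p" if "i \<noteq> j" for i
    using p that by (auto simp: cell_margin_def inner_diff_left)
  have "r$k * \<alpha> \<le> r$k * ((L$k - L$j) \<bullet> p)" using gap[OF \<open>k \<noteq> j\<close>] r0 by (intro mult_left_mono)
  also have "\<dots> \<le> cost L j p r" unfolding cost_def
    by (rule member_le_sum) (use gap \<open>\<alpha> > 0\<close> \<open>k \<noteq> j\<close> r0 in \<open>fastforce intro!: mult_nonneg_nonneg\<close>)+
  also have "\<dots> \<le> cost L j p (\<chi> i. if i = j then 0 else u)" using r u by (simp add: Ropt_iff)
  also have "\<dots> \<le> (\<Sum>i\<in>UNIV - {j}. u * Lm)"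
    unfolding cost_def using Lm \<open>u \<ge> 0\<close> by (intro sum_mono) (auto intro: mult_left_mono)
  also have "\<dots> \<le> (\<Sum>i\<in>(UNIV :: 'n set). u * Lm)"
    using \<open>u \<ge> 0\<close> Lm[of j] by (intro sum_mono2) auto
  finally show ?thesis using \<open>\<alpha> > 0\<close> by (simp add: field_simps)
qed

section \<open>Moving along segments in the simplex\<close>

lemma Smat_mix:
  "Smat H i *v ((1 - s) *\<^sub>R q + s *\<^sub>R q') = (1 - s) *\<^sub>R (Smat H i *v q) + s *\<^sub>R (Smat H i *v q')"
  by (simp add: vec_eq_iff Smat_nth sum.distrib[symmetric] sum_distrib_left if_distrib cong: if_cong)

lemma Smat_tendsto: "q' \<longlonglongrightarrow> q \<Longrightarrow> (\<lambda>n. Smat H i *v q' n) \<longlonglongrightarrow> Smat H i *v q"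
  by (rule isCont_tendsto_compose[OF linear_continuous_at[OF matrix_vector_mul_bounded_linear]])

lemma mix_less_exists:
  fixes w w' x :: real
  assumes "w < x"
  obtains s where "0 < s" "s < 1" "(1 - s) * w + s * w' < x"
proof -
  have "((\<lambda>s. (1 - s) * w + s * w') \<longlongrightarrow> (1 - 0) * w + 0 * w') (at_right 0)"
    by (intro tendsto_intros)
  then have "eventually (\<lambda>s. (1 - s) * w + s * w' < x) (at_right 0)"
    using assms by (intro order_tendstoD(2)) auto
  then obtain b where b: "b > 0" "\<And>s. 0 < s \<Longrightarrow> s < b \<Longrightarrow> (1 - s) * w + s * w' < x"
    unfolding eventually_at_right_field by auto
  show ?thesis by (rule that[of "min b 1 / 2"]) (use b(1) b(2)[of "min b 1 / 2"] in auto)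
qed

lemma ac_Smat_mix:
  assumes "q \<in> probsimplex" "q' \<in> probsimplex" "0 < s" "s < 1"
    "ac p (Smat H i *v q) \<or> ac p (Smat H i *v q')"
  shows "ac p (Smat H i *v ((1 - s) *\<^sub>R q + s *\<^sub>R q'))"
  unfolding Smat_mix using assms Smat_probsimplex
  by (intro ac_mix) (auto intro: probsimplex_nonneg)

lemma klr_Smat_mix:
  assumes "q \<in> probsimplex" "q' \<in> probsimplex" "p \<in> probsimplex" "0 < s" "s < 1"
    "ac p (Smat H i *v q)" "ac p (Smat H i *v q')"
  shows "klr p (Smat H i *v ((1 - s) *\<^sub>R q + s *\<^sub>R q')) \<le>
    (1 - s) * klr p (Smat H i *v q) + s * klr p (Smat H i *v q')"
  unfolding Smat_mix using assms Smat_probsimplex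
  by (intro klr_mix_le) (auto intro: probsimplex_nonneg)

text \<open>Convexity of the divergence in its second argument survives the hinge. At
  \<open>q\<close> finiteness is demanded only for positive rates, since the other actions do not
  contribute.\<close>

lemma wsum_mix:
  assumes q: "q \<in> probsimplex" "q' \<in> probsimplex" and s: "0 < s" "s < 1"
    and ps: "\<And>i. ps i \<in> probsimplex" and r: "\<And>i. 0 \<le> r$i"
    and ac: "\<And>i. i \<noteq> j \<Longrightarrow> 0 < r$i \<Longrightarrow> ac (ps i) (Smat H i *v q)" "\<And>i. ac (ps i) (Smat H i *v q')"
  shows "wsum H j ps \<delta> r ((1 - s) *\<^sub>R q + s *\<^sub>R q') \<le> (1 - s) * wsum H j ps \<delta> r q + s * wsum H j ps \<delta> r q'"
proof -
  have "r$i * max 0 (klr (ps i) (Smat H i *v ((1 - s) *\<^sub>R q + s *\<^sub>R q')) - \<delta> i) \<le>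
     (1 - s) * (r$i * max 0 (klr (ps i) (Smat H i *v q) - \<delta> i)) +
     s * (r$i * max 0 (klr (ps i) (Smat H i *v q') - \<delta> i))" if "i \<noteq> j" for i
  proof (cases "r$i = 0")
    case False
    then have ri: "r$i > 0" using r[of i] by simp
    define a where "a = klr (ps i) (Smat H i *v q)"
    define b where "b = klr (ps i) (Smat H i *v q')"
    have "klr (ps i) (Smat H i *v ((1 - s) *\<^sub>R q + s *\<^sub>R q')) - \<delta> i \<le> (1 - s) * (a - \<delta> i) + s * (b - \<delta> i)"
      using klr_Smat_mix[OF q ps s ac(1)[OF that ri] ac(2)] by (simp add: a_def b_def algebra_simps)
    also have "\<dots> \<le> (1 - s) * max 0 (a - \<delta> i) + s * max 0 (b - \<delta> i)"
      using s by (intro add_mono mult_left_mono) auto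
    finally have "max 0 (klr (ps i) (Smat H i *v ((1 - s) *\<^sub>R q + s *\<^sub>R q')) - \<delta> i) \<le>
      (1 - s) * max 0 (a - \<delta> i) + s * max 0 (b - \<delta> i)" using s by simp
    then have "r$i * max 0 (klr (ps i) (Smat H i *v ((1 - s) *\<^sub>R q + s *\<^sub>R q')) - \<delta> i) \<le>
      r$i * ((1 - s) * max 0 (a - \<delta> i) + s * max 0 (b - \<delta> i))"
      using ri by (intro mult_left_mono) auto
    then show ?thesis by (simp add: a_def b_def algebra_simps)
  qed auto
  then have "wsum H j ps \<delta> r ((1 - s) *\<^sub>R q + s *\<^sub>R q') \<le> (\<Sum>i\<in>UNIV - {j}.
     (1 - s) * (r$i * max 0 (klr (ps i) (Smat H i *v q) - \<delta> i)) +
     s * (r$i * max 0 (klr (ps i) (Smat H i *v q') - \<delta> i)))"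
    unfolding wsum_def by (intro sum_mono) auto
  then show ?thesis by (simp add: wsum_def sum.distrib sum_distrib_left)
qed

lemma cellc_mix:
  assumes "q \<in> probsimplex" "q' \<in> probsimplex" "0 < s" "s < 1" "i \<noteq> j"
    "(L$j - L$i) \<bullet> q \<ge> 0" "(L$j - L$i) \<bullet> q' > 0"
  shows "(1 - s) *\<^sub>R q + s *\<^sub>R q' \<in> cellc L j"
  unfolding cellc_iff
  using assms by (intro conjI probsimplex_mix exI[of _ i]) (auto simp: inner_add_right intro: add_nonneg_pos)

text \<open>At a point where some \<open>D (p_i || S_i q)\<close> is infinite the constraint on \<open>r\<close> is not closed, since
  \<open>0 * \<infinity> = 0\<close>; such points are approached along a segment towards a Slater point.\<close>

lemma closed_Rset:
  fixes L :: "real^'m::finite^'n::finite" and H :: "'a::finite^'m^'n"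
  assumes ps: "\<And>i. ps i \<in> probsimplex"
    and slater: "\<And>q i. \<lbrakk>q \<in> probsimplex; i \<noteq> j; (L$j - L$i) \<bullet> q \<ge> 0; \<exists>q0\<in>probsimplex. (L$j - L$i) \<bullet> q0 > 0;
        ac (ps j) (Smat H j *v q); klr (ps j) (Smat H j *v q) \<le> \<delta> j\<rbrakk> \<Longrightarrow>
      \<exists>q'\<in>probsimplex. (L$j - L$i) \<bullet> q' > 0 \<and> klr (ps j) (Smat H j *v q') \<le> \<delta> j \<and> (\<forall>k. ac (ps k) (Smat H k *v q'))"
  shows "closed (Rset H L j ps \<delta>)"
  unfolding closed_sequential_limits
proof (intro allI impI)
  fix R r assume "(\<forall>n. R n \<in> Rset H L j ps \<delta>) \<and> R \<longlonglongrightarrow> r"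
  then have R: "\<And>n. R n \<in> Rset H L j ps \<delta>" and lim: "R \<longlonglongrightarrow> r" by auto
  have limk: "(\<lambda>n. R n $ k) \<longlonglongrightarrow> r$k" for k using lim by (rule tendsto_vec_nth)
  have r0: "0 \<le> r$k" for k
    using LIMSEQ_le_const[OF limk, of 0] R by (auto simp: Rset_iff)
  have rj: "r$j = 0"
    using LIMSEQ_unique[OF limk[of j], of 0] R by (simp add: Rset_iff)
  show "r \<in> Rset H L j ps \<delta>"
    unfolding Rset_iff
  proof (intro conjI allI ballI impI rj r0 leI notI)
    fix q assume q: "q \<in> clP (cellc L j)" and acj: "ac (ps j) (Smat H j *v q)"
      and lej: "klr (ps j) (Smat H j *v q) \<le> \<delta> j"
      and ac: "\<forall>i. i \<noteq> j \<and> 0 < r$i \<longrightarrow> ac (ps i) (Smat H i *v q)"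
      and less: "wsum H j ps \<delta> r q < 1"
    obtain i q0 where qp: "q \<in> probsimplex" and i: "i \<noteq> j" "(L$j - L$i) \<bullet> q \<ge> 0"
      and q0: "q0 \<in> probsimplex" "(L$j - L$i) \<bullet> q0 > 0"
      using clP_cellcE[OF q] by metis
    from slater[OF qp i _ acj lej] q0 obtain q' where q': "q' \<in> probsimplex" "(L$j - L$i) \<bullet> q' > 0"
      "klr (ps j) (Smat H j *v q') \<le> \<delta> j" and ac': "\<And>k. ac (ps k) (Smat H k *v q')" by auto
    obtain s where s: "0 < s" "s < 1"
      and sl: "(1 - s) * wsum H j ps \<delta> r q + s * wsum H j ps \<delta> r q' < 1"
      using mix_less_exists[OF less] by metis
    \<comment> \<open>At \<open>x\<close> every divergence is finite, so its constraint binds for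
      each \<open>R n\<close>, whichever rates are positive, and it is linear in the rates.\<close>
    define x where "x = (1 - s) *\<^sub>R q + s *\<^sub>R q'"
    have x: "x \<in> clP (cellc L j)"
      using cellc_mix[OF qp q'(1) s i q'(2)] clP_superset[OF cellc_subset[of L j]] by (auto simp: x_def)
    have acx: "ac (ps k) (Smat H k *v x)" for k
      unfolding x_def using ac' by (intro ac_Smat_mix qp q'(1) s) auto
    have "klr (ps j) (Smat H j *v x) \<le> (1 - s) * klr (ps j) (Smat H j *v q) + s * klr (ps j) (Smat H j *v q')"
      unfolding x_def by (intro klr_Smat_mix qp q'(1) ps s acj ac')
    also have "\<dots> \<le> (1 - s) * \<delta> j + s * \<delta> j" using s lej q'(3) by (intro add_mono mult_left_mono) auto
    finally have lex: "klr (ps j) (Smat H j *v x) \<le> \<delta> j" by (simp add: algebra_simps)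
    have "wsum H j ps \<delta> r x \<le> (1 - s) * wsum H j ps \<delta> r q + s * wsum H j ps \<delta> r q'"
      unfolding x_def using ac ac' by (intro wsum_mix qp q'(1) ps s r0) auto
    then have wx: "wsum H j ps \<delta> r x < 1" using sl by simp
    have "(\<lambda>n. wsum H j ps \<delta> (R n) x) \<longlonglongrightarrow> wsum H j ps \<delta> r x"
      unfolding wsum_def by (intro tendsto_intros limk)
    moreover have "1 \<le> wsum H j ps \<delta> (R n) x" for n
      using R[of n] x acx lex unfolding Rset_iff by blast
    ultimately have "1 \<le> wsum H j ps \<delta> r x" by (intro LIMSEQ_le_const) auto
    then show False using wx by simp
  qed
qed

section \<open>Stability of the optimal rates\<close>

locale pm_game =
  fixes L :: "real^'m::finite^'n::finite" and H :: "'a::finite^'m^'n"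
    and p0 :: "real^'m" and i1 :: 'n and rstar :: "real^'n"
  assumes glob: "glob_obs L H"
    and p0: "p0 \<in> probsimplex"
    and uniq: "\<And>i. i \<noteq> i1 \<Longrightarrow> (L$i - L$i1) \<bullet> p0 > 0"
    and opt: "Ropt H L i1 p0 (\<lambda>i. Smat H i *v p0) (\<lambda>_. 0) = {rstar}"
    and reg: "clP (intP (cellc L i1) \<inter> Sdelta H i1 p0 0) = clP (clP (cellc L i1) \<inter> Sdelta H i1 p0 0)"
begin

abbreviation S where "S i q \<equiv> Smat H i *v q"

abbreviation Rset0 where "Rset0 \<equiv> Rset H L i1 (\<lambda>i. Smat H i *v p0) (\<lambda>_. 0)"

text \<open>Closeness of \<open>p\<close> to \<open>p0\<close> is measured only through loss
  differences, because the feedback may not identify \<open>p\<close>. The strict inequality between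
  divergence and tolerance is the slack from which Slater points are built.\<close>

definition pert :: "real \<Rightarrow> real^'m \<Rightarrow> ('n \<Rightarrow> real^'a) \<Rightarrow> ('n \<Rightarrow> real) \<Rightarrow> bool" where
  "pert \<eta> p ps \<delta> \<longleftrightarrow> p \<in> probsimplex \<and> (\<forall>i. \<bar>(L$i - L$i1) \<bullet> (p - p0)\<bar> < \<eta>) \<and>
     (\<forall>i. ps i \<in> probsimplex \<and> 0 < \<delta> i \<and> \<delta> i < \<eta> \<and> KL (ps i) (S i p0) < ereal (\<delta> i))"

lemma pertD:
  assumes "pert \<eta> p ps \<delta>"
  shows "p \<in> probsimplex" "\<bar>(L$i - L$i1) \<bullet> (p - p0)\<bar> < \<eta>" "ps i \<in> probsimplex" "0 < \<delta> i" "\<delta> i < \<eta>"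
    "ac (ps i) (S i p0)" "klr (ps i) (S i p0) < \<delta> i"
  using assms unfolding pert_def KL_less_iff by auto

lemma pert_mono: "pert \<eta> p ps \<delta> \<Longrightarrow> \<eta> \<le> \<eta>' \<Longrightarrow> pert \<eta>' p ps \<delta>"
  unfolding pert_def by (meson less_le_trans)

lemma S0: "S i p0 \<in> probsimplex"
  by (rule Smat_probsimplex[OF p0])

text \<open>The added 1 keeps the set nonempty when \<open>i1\<close> is the only action.\<close>

definition gap where "gap = Min ((\<lambda>i. (L$i - L$i1) \<bullet> p0) ` (UNIV - {i1}) \<union> {1})"

lemma gap_pos: "gap > 0" and gap_le: "i \<noteq> i1 \<Longrightarrow> gap \<le> (L$i - L$i1) \<bullet> p0"
  unfolding gap_def using uniq by (auto intro!: Min_le)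

lemma pert_gap:
  assumes "pert \<eta> p ps \<delta>" "\<eta> \<le> gap / 2" "i \<noteq> i1"
  shows "gap / 2 \<le> (L$i - L$i1) \<bullet> p"
  using pertD(2)[OF assms(1), of i] gap_le[OF assms(3)] assms(2) by (simp add: inner_diff_right)

lemma rstar: "rstar \<in> Rset0"
    "r \<in> Rset0 \<Longrightarrow> cost L i1 p0 rstar \<le> cost L i1 p0 r"
    "r \<in> Rset0 \<Longrightarrow> cost L i1 p0 r \<le> cost L i1 p0 rstar \<Longrightarrow> r = rstar"
proof -
  have *: "r \<in> Ropt H L i1 p0 (\<lambda>i. S i p0) (\<lambda>_. 0) \<longleftrightarrow> r = rstar" for r using opt by auto
  from *[of rstar] show a: "rstar \<in> Rset0"
    and b: "r \<in> Rset0 \<Longrightarrow> cost L i1 p0 rstar \<le> cost L i1 p0 r" for r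
    by (auto simp: Ropt_iff)
  show "r \<in> Rset0 \<Longrightarrow> cost L i1 p0 r \<le> cost L i1 p0 rstar \<Longrightarrow> r = rstar"
    unfolding *[symmetric] Ropt_iff using b by (meson order_trans)
qed

lemma pert_seq:
  assumes pert: "\<And>n. pert (\<eta> n) (p n) (ps n) (\<delta> n)" and \<eta>: "\<eta> \<longlonglongrightarrow> 0"
  shows "(\<lambda>n. \<delta> n i) \<longlonglongrightarrow> 0" "(\<lambda>n. ps n i) \<longlonglongrightarrow> S i p0"
    "(\<lambda>n. (L$i - L$i1) \<bullet> p n) \<longlonglongrightarrow> (L$i - L$i1) \<bullet> p0"
proof -
  show \<delta>: "(\<lambda>n. \<delta> n i) \<longlonglongrightarrow> 0"
    by (rule tendsto_sandwich[OF _ _ tendsto_const \<eta>])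
      (use pertD(4,5)[OF pert] in \<open>auto intro!: always_eventually less_imp_le\<close>)
  have le: "norm (ps n i - S i p0) \<le> 2 * sqrt (\<delta> n i)" for n
    using pertD(3,6)[OF pert[of n], of i] less_imp_le[OF pertD(7)[OF pert[of n], of i]]
    by (intro norm_le_of_klr S0)
  have "(\<lambda>n. 2 * sqrt (\<delta> n i)) \<longlonglongrightarrow> 2 * sqrt 0" by (intro tendsto_intros \<delta>)
  then have "(\<lambda>n. 2 * sqrt (\<delta> n i)) \<longlonglongrightarrow> 0" by simp
  then have "(\<lambda>n. ps n i - S i p0) \<longlonglongrightarrow> 0"
    by (rule Lim_null_comparison[OF always_eventually[OF allI[OF le]]])
  then show "(\<lambda>n. ps n i) \<longlonglongrightarrow> S i p0" by (rule LIM_zero_cancel)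
  have "(\<lambda>n. (L$i - L$i1) \<bullet> p n - (L$i - L$i1) \<bullet> p0) \<longlonglongrightarrow> 0"
    by (rule Lim_null_comparison[OF _ \<eta>])
      (use pertD(2)[OF pert] in \<open>auto intro!: always_eventually less_imp_le simp: inner_diff_right\<close>)
  then show "(\<lambda>n. (L$i - L$i1) \<bullet> p n) \<longlonglongrightarrow> (L$i - L$i1) \<bullet> p0" by (rule LIM_zero_cancel)
qed

lemma closed_clP: "closed (clP (X :: (real^'m) set))"
  unfolding clP_eq by (intro closed_Int closed_probsimplex closed_closure)

text \<open>The compactness argument shared by the proofs by contradiction below: counterexamples
  for every \<open>\<eta>\<close> give a sequence whose points \<open>q\<close> converge, and lower
  semicontinuity makes the limit indistinguishable from \<open>p0\<close> by action
  \<open>i1\<close>. The predicate \<open>Q\<close> carries what the particular counterexample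
  violates.\<close>

lemma pert_limit:
  assumes ex: "\<And>\<eta>. \<eta> > 0 \<Longrightarrow> \<exists>p ps \<delta> q. pert \<eta> p ps \<delta> \<and> q \<in> probsimplex \<and> ac (ps i1) (S i1 q) \<and>
      klr (ps i1) (S i1 q) \<le> \<delta> i1 \<and> Q ps \<delta> q"
  obtains \<eta> p ps \<delta> q q0 where "\<eta> \<longlonglongrightarrow> 0" "\<And>n::nat. pert (\<eta> n) (p n) (ps n) (\<delta> n)" "\<And>n. \<eta> n \<le> 1"
    "\<And>n. q n \<in> probsimplex" "\<And>n. Q (ps n) (\<delta> n) (q n)" "q \<longlonglongrightarrow> q0" "q0 \<in> probsimplex"
    "S i1 q0 = S i1 p0"
proof -
  define \<eta> where "\<eta> n = 1 / real (Suc n)" for n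
  have \<eta>: "\<eta> \<longlonglongrightarrow> 0" unfolding \<eta>_def using LIMSEQ_inverse_real_of_nat by (simp add: inverse_eq_divide)
  have "\<eta> n > 0" for n by (simp add: \<eta>_def)
  from ex[OF this] obtain p ps \<delta> q where P: "\<And>n. pert (\<eta> n) (p n) (ps n) (\<delta> n)"
    and q: "\<And>n. q n \<in> probsimplex" and ac1: "\<And>n. ac (ps n i1) (S i1 (q n))"
    and le1: "\<And>n. klr (ps n i1) (S i1 (q n)) \<le> \<delta> n i1" and Q: "\<And>n. Q (ps n) (\<delta> n) (q n)"
    by metis
  have "bounded (range q)" using q probsimplex_norm_le_1 by (auto simp: bounded_iff)
  then obtain q0 s where s: "strict_mono s" and lq: "(q \<circ> s) \<longlonglongrightarrow> q0"
    using bounded_imp_convergent_subsequence by blast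
  have lq': "(\<lambda>n. q (s n)) \<longlonglongrightarrow> q0" using lq by (simp add: o_def)
  have \<eta>s: "(\<lambda>n. \<eta> (s n)) \<longlonglongrightarrow> 0" using LIMSEQ_subseq_LIMSEQ[OF \<eta> s] by (simp add: o_def)
  have q0: "q0 \<in> probsimplex" using closed_sequentially[OF closed_probsimplex _ lq] q by auto
  note seq = pert_seq[OF P \<eta>s]
  have "ac (S i1 p0) (S i1 q0) \<and> klr (S i1 p0) (S i1 q0) \<le> 0"
    by (rule klr_lsc[OF seq(2) Smat_tendsto[OF lq'] seq(1)])
      (use ac1 le1 pertD(3)[OF P] q in \<open>auto intro!: probsimplex_nonneg Smat_probsimplex\<close>)
  then have "norm (S i1 p0 - S i1 q0) \<le> 2 * sqrt 0"
    by (intro norm_le_of_klr S0 Smat_probsimplex q0) auto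
  then show ?thesis by (intro that[OF \<eta>s P _ q Q lq' q0]) (simp_all add: \<eta>_def)
qed

text \<open>Points violating the constraint for ever smaller perturbations would accumulate at a
  point where, by lower semicontinuity, the objective of \<open>rstar\<close> is at most
  \<open>1 / c < 1\<close>.\<close>

lemma scaled_rstar_in_Rset:
  assumes "c > 1"
  obtains \<eta> where "\<eta> > 0" "\<And>p ps \<delta>. pert \<eta> p ps \<delta> \<Longrightarrow> c *\<^sub>R rstar \<in> Rset H L i1 ps \<delta>"
proof (rule ccontr)
  assume contr: "\<not> thesis"
  note witness = that
  have r0: "0 \<le> rstar$i" "rstar$i1 = 0" for i using rstar(1) by (auto simp: Rset_iff)
  define Q where "Q ps \<delta> q \<longleftrightarrow> q \<in> clP (cellc L i1) \<and> (\<forall>i. i \<noteq> i1 \<and> 0 < rstar$i \<longrightarrow> ac (ps i) (S i q)) \<and>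
      wsum H i1 ps \<delta> (c *\<^sub>R rstar) q < 1" for ps \<delta> q
  have "\<exists>p ps \<delta> q. pert \<eta> p ps \<delta> \<and> q \<in> probsimplex \<and> ac (ps i1) (S i1 q) \<and>
      klr (ps i1) (S i1 q) \<le> \<delta> i1 \<and> Q ps \<delta> q" if "\<eta> > 0" for \<eta>
  proof -
    have "\<exists>p ps \<delta>. pert \<eta> p ps \<delta> \<and> c *\<^sub>R rstar \<notin> Rset H L i1 ps \<delta>"
      using contr witness[OF that] by blast
    then obtain p ps \<delta> where P: "pert \<eta> p ps \<delta>" "c *\<^sub>R rstar \<notin> Rset H L i1 ps \<delta>"
      by blast
    have "0 < (c *\<^sub>R rstar)$i \<longleftrightarrow> 0 < rstar$i" for i using \<open>c > 1\<close> by (simp add: zero_less_mult_iff)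
    then have "\<exists>q. ac (ps i1) (S i1 q) \<and> klr (ps i1) (S i1 q) \<le> \<delta> i1 \<and> Q ps \<delta> q"
      using P r0 \<open>c > 1\<close> unfolding Rset_iff Q_def by (auto simp: not_le)
    moreover have "q \<in> probsimplex" if "Q ps \<delta> q" for q using that by (simp add: Q_def clP_eq)
    ultimately show ?thesis using P(1) by blast
  qed
  from pert_limit[of Q, OF this] obtain \<eta> p ps \<delta> q q0 where \<eta>: "\<eta> \<longlonglongrightarrow> 0" and P: "\<And>n::nat. pert (\<eta> n) (p n) (ps n) (\<delta> n)"
    and \<eta>1: "\<And>n. \<eta> n \<le> 1" and qP: "\<And>n. q n \<in> probsimplex" and Q: "\<And>n. Q (ps n) (\<delta> n) (q n)"
    and lq: "q \<longlonglongrightarrow> q0" and Sq0: "S i1 q0 = S i1 p0"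
    by metis
  have q: "q n \<in> clP (cellc L i1)" and ac: "i \<noteq> i1 \<Longrightarrow> 0 < rstar$i \<Longrightarrow> ac (ps n i) (S i (q n))"
    and less: "wsum H i1 (ps n) (\<delta> n) (c *\<^sub>R rstar) (q n) < 1" for n i using Q[of n] by (auto simp: Q_def)
  note seq = pert_seq[OF P \<eta>]
  \<comment> \<open>Only divergences with positive rate are recorded, since the others may be
    unbounded. A recorded one is bounded because its hinge term is below 1 and its tolerance is
    below 1, which gives the two summands of the bound.\<close>
  define y where "y n = (\<chi> i. if i \<noteq> i1 \<and> 0 < rstar$i then klr (ps n i) (S i (q n)) else 0)" for n
  have ybd: "0 \<le> y n $ i \<and> y n $ i \<le> (if 0 < rstar$i then 1 / (c * rstar$i) + 1 else 0)" for n i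
  proof (cases "i \<noteq> i1 \<and> 0 < rstar$i")
    case True
    have "c * rstar$i * (y n $ i - \<delta> n i) \<le> (c *\<^sub>R rstar)$i * max 0 (klr (ps n i) (S i (q n)) - \<delta> n i)"
      using True \<open>c > 1\<close> by (simp add: y_def)
    also have "\<dots> \<le> wsum H i1 (ps n) (\<delta> n) (c *\<^sub>R rstar) (q n)"
      unfolding wsum_def using True \<open>c > 1\<close> r0 by (intro member_le_sum) auto
    also have "\<dots> \<le> 1" using less[of n] by simp
    finally have "y n $ i - \<delta> n i \<le> 1 / (c * rstar$i)"
      using True \<open>c > 1\<close> by (simp add: field_simps)
    moreover have "\<delta> n i < \<eta> n" using pertD[OF P] by blast
    moreover note \<eta>1[of n]
    moreover have "0 \<le> y n $ i" using True pertD(3)[OF P[of n], of i] ac qP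
      by (auto simp: y_def intro!: klr_nonneg Smat_probsimplex)
    ultimately show ?thesis using True by auto
  qed (use \<open>c > 1\<close> r0 in \<open>auto simp: y_def\<close>)
  have "norm (y n) \<le> (\<Sum>i\<in>UNIV. if 0 < rstar$i then 1 / (c * rstar$i) + 1 else 0)" for n
    by (rule order_trans[OF norm_le_l1_cart]) (use ybd in \<open>auto intro!: sum_mono simp: abs_of_nonneg\<close>)
  then have "bounded (range y)" by (auto simp: bounded_iff)
  then obtain y0 s where s: "strict_mono s" and ly: "(y \<circ> s) \<longlonglongrightarrow> y0"
    using bounded_imp_convergent_subsequence by blast
  have q0: "q0 \<in> clP (cellc L i1)"
    using closed_sequentially[OF closed_clP _ lq] q by auto
  have sub: "f \<longlonglongrightarrow> l \<Longrightarrow> (\<lambda>n. f (s n)) \<longlonglongrightarrow> l" for f and l :: "'z::topological_space"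
    using LIMSEQ_subseq_LIMSEQ[OF _ s, of f l] by (simp add: o_def)
  have lyi: "(\<lambda>n. y (s n) $ i) \<longlonglongrightarrow> y0$i" for i
    using tendsto_vec_nth[OF ly] by (simp add: o_def)
  have A1: "ac (S i1 p0) (S i1 q0) \<and> klr (S i1 p0) (S i1 q0) \<le> 0"
    by (simp add: Sq0 ac_self klr_self)
  have A: "ac (S i p0) (S i q0) \<and> klr (S i p0) (S i q0) \<le> y0$i"
    if "i \<noteq> i1" "0 < rstar$i" for i
    by (rule klr_lsc[OF sub[OF seq(2)] sub[OF Smat_tendsto[OF lq]] lyi])
      (use that ac pertD(3)[OF P] qP in \<open>auto simp: y_def intro!: probsimplex_nonneg Smat_probsimplex\<close>)
  have "1 \<le> wsum H i1 (\<lambda>i. S i p0) (\<lambda>_. 0) rstar q0"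
    using rstar(1) q0 A1 A unfolding Rset_iff by blast
  also have "\<dots> \<le> (\<Sum>i\<in>UNIV - {i1}. rstar$i * max 0 (y0$i))"
    unfolding wsum_def
  proof (intro sum_mono)
    fix i assume "i \<in> UNIV - {i1}"
    then have "klr (S i p0) (S i q0) \<le> y0$i" if "rstar$i \<noteq> 0"
      using A[of i] r0(1)[of i] that by simp
    then show "rstar$i * max 0 (klr (S i p0) (S i q0) - 0) \<le> rstar$i * max 0 (y0$i)"
      using r0(1)[of i] by (cases "rstar$i = 0") (simp_all add: max.coboundedI2 mult_left_mono)
  qed
  finally have ge: "c \<le> c * (\<Sum>i\<in>UNIV - {i1}. rstar$i * max 0 (y0$i))" using \<open>c > 1\<close> by simp
  have "(\<lambda>n. c * (\<Sum>i\<in>UNIV - {i1}. rstar$i * max 0 (y (s n) $ i - \<delta> (s n) i)))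
     \<longlonglongrightarrow> c * (\<Sum>i\<in>UNIV - {i1}. rstar$i * max 0 (y0 $ i - 0))"
    by (intro tendsto_intros tendsto_max lyi sub[OF seq(1)])
  moreover have "c * (\<Sum>i\<in>UNIV - {i1}. rstar$i * max 0 (y n $ i - \<delta> n i)) \<le> 1" for n
  proof -
    have "c * (\<Sum>i\<in>UNIV - {i1}. rstar$i * max 0 (y n $ i - \<delta> n i)) = wsum H i1 (ps n) (\<delta> n) (c *\<^sub>R rstar) (q n)"
      unfolding wsum_def sum_distrib_left y_def using r0 by (intro sum.cong) (auto simp: less_le)
    then show ?thesis using less[of n] by simp
  qed
  ultimately have "c * (\<Sum>i\<in>UNIV - {i1}. rstar$i * max 0 (y0 $ i)) \<le> 1"
    by (intro LIMSEQ_le_const2) auto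
  then show False using ge \<open>c > 1\<close> by simp
qed

section \<open>Existence of optimal rates under perturbation\<close>

lemma cost_ge:
  assumes "pert \<eta> p ps \<delta>" "\<eta> \<le> gap / 2" "\<And>i. 0 \<le> r$i" "k \<noteq> i1"
  shows "r$k * (gap / 2) \<le> cost L i1 p r"
proof -
  have g: "gap / 2 \<le> (L$i - L$i1) \<bullet> p" if "i \<noteq> i1" for i
    using pert_gap[OF assms(1,2) that] .
  have "r$k * (gap / 2) \<le> r$k * ((L$k - L$i1) \<bullet> p)"
    using g assms by (intro mult_left_mono) auto
  also have "\<dots> \<le> cost L i1 p r"
    unfolding cost_def
  proof (rule member_le_sum)
    fix i assume "i \<in> UNIV - {i1} - {k}"
    then show "0 \<le> r$i * ((L$i - L$i1) \<bullet> p)"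
      using g[of i] gap_pos assms(3)[of i] by (intro mult_nonneg_nonneg) auto
  qed (use assms in auto)
  finally show ?thesis .
qed

text \<open>If no \<open>\<eta>\<close> worked, the points \<open>q\<close> for shrinking
  perturbations would accumulate at a point on the same closed side with the
  \<open>i1\<close>-symbol distribution of \<open>p0\<close>. That limit does not depend on the
  perturbation and is itself the required \<open>q'\<close>.\<close>

lemma Slater:
  fixes i :: 'n
  obtains \<eta> where "\<eta> > 0"
    "\<And>p ps \<delta> q. \<lbrakk>pert \<eta> p ps \<delta>; q \<in> probsimplex; (L$i1 - L$i) \<bullet> q \<ge> 0;
        ac (ps i1) (S i1 q); klr (ps i1) (S i1 q) \<le> \<delta> i1\<rbrakk> \<Longrightarrow>
      \<exists>q'\<in>probsimplex. (L$i1 - L$i) \<bullet> q' \<ge> 0 \<and> S i1 q' = S i1 p0"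
proof (rule ccontr)
  assume contr: "\<not> thesis"
  note witness = that
  let ?Q = "\<lambda>(ps :: 'n \<Rightarrow> real^'a) (\<delta> :: 'n \<Rightarrow> real) q. (L$i1 - L$i) \<bullet> q \<ge> 0"
  have "\<exists>p ps \<delta> q. pert \<eta> p ps \<delta> \<and> q \<in> probsimplex \<and> ac (ps i1) (S i1 q) \<and>
      klr (ps i1) (S i1 q) \<le> \<delta> i1 \<and> ?Q ps \<delta> q" if "\<eta> > 0" for \<eta>
    using contr witness[OF that] by blast
  from pert_limit[of ?Q, OF this] obtain q q0 where q: "\<And>n::nat. (L$i1 - L$i) \<bullet> q n \<ge> 0"
    and lq: "q \<longlonglongrightarrow> q0" and q0: "q0 \<in> probsimplex" "S i1 q0 = S i1 p0" by metis
  have "(\<lambda>n. (L$i1 - L$i) \<bullet> q n) \<longlonglongrightarrow> (L$i1 - L$i) \<bullet> q0" by (intro tendsto_intros lq)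
  then have "(L$i1 - L$i) \<bullet> q0 \<ge> 0" using q by (intro LIMSEQ_le_const) auto
  then show False using contr that[of 1] q0 by fastforce
qed

text \<open>Mixing in a little of \<open>p0\<close> keeps the strict inequality and makes the symbol
  distributions dominate those of \<open>p0\<close>.\<close>

lemma interior_point:
  assumes "q0 \<in> probsimplex" "v \<bullet> q0 > 0"
  obtains q :: "real^'m" where "q \<in> probsimplex" "v \<bullet> q > 0" "\<And>p i. ac p (S i p0) \<Longrightarrow> ac p (S i q)"
proof -
  have "- (v \<bullet> q0) < 0" using assms by simp
  then obtain s where s: "0 < s" "s < 1" "(1 - s) * (- (v \<bullet> q0)) + s * (- (v \<bullet> p0)) < 0"
    using mix_less_exists[of "- (v \<bullet> q0)" 0 "- (v \<bullet> p0)"] by blast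
  show ?thesis
  proof (rule that)
    show "(1 - s) *\<^sub>R q0 + s *\<^sub>R p0 \<in> probsimplex" using s by (intro probsimplex_mix p0 assms) auto
    show "v \<bullet> ((1 - s) *\<^sub>R q0 + s *\<^sub>R p0) > 0" using s by (simp add: inner_add_right)
    show "ac p (S i ((1 - s) *\<^sub>R q0 + s *\<^sub>R p0))" if "ac p (S i p0)" for p i
      using s that by (intro ac_Smat_mix p0 assms) auto
  qed
qed

text \<open>Attainment follows from a closed feasible set and bounded sublevel sets of the cost. The
  gap gives boundedness. For closedness, \<open>q1\<close> has slack in the divergence of
  \<open>i1\<close>, \<open>q2\<close> has the strict half-space inequality and the supports, and a
  short step from \<open>q1\<close> towards \<open>q2\<close> combines all three.\<close>

lemma Ropt_nonempty:
  obtains \<eta> where "\<eta> > 0" "\<And>p ps \<delta>. pert \<eta> p ps \<delta> \<Longrightarrow> Ropt H L i1 p ps \<delta> \<noteq> {}"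
proof -
  obtain \<eta>1 where \<eta>1: "\<eta>1 > 0" "\<And>p ps \<delta>. pert \<eta>1 p ps \<delta> \<Longrightarrow> 2 *\<^sub>R rstar \<in> Rset H L i1 ps \<delta>"
    using scaled_rstar_in_Rset[of 2] by auto
  have "\<forall>i. \<exists>\<eta>>0. \<forall>p ps \<delta> q. pert \<eta> p ps \<delta> \<longrightarrow> q \<in> probsimplex \<longrightarrow> (L$i1 - L$i) \<bullet> q \<ge> 0 \<longrightarrow>
        ac (ps i1) (S i1 q) \<longrightarrow> klr (ps i1) (S i1 q) \<le> \<delta> i1 \<longrightarrow>
      (\<exists>q'\<in>probsimplex. (L$i1 - L$i) \<bullet> q' \<ge> 0 \<and> S i1 q' = S i1 p0)"
    using Slater by metis
  then obtain e where e0: "\<And>i. e i > 0" and e: "\<And>i p ps \<delta> q. \<lbrakk>pert (e i) p ps \<delta>; q \<in> probsimplex; (L$i1 - L$i) \<bullet> q \<ge> 0;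
        ac (ps i1) (S i1 q); klr (ps i1) (S i1 q) \<le> \<delta> i1\<rbrakk> \<Longrightarrow>
      \<exists>q'\<in>probsimplex. (L$i1 - L$i) \<bullet> q' \<ge> 0 \<and> S i1 q' = S i1 p0"
    by metis
  define \<eta> where "\<eta> = Min (insert \<eta>1 (insert (gap / 2) (range e)))"
  have "\<eta> > 0" unfolding \<eta>_def using \<eta>1(1) e0 gap_pos by (subst Min_gr_iff) auto
  moreover have "\<eta> \<le> x" if "x \<in> insert \<eta>1 (insert (gap / 2) (range e))" for x
    unfolding \<eta>_def using that by (intro Min_le) auto
  ultimately have \<eta>: "\<eta> > 0" "\<eta> \<le> \<eta>1" "\<eta> \<le> gap / 2" "\<eta> \<le> e i" for i by blast+
  show ?thesis
  proof (rule that[OF \<eta>(1)])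
    fix p ps \<delta> assume P: "pert \<eta> p ps \<delta>"
    note PD = pertD[OF P]
    have cl: "closed (Rset H L i1 ps \<delta>)"
    proof (rule closed_Rset)
      fix q i assume q: "q \<in> probsimplex" "i \<noteq> i1" "(L$i1 - L$i) \<bullet> q \<ge> 0" "\<exists>q0\<in>probsimplex. (L$i1 - L$i) \<bullet> q0 > 0"
        and ac: "ac (ps i1) (S i1 q)" and le: "klr (ps i1) (S i1 q) \<le> \<delta> i1"
      obtain q1 where q1: "q1 \<in> probsimplex" "(L$i1 - L$i) \<bullet> q1 \<ge> 0" "S i1 q1 = S i1 p0"
        using e[OF pert_mono[OF P \<eta>(4)] q(1,3) ac le] by auto
      obtain q2 where q2: "q2 \<in> probsimplex" "(L$i1 - L$i) \<bullet> q2 > 0"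
        and ac2: "\<And>p i. ac p (S i p0) \<Longrightarrow> ac p (S i q2)"
        using interior_point q(4) by metis
      \<comment> \<open>The divergence at \<open>q1\<close> equals that at \<open>p0\<close> for
        action \<open>i1\<close>, so the strict inequality in \<open>pert\<close> leaves room for
        this step.\<close>
      obtain s where s: "0 < s" "s < 1"
        and sl: "(1 - s) * klr (ps i1) (S i1 q1) + s * klr (ps i1) (S i1 q2) < \<delta> i1"
        using mix_less_exists[of "klr (ps i1) (S i1 q1)" "\<delta> i1"] PD(7)[of i1] q1(3) by metis
      have acq2: "ac (ps k) (S k q2)" for k using ac2 PD(6) by blast
      define x where "x = (1 - s) *\<^sub>R q1 + s *\<^sub>R q2"
      have "x \<in> cellc L i1" unfolding x_def by (rule cellc_mix[OF q1(1) q2(1) s q(2) q1(2) q2(2)])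
      have "(L$i1 - L$i) \<bullet> x > 0"
        using q1(2) q2(2) s by (auto simp: x_def inner_add_right intro: add_nonneg_pos)
      moreover have "x \<in> probsimplex" unfolding x_def using s by (intro probsimplex_mix q1 q2) auto
      moreover have "klr (ps i1) (S i1 x) \<le> \<delta> i1"
        using klr_Smat_mix[OF q1(1) q2(1) PD(3) s, of i1 H i1] q1(3) PD(6)[of i1] acq2 sl by (simp add: x_def)
      moreover have "ac (ps k) (S k x)" for k
        unfolding x_def using acq2 by (intro ac_Smat_mix q1 q2 s) auto
      ultimately show "\<exists>q'\<in>probsimplex. (L$i1 - L$i) \<bullet> q' > 0 \<and> klr (ps i1) (S i1 q') \<le> \<delta> i1 \<and>
          (\<forall>k. ac (ps k) (S k q'))" by blast
    qed (rule PD)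
    have r1: "2 *\<^sub>R rstar \<in> Rset H L i1 ps \<delta>" using \<eta>1(2)[OF pert_mono[OF P \<eta>(2)]] .
    define X where "X = Rset H L i1 ps \<delta> \<inter> {r. cost L i1 p r \<le> cost L i1 p (2 *\<^sub>R rstar)}"
    have "closed X" unfolding X_def cost_def
      by (intro closed_Int cl closed_Collect_le continuous_intros)
    moreover have "bounded X"
    proof -
      define B where "B = cost L i1 p (2 *\<^sub>R rstar) / (gap / 2)"
      have "\<bar>r$k\<bar> \<le> \<bar>B\<bar>" if "r \<in> X" for r k
      proof (cases "k = i1")
        case False
        have r: "\<And>i. 0 \<le> r$i" and c: "cost L i1 p r \<le> cost L i1 p (2 *\<^sub>R rstar)"
          using that by (auto simp: X_def Rset_iff)
        have "r$k * (gap / 2) \<le> cost L i1 p (2 *\<^sub>R rstar)"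
          using cost_ge[OF P \<eta>(3) r False] c by simp
        then have "r$k \<le> B" using gap_pos by (simp add: B_def field_simps)
        then show ?thesis using r[of k] by simp
      qed (use that in \<open>auto simp: X_def Rset_iff\<close>)
      then have "norm r \<le> (\<Sum>k\<in>(UNIV::'n set). \<bar>B\<bar>)" if "r \<in> X" for r
        using that by (intro order_trans[OF norm_le_l1_cart] sum_mono) auto
      then show ?thesis unfolding bounded_iff by blast
    qed
    ultimately have "compact X" by (simp add: compact_eq_bounded_closed)
    moreover have "X \<noteq> {}" using r1 by (auto simp: X_def)
    moreover have "continuous_on X (cost L i1 p)" unfolding cost_def[abs_def] by (intro continuous_intros)
    ultimately obtain r where r: "r \<in> X" "\<And>r'. r' \<in> X \<Longrightarrow> cost L i1 p r \<le> cost L i1 p r'"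
      using continuous_attains_inf by metis
    have "r \<in> Ropt H L i1 p ps \<delta>"
      unfolding Ropt_iff
    proof (intro conjI ballI)
      fix r' assume "r' \<in> Rset H L i1 ps \<delta>"
      then show "cost L i1 p r \<le> cost L i1 p r'"
        using r r1 by (cases "r' \<in> X") (force simp: X_def)+
    qed (use r in \<open>auto simp: X_def\<close>)
    then show "Ropt H L i1 p ps \<delta> \<noteq> {}" by auto
  qed
qed

text \<open>A constraint of the true problem passes to the limit only if it binds in the perturbed
  problems too. A violated one is therefore moved to a point of the complement with finite
  divergences and the same \<open>i1\<close>-symbol distribution as \<open>p0\<close>, where
  everything is continuous.\<close>

lemma limit_in_Rset:
  assumes P: "\<And>n. pert (\<eta> n) (p n) (ps n) (\<delta> n)" and \<eta>: "\<eta> \<longlonglongrightarrow> 0"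
    and R: "\<And>n. R n \<in> Rset H L i1 (ps n) (\<delta> n)" and lim: "R \<longlonglongrightarrow> r"
  shows "r \<in> Rset0"
proof -
  note seq = pert_seq[OF P \<eta>]
  let ?P = "\<lambda>i. S i p0"
  have limk: "(\<lambda>n. R n $ k) \<longlonglongrightarrow> r$k" for k using lim by (rule tendsto_vec_nth)
  have r0: "0 \<le> r$k" for k
    using LIMSEQ_le_const[OF limk, of 0] R by (auto simp: Rset_iff)
  have rj: "r$i1 = 0"
    using LIMSEQ_unique[OF limk[of i1], of 0] R by (simp add: Rset_iff)
  show ?thesis
    unfolding Rset_iff
  proof (intro conjI allI ballI impI rj r0 leI notI)
    fix q assume q: "q \<in> clP (cellc L i1)" and ac1: "ac (?P i1) (S i1 q)"
      and le1: "klr (?P i1) (S i1 q) \<le> 0"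
      and ac: "\<forall>i. i \<noteq> i1 \<and> 0 < r$i \<longrightarrow> ac (?P i) (S i q)"
      and less: "wsum H i1 ?P (\<lambda>_. 0) r q < 1"
    have qp: "q \<in> probsimplex" using q by (simp add: clP_eq)
    have "q \<in> clP (cellc L i1) \<inter> Sdelta H i1 p0 0"
      using q qp ac1 le1 by (simp add: Sdelta_def KL_le_iff)
    then have "q \<in> clP (clP (cellc L i1) \<inter> Sdelta H i1 p0 0)"
      using clP_superset[of "clP (cellc L i1) \<inter> Sdelta H i1 p0 0"] by (auto simp: Sdelta_def)
    \<comment> \<open>Regularity: \<open>q\<close> is a limit of points in the interior of the
      complement that still have exactly the \<open>i1\<close>-symbol distribution of
      \<open>p0\<close>.\<close>
    then have "q \<in> clP (intP (cellc L i1) \<inter> Sdelta H i1 p0 0)" using reg by simp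
    then have "q \<in> closure (intP (cellc L i1) \<inter> Sdelta H i1 p0 0)"
      unfolding clP_eq by (meson Int_lower2 closure_mono IntD2 subsetD)
    then obtain x where x: "\<And>n. x n \<in> intP (cellc L i1) \<inter> Sdelta H i1 p0 0" and xl: "x \<longlonglongrightarrow> q"
      unfolding closure_sequential by blast
    have xc: "x n \<in> cellc L i1" for n
      using x[of n] interior_of_subset[of "top_of_set probsimplex" "cellc L i1"] by (auto simp: intP_def)
    have xp: "x n \<in> probsimplex" for n using x[of n] by (auto simp: Sdelta_def)
    have xS: "S i1 (x n) = ?P i1" for n
    proof -
      have "norm (?P i1 - S i1 (x n)) \<le> 2 * sqrt 0"
        using x[of n] by (intro norm_le_of_klr S0 Smat_probsimplex xp) (auto simp: Sdelta_def KL_le_iff)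
      then show ?thesis by simp
    qed
    have "(\<lambda>n. wsum H i1 ?P (\<lambda>_. 0) r (x n)) \<longlonglongrightarrow> wsum H i1 ?P (\<lambda>_. 0) r q"
      unfolding wsum_def
    proof (intro tendsto_sum)
      fix i assume i: "i \<in> UNIV - {i1}"
      show "(\<lambda>n. r$i * max 0 (klr (?P i) (S i (x n)) - 0)) \<longlonglongrightarrow> r$i * max 0 (klr (?P i) (S i q) - 0)"
      proof (cases "r$i = 0")
        case False
        then have "ac (?P i) (S i q)" using ac r0[of i] i by auto
        then show ?thesis
          by (intro tendsto_intros tendsto_max klr_tendsto_right Smat_tendsto xl)
            (use probsimplex_nonneg[OF S0] probsimplex_nonneg[OF Smat_probsimplex[OF qp]] in auto)
      qed auto
    qed
    then have "eventually (\<lambda>n. wsum H i1 ?P (\<lambda>_. 0) r (x n) < 1) sequentially"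
      using less by (rule order_tendstoD(2))
    moreover have "eventually (\<lambda>n. \<forall>i. i \<noteq> i1 \<and> 0 < r$i \<longrightarrow> ac (?P i) (S i (x n))) sequentially"
    proof (rule eventually_all_finite)
      fix i show "eventually (\<lambda>n. i \<noteq> i1 \<and> 0 < r$i \<longrightarrow> ac (?P i) (S i (x n))) sequentially"
      proof (cases "i \<noteq> i1 \<and> 0 < r$i")
        case True
        then have "ac (?P i) (S i q)" using ac by auto
        from klr_tendsto_right(2)[OF Smat_tendsto[OF xl] this probsimplex_nonneg[OF S0]
            probsimplex_nonneg[OF Smat_probsimplex[OF qp]]]
        show ?thesis by (rule eventually_mono) simp
      qed auto
    qed
    ultimately have "eventually (\<lambda>n. wsum H i1 ?P (\<lambda>_. 0) r (x n) < 1 \<and>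
        (\<forall>i. i \<noteq> i1 \<and> 0 < r$i \<longrightarrow> ac (?P i) (S i (x n)))) sequentially"
      by eventually_elim auto
    then obtain n0 where n0: "wsum H i1 ?P (\<lambda>_. 0) r (x n0) < 1"
      "\<And>i. i \<noteq> i1 \<Longrightarrow> 0 < r$i \<Longrightarrow> ac (?P i) (S i (x n0))"
      unfolding eventually_sequentially by auto
    define z where "z = x n0"
    obtain i where i: "i \<noteq> i1" "(L$i1 - L$i) \<bullet> z > 0" using xc[of n0] by (auto simp: cellc_iff z_def)
    have zp: "z \<in> probsimplex" using xp by (simp add: z_def)
    have "- ((L$i1 - L$i) \<bullet> z) < 0" using i by simp
    moreover have "(1 - s) * w + s * w < 1" if "w < 1" for s w :: real using that by (simp add: algebra_simps)
    ultimately obtain s where s: "0 < s" "s < 1" "(1 - s) * - ((L$i1 - L$i) \<bullet> z) + s * - ((L$i1 - L$i) \<bullet> p0) < 0"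
      using mix_less_exists[of "- ((L$i1 - L$i) \<bullet> z)" 0 "- ((L$i1 - L$i) \<bullet> p0)"] by blast
    \<comment> \<open>A short step to \<open>p0\<close> stays in the complement, keeps the
      \<open>i1\<close>-symbol distribution and dominates every \<open>ps n k\<close>. Hence
      \<open>y\<close> is admissible with finite divergences in every perturbed problem.\<close>
    define y where "y = (1 - s) *\<^sub>R z + s *\<^sub>R p0"
    have yp: "y \<in> probsimplex" unfolding y_def using s by (intro probsimplex_mix zp p0) auto
    have "y \<in> cellc L i1" unfolding cellc_iff using i(1) s yp by (auto simp: y_def inner_add_right intro!: exI[of _ i])
    then have yc: "y \<in> clP (cellc L i1)" using clP_superset[OF cellc_subset] by blast
    have yS: "S i1 y = ?P i1"
      unfolding y_def Smat_mix using xS[of n0] by (simp add: z_def scaleR_add_left[symmetric])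
    have acy: "ac p (S k y)" if "ac p (?P k)" for k p
      unfolding y_def using that s by (intro ac_Smat_mix zp p0) auto
    have "wsum H i1 ?P (\<lambda>_. 0) r y \<le> (1 - s) * wsum H i1 ?P (\<lambda>_. 0) r z + s * wsum H i1 ?P (\<lambda>_. 0) r p0"
      unfolding y_def using s n0 by (intro wsum_mix zp p0 S0 r0) (auto simp: z_def ac_self)
    also have "wsum H i1 ?P (\<lambda>_. 0) r p0 = 0" by (simp add: wsum_def klr_self)
    also have "(1 - s) * wsum H i1 ?P (\<lambda>_. 0) r z + s * 0 < 1"
    proof -
      have "wsum H i1 ?P (\<lambda>_. 0) r z \<ge> 0" using r0 by (auto simp: wsum_def intro!: sum_nonneg)
      then have "(1 - s) * wsum H i1 ?P (\<lambda>_. 0) r z \<le> 1 * wsum H i1 ?P (\<lambda>_. 0) r z"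
        using s by (intro mult_right_mono) auto
      then show ?thesis using n0(1) by (simp add: z_def)
    qed
    finally have wy: "wsum H i1 ?P (\<lambda>_. 0) r y < 1" .
    have "1 \<le> wsum H i1 (ps n) (\<delta> n) (R n) y" for n
    proof -
      have "\<forall>i. ac (ps n i) (S i y)" using acy pertD(6)[OF P] by blast
      moreover have "klr (ps n i1) (S i1 y) \<le> \<delta> n i1"
        unfolding yS using pertD(7)[OF P[of n], of i1] by simp
      ultimately show ?thesis using R[of n] yc unfolding Rset_iff by blast
    qed
    moreover have "(\<lambda>n. wsum H i1 (ps n) (\<delta> n) (R n) y) \<longlonglongrightarrow> wsum H i1 ?P (\<lambda>_. 0) r y"
      unfolding wsum_def
      by (intro tendsto_intros tendsto_max limk klr_tendsto_left seq)
        (use probsimplex_nonneg[OF S0] probsimplex_nonneg[OF Smat_probsimplex[OF yp]]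
          pertD(6)[OF P] acy[OF ac_self] in auto)
    ultimately have "1 \<le> wsum H i1 ?P (\<lambda>_. 0) r y" by (intro LIMSEQ_le_const) auto
    then show False using wy by simp
  qed
qed

text \<open>Optimal rates of shrinking perturbations accumulate at some \<open>r\<close>, which is
  feasible by \<open>limit_in_Rset\<close> and costs no more than \<open>rstar\<close>. Uniqueness
  forces \<open>r = rstar\<close>, against an excess of \<open>\<epsilon>\<close> in some
  coordinate.\<close>

lemma Ropt_upper:
  assumes "\<epsilon> > 0"
  obtains \<eta> where "\<eta> > 0"
    "\<And>p ps \<delta> r k. pert \<eta> p ps \<delta> \<Longrightarrow> r \<in> Ropt H L i1 p ps \<delta> \<Longrightarrow> r$k \<le> rstar$k + \<epsilon>"
proof (rule ccontr)
  assume contr: "\<not> thesis"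
  obtain \<eta>1 where \<eta>1: "\<eta>1 > 0" "\<And>p ps \<delta>. pert \<eta>1 p ps \<delta> \<Longrightarrow> 2 *\<^sub>R rstar \<in> Rset H L i1 ps \<delta>"
    using scaled_rstar_in_Rset[of 2] by auto
  define e where "e = min 1 (min \<eta>1 (gap / 2))"
  have e: "e > 0" "e \<le> 1" "e \<le> \<eta>1" "e \<le> gap / 2" using \<eta>1(1) gap_pos by (auto simp: e_def)
  define \<eta> where "\<eta> n = e / real (Suc n)" for n
  have \<eta>: "\<eta> \<longlonglongrightarrow> 0" unfolding \<eta>_def
    using tendsto_mult_right_zero[OF LIMSEQ_inverse_real_of_nat, of e] by (simp add: divide_inverse)
  have \<eta>e: "\<eta> n \<le> e" for n using e(1) by (simp add: \<eta>_def field_simps)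
  have "\<exists>p ps \<delta> r k. pert (\<eta> n) p ps \<delta> \<and> r \<in> Ropt H L i1 p ps \<delta> \<and> r$k > rstar$k + \<epsilon>" for n
  proof -
    have "\<eta> n > 0" using e by (simp add: \<eta>_def)
    then show ?thesis using contr that[of "\<eta> n"] by (meson not_le)
  qed
  then obtain p ps \<delta> R k where P: "\<And>n. pert (\<eta> n) (p n) (ps n) (\<delta> n)"
    and R: "\<And>n. R n \<in> Ropt H L i1 (p n) (ps n) (\<delta> n)" and big: "\<And>n. R n $ k n > rstar$k n + \<epsilon>"
    by metis
  have Rs: "R n \<in> Rset H L i1 (ps n) (\<delta> n)" and R0: "0 \<le> R n $ i" "R n $ i1 = 0" for n i
    using R[of n] by (auto simp: Ropt_iff Rset_iff)
  have rs0: "0 \<le> rstar$i" for i using rstar(1) by (simp add: Rset_iff)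
  \<comment> \<open>Twice \<open>rstar\<close> is feasible for the perturbed problem, and perturbed
    loss differences exceed the true ones by at most 1. Dividing by \<open>gap / 2\<close> turns
    this cost bound into a bound on single rates.\<close>
  define B where "B = (\<Sum>i\<in>UNIV. 2 * rstar$i * ((L$i - L$i1) \<bullet> p0 + 1)) / (gap / 2)"
  have Rbd: "\<bar>R n $ i\<bar> \<le> \<bar>B\<bar>" for n i
  proof (cases "i = i1")
    case False
    have "R n $ i * (gap / 2) \<le> cost L i1 (p n) (R n)"
      using cost_ge[OF P _ R0(1) False] \<eta>e e(4) order_trans by blast
    also have "\<dots> \<le> cost L i1 (p n) (2 *\<^sub>R rstar)"
      using R[of n] \<eta>1(2)[OF pert_mono[OF P]] \<eta>e e(3) order_trans unfolding Ropt_iff by blast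
    also have "\<dots> \<le> (\<Sum>i\<in>UNIV - {i1}. 2 * rstar$i * ((L$i - L$i1) \<bullet> p0 + 1))"
      unfolding cost_def
    proof (intro sum_mono)
      fix j
      have "\<bar>(L$j - L$i1) \<bullet> (p n - p0)\<bar> < 1"
        using pertD(2)[OF P[of n], of j] \<eta>e[of n] e(2) by linarith
      then have "(L$j - L$i1) \<bullet> p n \<le> (L$j - L$i1) \<bullet> p0 + 1" by (simp add: inner_diff_right)
      then show "(2 *\<^sub>R rstar)$j * ((L$j - L$i1) \<bullet> p n) \<le> 2 * rstar$j * ((L$j - L$i1) \<bullet> p0 + 1)"
        using rs0[of j] by (auto intro: mult_left_mono)
    qed
    also have "\<dots> \<le> (\<Sum>i\<in>UNIV. 2 * rstar$i * ((L$i - L$i1) \<bullet> p0 + 1))"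
      using rs0 by (intro sum_mono2) auto
    finally have "R n $ i \<le> B" using gap_pos by (simp add: B_def field_simps)
    then show ?thesis using R0(1)[of n i] by simp
  qed (use R0 in auto)
  have "norm (R n) \<le> (\<Sum>i\<in>(UNIV::'n set). \<bar>B\<bar>)" for n
    using Rbd by (intro order_trans[OF norm_le_l1_cart] sum_mono) auto
  then have "bounded (range R)" by (auto simp: bounded_iff)
  then obtain r s where s: "strict_mono s" and lr: "(R \<circ> s) \<longlonglongrightarrow> r"
    using bounded_imp_convergent_subsequence by blast
  have \<eta>s: "(\<lambda>n. \<eta> (s n)) \<longlonglongrightarrow> 0" using LIMSEQ_subseq_LIMSEQ[OF \<eta> s] by (simp add: o_def)
  have lr': "(\<lambda>n. R (s n)) \<longlonglongrightarrow> r" using lr by (simp add: o_def)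
  have rR: "r \<in> Rset0"
    by (rule limit_in_Rset[OF P \<eta>s Rs lr'])
  note seq = pert_seq[OF P \<eta>s]
  have limk: "(\<lambda>n. R (s n) $ k) \<longlonglongrightarrow> r$k" for k using lr' by (rule tendsto_vec_nth)
  have lc: "(\<lambda>n. cost L i1 (p (s n)) (R (s n))) \<longlonglongrightarrow> cost L i1 p0 r"
    unfolding cost_def by (intro tendsto_intros limk seq)
  \<comment> \<open>The rates \<open>rstar\<close> themselves may fail to be feasible after
    perturbation, so the comparison goes through \<open>c *\<^sub>R rstar\<close> and lets
    \<open>c\<close> tend to 1.\<close>
  have "cost L i1 p0 r \<le> c * cost L i1 p0 rstar" if c: "c > 1" for c
  proof -
    obtain \<eta>2 where \<eta>2: "\<eta>2 > 0" "\<And>p ps \<delta>. pert \<eta>2 p ps \<delta> \<Longrightarrow> c *\<^sub>R rstar \<in> Rset H L i1 ps \<delta>"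
      using scaled_rstar_in_Rset[OF c] by auto
    have lc': "(\<lambda>n. cost L i1 (p (s n)) (c *\<^sub>R rstar)) \<longlonglongrightarrow> cost L i1 p0 (c *\<^sub>R rstar)"
      unfolding cost_def by (intro tendsto_intros seq)
    have "eventually (\<lambda>n. \<eta> (s n) < \<eta>2) sequentially"
      using order_tendstoD(2)[OF \<eta>s \<eta>2(1)] .
    then have "eventually (\<lambda>n. cost L i1 (p (s n)) (R (s n)) \<le> cost L i1 (p (s n)) (c *\<^sub>R rstar)) sequentially"
    proof eventually_elim
      case (elim n)
      then show ?case using R[of "s n"] \<eta>2(2)[OF pert_mono[OF P]] unfolding Ropt_iff by (meson less_imp_le)
    qed
    from tendsto_le[OF trivial_limit_sequentially lc' lc this]
    have "cost L i1 p0 r \<le> cost L i1 p0 (c *\<^sub>R rstar)" .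
    also have "\<dots> = c * cost L i1 p0 rstar" by (simp add: cost_def sum_distrib_left algebra_simps)
    finally show ?thesis .
  qed
  then have "eventually (\<lambda>c. cost L i1 p0 r \<le> c * cost L i1 p0 rstar) (at_right 1)"
    by (auto simp: eventually_at_filter)
  moreover have "((\<lambda>c. c * cost L i1 p0 rstar) \<longlongrightarrow> 1 * cost L i1 p0 rstar) (at_right 1)"
    by (intro tendsto_intros)
  ultimately have "cost L i1 p0 r \<le> 1 * cost L i1 p0 rstar"
    by (intro tendsto_lowerbound) auto
  then have "r = rstar" using rstar(3)[OF rR] by simp
  have "eventually (\<lambda>n. \<forall>i. R (s n) $ i < rstar$i + \<epsilon>) sequentially"
  proof (rule eventually_all_finite)
    fix i show "eventually (\<lambda>n. R (s n) $ i < rstar$i + \<epsilon>) sequentially"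
      by (rule order_tendstoD(2)[OF limk]) (use \<open>r = rstar\<close> \<open>\<epsilon> > 0\<close> in simp)
  qed
  then obtain n where "\<forall>i. R (s n) $ i < rstar$i + \<epsilon>" unfolding eventually_sequentially by auto
  then show False using big[of "s n"] by (metis less_asym)
qed

end

section \<open>A likelihood-ratio supermartingale on histories\<close>

text \<open>Monotonicity of \<open>(1 + 1 / n) ^ n\<close>, cross-multiplied so that
  \<open>c = 0\<close> is covered through \<open>0 ^ 0 = 1\<close>.\<close>

lemma Suc_power_mult_mono:
  fixes c n :: nat
  assumes "c \<le> n"
  shows "(real c + 1) ^ c * real n ^ n \<le> real c ^ c * (real n + 1) ^ n"
  using assms
proof (induction n rule: dec_induct)
  case (step n)
  have mono: "(real n + 1) ^ n * (real n + 1) ^ Suc n \<le> real n ^ n * (real n + 2) ^ Suc n"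
  proof (cases "n = 0")
    case False
    define x where "x = real n"
    have x: "x > 0" using False by (simp add: x_def)
    \<comment> \<open>The base \<open>1 - 1 / (x + 1)\<^sup>2\<close> is the quotient of the
      consecutive numbers \<open>1 + 1 / (x + 1)\<close> and \<open>1 + 1 / x\<close>.\<close>
    have "1 + real n * (- 1 / (x + 1)\<^sup>2) \<le> (1 + (- 1 / (x + 1)\<^sup>2)) ^ n"
      using x one_le_power[of "x + 1" 2] by (intro Bernoulli_inequality) simp
    also have "1 + (- 1 / (x + 1)\<^sup>2) = ((x + 1)\<^sup>2 - 1) / (x + 1)\<^sup>2"
      using x by (simp add: diff_divide_distrib)
    also have "(x + 1)\<^sup>2 - 1 = x * (x + 2)" by (simp add: power2_eq_square algebra_simps)
    finally have "1 - x / (x + 1)\<^sup>2 \<le> (x * (x + 2) / (x + 1)\<^sup>2) ^ n" by (simp add: x_def)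
    then have "(1 - x / (x + 1)\<^sup>2) * (x + 2) \<le> (x * (x + 2) / (x + 1)\<^sup>2) ^ n * (x + 2)"
      using x by (intro mult_right_mono) auto
    moreover have "x + 1 \<le> (1 - x / (x + 1)\<^sup>2) * (x + 2)"
    proof -
      define D where "D = (x + 1)\<^sup>2"
      have D: "D > 0" using x by (simp add: D_def)
      have "(x + 1) * D \<le> (D - x) * (x + 2)"
        using x by (simp add: D_def power2_eq_square algebra_simps)
      then have "x + 1 \<le> (D - x) * (x + 2) / D" using D by (simp add: pos_le_divide_eq)
      also have "(D - x) * (x + 2) / D = (D - x) / D * (x + 2)" by simp
      also have "(D - x) / D = 1 - x / D" using D by (simp add: diff_divide_distrib)
      finally show ?thesis by (simp add: D_def)
    qed
    ultimately have "x + 1 \<le> (x * (x + 2) / (x + 1)\<^sup>2) ^ n * (x + 2)" by simp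
    then have "(x + 1) * ((x + 1)\<^sup>2) ^ n \<le> (x * (x + 2) / (x + 1)\<^sup>2) ^ n * (x + 2) * ((x + 1)\<^sup>2) ^ n"
      using x by (intro mult_right_mono) auto
    also have "\<dots> = (x * (x + 2)) ^ n * (x + 2)" using x by (simp add: power_divide)
    finally show ?thesis
      unfolding x_def[symmetric] power2_eq_square power_mult_distrib power_Suc by (simp only: mult_ac)
  qed simp
  have pos: "(real n + 1) ^ n > 0" by simp
  have "((real c + 1) ^ c * (real n + 1) ^ Suc n) * real n ^ n \<le>
     (real c ^ c * (real n + 1) ^ n) * (real n + 1) ^ Suc n"
    using mult_right_mono[OF step.IH, of "(real n + 1) ^ Suc n"] by (simp add: algebra_simps)
  also have "\<dots> \<le> real c ^ c * (real n ^ n * (real n + 2) ^ Suc n)"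
    using mult_left_mono[OF mono, of "real c ^ c"] by (simp add: algebra_simps)
  finally have "((real c + 1) ^ c * (real n + 1) ^ Suc n) * real n ^ n \<le> (real c ^ c * (real n + 2) ^ Suc n) * real n ^ n"
    by (simp add: algebra_simps)
  moreover have "real n ^ n > 0" by (cases n) auto
  ultimately have "(real c + 1) ^ c * (real n + 1) ^ Suc n \<le> real c ^ c * (real n + 2) ^ Suc n"
    by (rule mult_right_le_imp_le)
  then show ?case by (simp add: add.commute)
qed simp

lemma Ncount_eq_sum: "Ncount h i = (\<Sum>k\<in>(UNIV :: 'a::finite set). count_list h (i, k))"
proof (induction h)
  case (Cons x h)
  have "(\<Sum>k\<in>UNIV. count_list (x # h) (i, k)) =
      (\<Sum>k\<in>UNIV. (if x = (i, k) then 1 else 0) + count_list h (i, k))"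
    by (intro sum.cong) auto
  also have "\<dots> = (\<Sum>k\<in>UNIV. if k = snd x \<and> fst x = i then 1 else 0) + Ncount h i"
    unfolding sum.distrib Cons.IH by (intro arg_cong2[of _ _ _ _ "(+)"] sum.cong) (auto simp: prod_eq_iff)
  also have "\<dots> = Ncount (x # h) i"
    by (cases "fst x = i") (simp_all add: Ncount_def)
  finally show ?case by simp
qed (simp add: Ncount_def)

lemma Ncount_append [simp]: "Ncount (h @ [(i', k)]) i = Ncount h i + (if i' = i then 1 else 0)"
  by (simp add: Ncount_def)

lemma Ncount_Nil [simp]: "Ncount [] i = 0"
  by (simp add: Ncount_def)

lemma count_list_snoc: "count_list (h @ [x]) y = count_list h y + (if x = y then 1 else 0)"
  by simp

definition seen_null :: "'a::finite^'m^'n \<Rightarrow> real^'m \<Rightarrow> ('n \<times> 'a) list \<Rightarrow> 'n \<Rightarrow> bool" where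
  "seen_null H p h i \<longleftrightarrow> (\<exists>k. count_list h (i, k) \<noteq> 0 \<and> (Smat H i *v p) $ k = 0)"

text \<open>Powers of counts instead of \<open>exp\<close> and \<open>ln\<close>: one more
  observation changes explicit factors, and \<open>0 ^ 0 = 1\<close> covers unseen symbols and the
  empty history.\<close>

definition lratio :: "'a::finite^'m^'n \<Rightarrow> real^'m \<Rightarrow> ('n \<times> 'a) list \<Rightarrow> 'n \<Rightarrow> real" where
  "lratio H p h i = (\<Prod>k\<in>UNIV. (real (count_list h (i, k)) / (Smat H i *v p) $ k) ^ count_list h (i, k))
     / real (Ncount h i) ^ Ncount h i / (real (Ncount h i) + 1) ^ CARD('a)"

text \<open>The maximal likelihood ratio \<open>exp (N_i * D (emp_i || S_i p))\<close> divided by \<open>(N_i + 1) ^ A\<close>; it is a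
  supermartingale. Histories containing a symbol of probability 0 get an arbitrary value \<open>B\<close>.\<close>

definition evid :: "real \<Rightarrow> 'a::finite^'m^'n \<Rightarrow> real^'m \<Rightarrow> ('n \<times> 'a) list \<Rightarrow> 'n \<Rightarrow> real" where
  "evid B H p h i = (if seen_null H p h i then B else lratio H p h i)"

lemma evid_Nil: "evid B H p [] i = 1"
  by (simp add: evid_def seen_null_def lratio_def)

lemma evid_nonneg: "B \<ge> 0 \<Longrightarrow> p \<in> probsimplex \<Longrightarrow> evid B H p h i \<ge> 0"
  unfolding evid_def lratio_def
  by (auto intro!: divide_nonneg_nonneg prod_nonneg zero_le_power probsimplex_nonneg Smat_probsimplex)

lemma evid_other: "i' \<noteq> i \<Longrightarrow> evid B H p (h @ [(i', k)]) i = evid B H p h i"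
proof -
  assume "i' \<noteq> i"
  then have "seen_null H p (h @ [(i', k)]) i = seen_null H p h i"
    "lratio H p (h @ [(i', k)]) i = lratio H p h i"
    by (simp_all add: seen_null_def lratio_def)
  then show ?thesis by (simp add: evid_def)
qed

lemma sum_outcome_eq_sum_symbol:
  "(\<Sum>j\<in>UNIV. p $ j * G (H$i$j)) = (\<Sum>k\<in>UNIV. (Smat H i *v p) $ k * G k)"
proof -
  have "(\<Sum>k\<in>UNIV. (Smat H i *v p) $ k * G k) = (\<Sum>k\<in>UNIV. \<Sum>j\<in>UNIV. if H$i$j = k then p$j * G k else 0)"
    unfolding Smat_nth sum_distrib_right by (intro sum.cong) auto
  also have "\<dots> = (\<Sum>j\<in>UNIV. \<Sum>k\<in>UNIV. if H$i$j = k then p$j * G k else 0)" by (rule sum.swap)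
  also have "\<dots> = (\<Sum>j\<in>UNIV. p $ j * G (H$i$j))" by simp
  finally show ?thesis by simp
qed

text \<open>The symbol probability cancels against the new likelihood factor. What remains are
  quotients \<open>(x + 1) ^ (x + 1) / x ^ x\<close> at the symbol count and at the total;
  monotonicity of \<open>(1 + 1 / n) ^ n\<close> reduces them to an add-one weight.\<close>

lemma lratio_step:
  fixes H :: "'a::finite^'m::finite^'n::finite"
  assumes "p \<in> probsimplex" "(Smat H i *v p) $ k \<noteq> 0"
  shows "(Smat H i *v p) $ k * lratio H p (h @ [(i, k)]) i \<le> lratio H p h i *
     ((real (count_list h (i, k)) + 1) / (real (Ncount h i) + 1) * ((real (Ncount h i) + 1) / (real (Ncount h i) + 2)) ^ CARD('a))"
proof -
  define \<pi> where "\<pi> l = (Smat H i *v p) $ l" for l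
  define c where "c l = count_list h (i, l)" for l
  define n where "n = Ncount h i"
  define A where "A = CARD('a)"
  define G where "G = (\<Prod>l\<in>UNIV - {k}. (real (c l) / \<pi> l) ^ c l)"
  have \<pi>: "\<pi> l \<ge> 0" for l unfolding \<pi>_def by (intro probsimplex_nonneg Smat_probsimplex assms)
  have \<pi>k: "\<pi> k > 0" using assms(2) \<pi>[of k] by (simp add: \<pi>_def)
  have G0: "G \<ge> 0" unfolding G_def using \<pi> by (intro prod_nonneg) auto
  have cn: "c k \<le> n" unfolding c_def n_def Ncount_eq_sum by (rule member_le_sum) auto
  have l1: "lratio H p h i = (real (c k) / \<pi> k) ^ c k * G / real n ^ n / (real n + 1) ^ A"
    unfolding lratio_def A_def G_def c_def n_def \<pi>_def by (subst prod.remove[of _ k]) auto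
  have l2: "lratio H p (h @ [(i, k)]) i =
      ((real (c k) + 1) / \<pi> k) ^ Suc (c k) * G / (real n + 1) ^ Suc n / (real n + 2) ^ A"
  proof -
    have "lratio H p (h @ [(i, k)]) i =
      (\<Prod>l\<in>UNIV. (real (c l + (if k = l then 1 else 0)) / \<pi> l) ^ (c l + (if k = l then 1 else 0)))
       / real (n + 1) ^ (n + 1) / (real (n + 1) + 1) ^ A"
      unfolding lratio_def A_def c_def n_def \<pi>_def count_list_snoc by simp
    also have "(\<Prod>l\<in>UNIV. (real (c l + (if k = l then 1 else 0)) / \<pi> l) ^ (c l + (if k = l then 1 else 0))) =
      ((real (c k) + 1) / \<pi> k) ^ Suc (c k) * G"
      unfolding G_def by (subst prod.remove[of _ k]) (auto intro!: prod.cong simp: add.commute)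
    finally show ?thesis by (simp add: add.commute)
  qed
  have n0: "real n ^ n > 0" by (cases n) auto
  have "(real (c k) + 1) ^ c k / (real n + 1) ^ n \<le> real (c k) ^ c k / real n ^ n"
    using Suc_power_mult_mono[OF cn] n0 by (simp add: divide_simps)
  then have "(real (c k) + 1) ^ c k / (real n + 1) ^ n * (G / \<pi> k ^ c k * (real (c k) + 1) / (real n + 1) / (real n + 2) ^ A)
      \<le> real (c k) ^ c k / real n ^ n * (G / \<pi> k ^ c k * (real (c k) + 1) / (real n + 1) / (real n + 2) ^ A)"
    using G0 \<pi>k by (intro mult_right_mono) auto
  also have "(real (c k) + 1) ^ c k / (real n + 1) ^ n * (G / \<pi> k ^ c k * (real (c k) + 1) / (real n + 1) / (real n + 2) ^ A)
      = \<pi> k * lratio H p (h @ [(i, k)]) i"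
  proof -
    have "x / y * (G / z * u / v / w) = q * (u * x / (q * z) * G / (v * y) / w)"
      if "y > 0" "z > 0" "v > 0" "w > 0" "q > 0" for x y z u v w q :: real
      using that by (simp add: field_simps)
    from this[of "(real n + 1) ^ n" "\<pi> k ^ c k" "real n + 1" "(real n + 2) ^ A" "\<pi> k"
        "(real (c k) + 1) ^ c k" "real (c k) + 1"] \<pi>k
    show ?thesis unfolding l2 power_divide power_Suc by simp
  qed
  also have "real (c k) ^ c k / real n ^ n * (G / \<pi> k ^ c k * (real (c k) + 1) / (real n + 1) / (real n + 2) ^ A)
      = lratio H p h i * ((real (c k) + 1) / (real n + 1) * ((real n + 1) / (real n + 2)) ^ A)"
    unfolding l1 using \<pi>k n0 by (simp add: power_divide divide_simps)
  finally show ?thesis by (simp add: \<pi>_def c_def n_def A_def)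
qed

text \<open>Symbols of probability 0 carry no weight. Over the others the add-one weights sum to at
  most \<open>(n + A) / (n + 1)\<close>, which by Bernoulli's inequality is at most the growth of
  the normaliser; this is the origin of the exponent \<open>CARD('a)\<close>.\<close>

lemma evid_supermartingale:
  fixes H :: "'a::finite^'m::finite^'n::finite"
  assumes p: "p \<in> probsimplex" and "B \<ge> 0"
  shows "(\<Sum>j\<in>UNIV. p $ j * evid B H p (h @ [(i, H$i$j)]) i) \<le> evid B H p h i"
proof (cases "seen_null H p h i")
  case True
  then have "seen_null H p (h @ [(i, k)]) i" for k unfolding seen_null_def by auto
  then show ?thesis using True p by (simp add: evid_def sum_distrib_right[symmetric] probsimplex_def)
next
  case False
  define n where "n = real (Ncount h i)"
  define A where "A = CARD('a)"
  have n: "n \<ge> 0" by (simp add: n_def)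
  have L0: "lratio H p h i \<ge> 0" using evid_nonneg[OF \<open>B \<ge> 0\<close> p, of H h i] False by (simp add: evid_def)
  have "(\<Sum>j\<in>UNIV. p $ j * evid B H p (h @ [(i, H$i$j)]) i) =
     (\<Sum>k\<in>UNIV. (Smat H i *v p) $ k * evid B H p (h @ [(i, k)]) i)"
    by (rule sum_outcome_eq_sum_symbol)
  also have "\<dots> \<le> (\<Sum>k\<in>UNIV. lratio H p h i * ((real (count_list h (i, k)) + 1) / (n + 1) * ((n + 1) / (n + 2)) ^ A))"
  proof (rule sum_mono)
    fix k
    show "(Smat H i *v p) $ k * evid B H p (h @ [(i, k)]) i \<le>
       lratio H p h i * ((real (count_list h (i, k)) + 1) / (n + 1) * ((n + 1) / (n + 2)) ^ A)"
    proof (cases "(Smat H i *v p) $ k = 0")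
      case True
      then show ?thesis using L0 n by simp
    next
      case k: False
      then have "\<not> seen_null H p (h @ [(i, k)]) i" using False by (auto simp: seen_null_def split: if_splits)
      then show ?thesis using lratio_step[OF p k, of h] by (simp add: evid_def n_def A_def)
    qed
  qed
  also have "\<dots> = lratio H p h i * ((n + A) / (n + 1) * ((n + 1) / (n + 2)) ^ A)"
  proof -
    have "(\<Sum>k\<in>(UNIV::'a set). real (count_list h (i, k)) + 1) = n + A"
      unfolding n_def Ncount_eq_sum A_def by (simp add: sum.distrib)
    then show ?thesis
      unfolding sum_distrib_left[symmetric] sum_distrib_right[symmetric] sum_divide_distrib[symmetric]
      by simp
  qed
  also have "\<dots> \<le> lratio H p h i * 1"
  proof (rule mult_left_mono[OF _ L0])
    have "1 + real A * (1 / (n + 1)) \<le> (1 + 1 / (n + 1)) ^ A"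
      by (rule Bernoulli_inequality) (use n in \<open>simp add: field_simps\<close>)
    moreover have "(n + A) / (n + 1) \<le> 1 + real A * (1 / (n + 1))" using n by (simp add: field_simps)
    moreover have "1 + 1 / (n + 1) = (n + 2) / (n + 1)" using n by (simp add: field_simps)
    ultimately have "(n + A) / (n + 1) \<le> ((n + 2) / (n + 1)) ^ A" by simp
    then have "(n + A) / (n + 1) * ((n + 1) / (n + 2)) ^ A \<le> ((n + 2) / (n + 1)) ^ A * ((n + 1) / (n + 2)) ^ A"
      using n by (intro mult_right_mono) auto
    also have "\<dots> = 1" using n by (simp add: power_mult_distrib[symmetric])
    finally show "(n + A) / (n + 1) * ((n + 1) / (n + 2)) ^ A \<le> 1" .
  qed
  also have "\<dots> = evid B H p h i" using False by (simp add: evid_def)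
  finally show ?thesis .
qed

lemma emp_probsimplex:
  assumes "Ncount h i > 0" shows "emp h i \<in> probsimplex"
  using assms unfolding probsimplex_def emp_def
  by (simp add: sum_divide_distrib[symmetric] flip: of_nat_sum Ncount_eq_sum)

lemma evid_eq:
  fixes H :: "'a::finite^'m::finite^'n::finite"
  assumes p: "p \<in> probsimplex" and n: "Ncount h i > 0" 
  shows "evid B H p h i = (if ac (emp h i) (Smat H i *v p) then
     exp (real (Ncount h i) * klr (emp h i) (Smat H i *v p)) / (real (Ncount h i) + 1) ^ CARD('a) else B)"
proof -
  define \<pi> where "\<pi> l = (Smat H i *v p) $ l" for l
  define c where "c l = count_list h (i, l)" for l
  define N where "N = Ncount h i"
  have \<pi>: "\<pi> l \<ge> 0" for l unfolding \<pi>_def by (intro probsimplex_nonneg Smat_probsimplex assms)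
  have sn: "seen_null H p h i \<longleftrightarrow> \<not> ac (emp h i) (Smat H i *v p)"
    using n by (auto simp: seen_null_def ac_def emp_def)
  have "lratio H p h i = exp (real N * klr (emp h i) (Smat H i *v p)) / (real N + 1) ^ CARD('a)"
    if ac: "\<not> seen_null H p h i"
  proof -
    have "exp (real N * klr (emp h i) (Smat H i *v p)) = (\<Prod>k\<in>UNIV. exp (real (c k) * ln (real (c k) / real N / \<pi> k)))"
      using n unfolding klr_def sum_distrib_left exp_sum[OF finite]
      by (simp add: emp_def c_def \<pi>_def N_def)
    also have "\<dots> = (\<Prod>k\<in>UNIV. (real (c k) / \<pi> k) ^ c k / real N ^ c k)"
    proof (intro prod.cong refl)
      fix k
      show "exp (real (c k) * ln (real (c k) / real N / \<pi> k)) = (real (c k) / \<pi> k) ^ c k / real N ^ c k"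
      proof (cases "c k = 0")
        case False
        then have "\<pi> k \<noteq> 0" using ac unfolding seen_null_def c_def \<pi>_def by blast
        then have "\<pi> k > 0" using \<pi>[of k] by simp
        then have "real (c k) / real N / \<pi> k > 0" using False n by (simp add: N_def)
        then have "exp (real (c k) * ln (real (c k) / real N / \<pi> k)) = (real (c k) / real N / \<pi> k) ^ c k"
          by (simp add: exp_of_nat_mult)
        also have "\<dots> = (real (c k) / \<pi> k) ^ c k / real N ^ c k"
          by (simp add: power_divide field_simps)
        finally show ?thesis .
      qed auto
    qed
    also have "\<dots> = (\<Prod>k\<in>UNIV. (real (c k) / \<pi> k) ^ c k) / real N ^ N"
      unfolding prod_dividef power_sum[symmetric] by (simp add: N_def Ncount_eq_sum c_def)
    finally show ?thesis unfolding lratio_def by (simp add: c_def \<pi>_def N_def)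
  qed
  then show ?thesis using sn by (auto simp: evid_def N_def)
qed

text \<open>Adding 1 to each factor makes the product dominate the partial products over all sets of
  actions simultaneously, so the random set of deviating actions needs no separate treatment. A
  round changes one factor only.\<close>

definition joint_evid :: "real \<Rightarrow> 'a::finite^'m^'n \<Rightarrow> real^'m \<Rightarrow> ('n \<times> 'a) list \<Rightarrow> real" where
  "joint_evid B H p h = (\<Prod>i\<in>UNIV. 1 + evid B H p h i)"

lemma joint_evid_supermartingale:
  fixes H :: "'a::finite^'m::finite^'n::finite"
  assumes p: "p \<in> probsimplex" and "B \<ge> 0"
  shows "(\<Sum>j\<in>UNIV. p $ j * joint_evid B H p (h @ [(i, H$i$j)])) \<le> joint_evid B H p h"
proof -
  define G where "G = (\<Prod>l\<in>UNIV - {i}. 1 + evid B H p h l)"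
  have G0: "G \<ge> 0" unfolding G_def by (intro prod_nonneg) (simp add: evid_nonneg[OF \<open>B \<ge> 0\<close> p] add_nonneg_nonneg)
  have e: "joint_evid B H p (h @ [(i, k)]) = (1 + evid B H p (h @ [(i, k)]) i) * G" for k
    unfolding joint_evid_def G_def by (subst prod.remove[of _ i]) (auto simp: evid_other intro!: prod.cong)
  have "(\<Sum>j\<in>UNIV. p $ j * joint_evid B H p (h @ [(i, H$i$j)])) =
     ((\<Sum>j\<in>UNIV. p $ j) + (\<Sum>j\<in>UNIV. p $ j * evid B H p (h @ [(i, H$i$j)]) i)) * G"
    unfolding e sum.distrib[symmetric] sum_distrib_right by (simp add: algebra_simps)
  also have "\<dots> \<le> (1 + evid B H p h i) * G"
    using evid_supermartingale[OF p \<open>B \<ge> 0\<close>, of H h i] p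
    by (intro mult_right_mono G0) (simp add: probsimplex_def)
  also have "\<dots> = joint_evid B H p h"
    unfolding joint_evid_def G_def by (subst (2) prod.remove[of _ i]) auto
  finally show ?thesis .
qed

text \<open>Freezing the process at \<open>\<theta>\<close> once a prefix has reached it turns
  Markov's inequality at the last round into Ville's inequality for all rounds.\<close>

definition stopped :: "real \<Rightarrow> ('h list \<Rightarrow> real) \<Rightarrow> 'h list \<Rightarrow> real" where
  "stopped \<theta> F h = (if \<exists>s\<le>length h. \<theta> \<le> F (take s h) then \<theta> else F h)"

lemma stopped_supermartingale:
  assumes p: "p \<in> probsimplex"
    and F: "(\<Sum>j\<in>UNIV. p $ j * F (h @ [(i, H$i$j)])) \<le> F h"
  shows "(\<Sum>j\<in>UNIV. p $ j * stopped \<theta> F (h @ [(i, H$i$j)])) \<le> stopped \<theta> F h"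
proof (cases "\<exists>s\<le>length h. \<theta> \<le> F (take s h)")
  case True
  then have "stopped \<theta> F (h @ [x]) = \<theta>" for x
    unfolding stopped_def by (auto simp: le_Suc_eq)
  then show ?thesis using True p by (simp add: stopped_def sum_distrib_right[symmetric] probsimplex_def)
next
  case False
  have "stopped \<theta> F (h @ [x]) \<le> F (h @ [x])" for x
    using False unfolding stopped_def by (auto simp: le_Suc_eq)
  then have "(\<Sum>j\<in>UNIV. p $ j * stopped \<theta> F (h @ [(i, H$i$j)])) \<le> (\<Sum>j\<in>UNIV. p $ j * F (h @ [(i, H$i$j)]))"
    using p by (intro sum_mono mult_left_mono) (auto simp: probsimplex_def)
  also have "\<dots> \<le> stopped \<theta> F h" using F False by (auto simp: stopped_def)
  finally show ?thesis .
qed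

section \<open>Outcome sequences and the run of the algorithm\<close>

text \<open>An elementary form of adaptedness. With finitely many outcomes such a function factors
  through a finite discrete space, so it is measurable and integrable however irregular the
  selection functions are.\<close>

definition dep :: "nat \<Rightarrow> ((nat \<Rightarrow> 'm) \<Rightarrow> 'b) \<Rightarrow> bool" where
  "dep m g \<longleftrightarrow> (\<forall>w w'. (\<forall>s\<le>m. w s = w' s) \<longrightarrow> g w = g w')"

lemma dep_comp: "dep m g \<Longrightarrow> dep m (\<lambda>w. F (g w))"
  unfolding dep_def by metis

abbreviation outcomes :: "'m pmf \<Rightarrow> (nat \<Rightarrow> 'm) measure" where
  "outcomes P \<equiv> PiM UNIV (\<lambda>_::nat. measure_pmf P)"

lemma prob_space_outcomes: "prob_space (outcomes P)"
  by (intro prob_space_PiM measure_pmf.prob_space_axioms)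

lemma space_outcomes [simp]: "space (outcomes P) = UNIV"
  by (simp add: space_PiM PiE_UNIV_domain)

lemma dep_restrict:
  assumes "dep m g" shows "g = (\<lambda>w. g (restrict w {..m}))"
  using assms unfolding dep_def by (intro ext) (metis atMost_iff restrict_apply')

lemma dep_measurable:
  fixes P :: "'m::finite pmf"
  assumes "dep m g" shows "g \<in> measurable (outcomes P) (count_space UNIV)"
proof -
  have "(\<lambda>w. restrict w {..m}) \<in> measurable (outcomes P) (PiM {..m} (\<lambda>_. measure_pmf P))"
    by (rule measurable_restrict_subset) auto
  moreover have "sets (PiM {..m} (\<lambda>_. measure_pmf P)) = sets (count_space (PiE {..m} (\<lambda>_. UNIV)))"
    using sets_PiM_cong[of "{..m}" "{..m}" "\<lambda>_. measure_pmf P" "\<lambda>_. count_space (UNIV::'m set)"]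
      count_space_PiM_finite[of "{..m}" "\<lambda>_. UNIV::'m set"] by simp
  ultimately have "(\<lambda>w. restrict w {..m}) \<in> measurable (outcomes P) (count_space (PiE {..m} (\<lambda>_. UNIV)))"
    using measurable_cong_sets by blast
  from measurable_compose[OF this, of g "count_space UNIV"]
  show ?thesis by (subst dep_restrict[OF assms]) simp
qed

lemma dep_finite_range:
  fixes g :: "(nat \<Rightarrow> 'm::finite) \<Rightarrow> 'b"
  assumes "dep m g" shows "finite (range g)"
proof -
  have "range g \<subseteq> g ` (PiE {..m} (\<lambda>_. UNIV))"
    by (subst dep_restrict[OF assms]) auto
  then show ?thesis by (rule finite_subset) (intro finite_imageI finite_PiE, auto)
qed

lemma dep_integrable:
  fixes g :: "(nat \<Rightarrow> 'm::finite) \<Rightarrow> real"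
  assumes "dep m g" shows "integrable (outcomes P) g"
proof -
  interpret prob_space "outcomes P" by (rule prob_space_outcomes)
  have "finite (range (\<lambda>w. \<bar>g w\<bar>))" by (rule dep_finite_range[OF dep_comp[OF assms]])
  then have "\<bar>g w\<bar> \<le> Max (range (\<lambda>w. \<bar>g w\<bar>))" for w by (intro Max_ge) auto
  moreover have "g \<in> borel_measurable (outcomes P)"
    using measurable_compose[OF dep_measurable[OF assms], of "\<lambda>x. x" borel] by simp
  ultimately show ?thesis by (intro integrable_const_bound[where B="Max (range (\<lambda>w. \<bar>g w\<bar>))"]) auto
qed

lemma dep_sets:
  fixes P :: "'m::finite pmf"
  assumes "dep m Q" shows "{w. Q w} \<in> sets (outcomes P)"
proof -
  have "Q -` {True} \<inter> space (outcomes P) \<in> sets (outcomes P)"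
    by (rule measurable_sets[OF dep_measurable[OF assms]]) simp
  then show ?thesis by (simp add: vimage_def)
qed

text \<open>Redrawing one coordinate independently preserves the product measure. This takes the
  place of conditional expectations.\<close>

lemma integral_resample:
  fixes P :: "'m::finite pmf" and g :: "(nat \<Rightarrow> 'm) \<Rightarrow> real"
  assumes "dep m g"
  shows "(\<integral>w. g w \<partial>outcomes P) = (\<integral>w. (\<Sum>j\<in>UNIV. pmf P j * g (fun_upd w t j)) \<partial>outcomes P)"
proof -
  interpret M: prob_space "measure_pmf P" by (rule measure_pmf.prob_space_axioms)
  interpret O: prob_space "outcomes P" by (rule prob_space_outcomes)
  interpret pair: pair_prob_space "measure_pmf P" "outcomes P" ..
  let ?f = "\<lambda>(j, w). fun_upd w t j"
  have distr: "distr (measure_pmf P \<Otimes>\<^sub>M outcomes P) (outcomes P) ?f = outcomes P"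
    using distr_pair_PiM_eq_PiM[of UNIV "\<lambda>_. measure_pmf P" t]
    by (simp add: measure_pmf.prob_space_axioms)
  have meas: "?f \<in> measurable (measure_pmf P \<Otimes>\<^sub>M outcomes P) (outcomes P)"
  proof -
    have "(\<lambda>x. (snd x)(t := fst x)) \<in> measurable (measure_pmf P \<Otimes>\<^sub>M outcomes P) (PiM (insert t UNIV) (\<lambda>_. measure_pmf P))"
      by (intro measurable_fun_upd[where J=UNIV]) auto
    then show ?thesis by (simp add: case_prod_beta')
  qed
  have int: "integrable (measure_pmf P \<Otimes>\<^sub>M outcomes P) (\<lambda>x. g (?f x))"
    using integrable_distr_eq[OF meas, of g] dep_integrable[OF assms, of P] by (simp add: distr borel_measurable_integrable)
  have "(\<integral>w. g w \<partial>outcomes P) = (\<integral>x. g (?f x) \<partial>(measure_pmf P \<Otimes>\<^sub>M outcomes P))"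
    by (subst distr[symmetric], rule integral_distr[OF meas])
      (use dep_integrable[OF assms, of P] in \<open>simp add: borel_measurable_integrable\<close>)
  also have "\<dots> = (\<integral>w. (\<integral>j. g (fun_upd w t j) \<partial>measure_pmf P) \<partial>outcomes P)"
    using pair.integral_snd[of "\<lambda>j w. g (fun_upd w t j)"] int by (simp add: case_prod_beta')
  also have "\<dots> = (\<integral>w. (\<Sum>j\<in>UNIV. pmf P j * g (fun_upd w t j)) \<partial>outcomes P)"
    by (simp add: integral_measure_pmf_real[of UNIV] mult.commute)
  finally show ?thesis .
qed

lemma dep_markov:
  fixes P :: "'m::finite pmf" and F :: "(nat \<Rightarrow> 'm) \<Rightarrow> real"
  assumes F: "dep m F" and nn: "\<And>w. 0 \<le> F w" and le: "(\<integral>w. F w \<partial>outcomes P) \<le> B"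
    and Q: "dep m Q" and QF: "\<And>w. Q w \<Longrightarrow> \<theta> \<le> F w" and "\<theta> > 0"
  shows "measure (outcomes P) {w. Q w} \<le> B / \<theta>"
proof -
  interpret prob_space "outcomes P" by (rule prob_space_outcomes)
  have "measure (outcomes P) {w. Q w} \<le> measure (outcomes P) {w \<in> space (outcomes P). \<theta> \<le> F w}"
    using QF dep_sets[OF dep_comp[OF F, of "\<lambda>x. \<theta> \<le> x"], of P] by (intro finite_measure_mono) auto
  also have "\<dots> \<le> (\<integral>w. F w \<partial>outcomes P) / \<theta>"
    by (rule integral_Markov_inequality_measure[where A="{}"])
      (use dep_integrable[OF F] nn \<open>\<theta> > 0\<close> in auto)
  also have "\<dots> \<le> B / \<theta>" using le \<open>\<theta> > 0\<close> by (intro divide_right_mono) auto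
  finally show ?thesis .
qed

lemma pvec_probsimplex: "pvec P \<in> (probsimplex :: (real^'m::finite) set)"
  by (simp add: probsimplex_def pvec_def sum_pmf_eq_1)

locale pm_run =
  fixes L :: "real^'m::finite^'n::finite" and H :: "'a::finite^'m^'n" and P :: "'m pmf"
    and a b c :: real and ordr :: "'n list"
    and selP :: "nat \<Rightarrow> ('n \<times> 'a) list \<Rightarrow> real^'m"
    and selI :: "nat \<Rightarrow> ('n \<times> 'a) list \<Rightarrow> 'n"
    and selR :: "nat \<Rightarrow> ('n \<times> 'a) list \<Rightarrow> (real^'n) option"
  assumes ordr: "distinct ordr" "set ordr = UNIV"
begin

abbreviation E where "E g \<equiv> \<integral>w. g w \<partial>outcomes P"
abbreviation Prob where "Prob Q \<equiv> measure (outcomes P) {w. Q w}"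

definition st where "st w n = alg_state ordr H L a b c selP selI selR w n"
definition hist where "hist w n = snd (snd (snd (st w n)))"
definition queue where "queue w n = (if fst (st w n) = [] then filter (\<lambda>i. i \<in> fst (snd (snd (st w n)))) ordr else fst (st w n))"
definition act where "act w n = hd (queue w n)"
text \<open>Rounds are numbered from 1 and the first \<open>length ordr\<close> of them are the
  initial plays, so this is the round played from state \<open>n\<close>.\<close>

definition rnd :: "nat \<Rightarrow> nat" where "rnd n = length ordr + 1 + n"

lemma length_ordr: "length ordr = CARD('n)"
  using ordr distinct_card by metis

lemma st_dep: "dep (length ordr + n) (\<lambda>w. st w n)"
proof (induction n)
  case 0
  show ?case unfolding dep_def st_def by auto
next
  case (Suc n)
  show ?case
    unfolding dep_def
  proof (intro allI impI)
    fix w w' :: "nat \<Rightarrow> 'm" assume eq: "\<forall>s\<le>length ordr + Suc n. w s = w' s"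
    then have "st w n = st w' n" using Suc unfolding dep_def by auto
    moreover have "w (length ordr + 1 + n) = w' (length ordr + 1 + n)" using eq by auto
    ultimately show "st w (Suc n) = st w' (Suc n)"
      unfolding st_def alg_state.simps alg_step_def by simp
  qed
qed

lemma hist_dep: "dep (length ordr + n) (\<lambda>w. hist w n)"
  unfolding hist_def by (rule dep_comp[OF st_dep])

lemma hist_Suc: "hist w (Suc n) = hist w n @ [(act w n, H $ act w n $ w (rnd n))]"
proof -
  obtain Q0 ZR0 ZN0 h where e: "st w n = (Q0, ZR0, ZN0, h)" by (metis prod_cases4)
  then have "st w (Suc n) = alg_step ordr H L a b c selP selI selR w (rnd n) (Q0, ZR0, ZN0, h)"
    by (simp add: st_def rnd_def)
  then show ?thesis
    by (cases "Q0 = []") (simp_all add: hist_def act_def queue_def e alg_step_def Let_def)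
qed

lemma length_hist: "length (hist w n) = length ordr + n"
proof (induction n)
  case 0 show ?case by (simp add: hist_def st_def)
qed (simp add: hist_Suc)

lemma hist_prefix: "n \<le> n' \<Longrightarrow> take (length ordr + n) (hist w n') = hist w n"
proof (induction n' rule: dec_induct)
  case base show ?case by (simp add: length_hist)
next
  case (step n')
  then show ?case by (simp add: hist_Suc length_hist)
qed

text \<open>The hypothesis holds for every action that might be appended, so the way in which the
  algorithm chooses actions is irrelevant.\<close>

lemma expectation_hist_le:
  assumes F: "\<And>h i. (\<Sum>j\<in>UNIV. pvec P $ j * F (h @ [(i, H$i$j)])) \<le> F h"
  shows "E (\<lambda>w. F (hist w n)) \<le> F []"
proof (induction n)
  case 0
  \<comment> \<open>The initial plays are not steps of \<open>alg_state\<close>, so they need their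
    own induction over prefixes of the first history.\<close>
  define g where "g w m = F (map (\<lambda>k. (ordr ! k, H$(ordr ! k)$(w (Suc k)))) [0..<m])" for w m
  have dep: "dep m (\<lambda>w. g w m)" for m
    unfolding g_def dep_def by (intro allI impI arg_cong[of _ _ F] map_cong refl) auto
  have "E (\<lambda>w. g w m) \<le> F []" for m
  proof (induction m)
    case 0
    interpret prob_space "outcomes P" by (rule prob_space_outcomes)
    show ?case using prob_space by (simp add: g_def)
  next
    case (Suc m)
    have gm: "g (fun_upd w (Suc m) j) (Suc m) = F (map (\<lambda>k. (ordr ! k, H$(ordr ! k)$(w (Suc k)))) [0..<m] @ [(ordr ! m, H$(ordr ! m)$j)])" for w j
    proof -
      have "map (\<lambda>k. (ordr ! k, H$(ordr ! k)$(fun_upd w (Suc m) j (Suc k)))) [0..<m] =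
          map (\<lambda>k. (ordr ! k, H$(ordr ! k)$(w (Suc k)))) [0..<m]"
        by (rule map_cong) auto
      moreover have "fun_upd w (Suc m) j (Suc m) = j" by simp
      ultimately show ?thesis unfolding g_def upt_Suc by (simp only: map_append list.map if_True zero_le)
    qed
    have depS: "dep (Suc m) (\<lambda>w. \<Sum>j\<in>UNIV. pmf P j * g (fun_upd w (Suc m) j) (Suc m))"
      unfolding gm dep_def
      by (intro allI impI sum.cong refl arg_cong2[of _ _ _ _ "(*)"] arg_cong[of _ _ F] arg_cong2[of _ _ _ _ "(@)"] map_cong) auto
    have "E (\<lambda>w. g w (Suc m)) = E (\<lambda>w. (\<Sum>j\<in>UNIV. pmf P j * g (fun_upd w (Suc m) j) (Suc m)))"
      by (rule integral_resample[OF dep])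
    also have "\<dots> \<le> E (\<lambda>w. g w m)"
    proof (rule integral_mono[OF dep_integrable[OF depS] dep_integrable[OF dep]])
      fix w
      show "(\<Sum>j\<in>UNIV. pmf P j * g (fun_upd w (Suc m) j) (Suc m)) \<le> g w m"
        unfolding gm using F by (simp add: g_def pvec_def)
    qed
    finally show ?case using Suc by simp
  qed
  then show ?case by (simp add: hist_def st_def g_def)
next
  case (Suc n)
  let ?t = "rnd n"
  \<comment> \<open>The state, and with it the action of this round, is fixed by earlier outcomes;
    only the observed symbol reacts to resampling.\<close>
  have same: "st (fun_upd w ?t j) n = st w n" for w j
    using st_dep[of n] unfolding dep_def rnd_def by auto
  have upd: "hist (fun_upd w ?t j) (Suc n) = hist w n @ [(act w n, H $ act w n $ j)]" for w j
    unfolding hist_Suc by (simp add: hist_def act_def queue_def same)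
  have stn: "dep (length ordr + n) (\<lambda>w. (hist w n, act w n))"
    using dep_comp[OF st_dep[of n], of "\<lambda>s. (snd (snd (snd s)), hd (if fst s = [] then filter (\<lambda>i. i \<in> fst (snd (snd s))) ordr else fst s))"]
    by (simp add: hist_def act_def queue_def)
  have depS: "dep (length ordr + n) (\<lambda>w. \<Sum>j\<in>UNIV. pmf P j * F (hist (fun_upd w ?t j) (Suc n)))"
    unfolding upd using dep_comp[OF stn, of "\<lambda>(h, i). \<Sum>j\<in>UNIV. pmf P j * F (h @ [(i, H $ i $ j)])"] by simp
  have "E (\<lambda>w. F (hist w (Suc n))) = E (\<lambda>w. (\<Sum>j\<in>UNIV. pmf P j * F (hist (fun_upd w ?t j) (Suc n))))"
    by (rule integral_resample[OF dep_comp[OF hist_dep]])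
  also have "\<dots> \<le> E (\<lambda>w. F (hist w n))"
  proof (rule integral_mono[OF dep_integrable[OF depS] dep_integrable[OF dep_comp[OF hist_dep]]])
    fix w
    show "(\<Sum>j\<in>UNIV. pmf P j * F (hist (fun_upd w ?t j) (Suc n))) \<le> F (hist w n)"
      unfolding upd using F by (simp add: pvec_def)
  qed
  finally show ?case using Suc by simp
qed

end

section \<open>Bookkeeping of the action lists\<close>

lemma subroutine_superset: "ZN \<subseteq> subroutine H L a b c selP selI selR t h ZR ZN"
  unfolding subroutine_def Let_def by (auto split: option.split)

lemma subroutine_best:
  "selI t h \<notin> ZR \<Longrightarrow> selI t h \<in> subroutine H L a b c selP selI selR t h ZR ZN"
  unfolding subroutine_def Let_def by (auto split: option.split)

lemma subroutine_uncertain: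
  assumes "selP t h \<notin> cell_margin L (selI t h) (alpha a t)
     \<or> (\<exists>i. KL (emp h i) (Smat H i *v selP t h) > ereal (fexp b (Ncount h i)))
     \<or> (\<exists>i. real (Ncount h i) < c * sqrt (ln (real t)))"
  shows "k \<in> ZR \<or> k \<in> subroutine H L a b c selP selI selR t h ZR ZN"
  using assms unfolding subroutine_def Let_def by (auto split: option.split)

abbreviation rates :: "nat \<Rightarrow> ('n \<times> 'a) list \<Rightarrow> 'n \<Rightarrow> real^'n" where
  "rates t h j \<equiv> (\<chi> i. if i = j then 0 else real (Ncount h i) / ln (real t))"

lemma subroutine_None:
  assumes "rates t h (selI t h) \<notin> Rset H L (selI t h) (emp h) (\<lambda>i. fexp b (Ncount h i))"
    and "selR t h = None"
  shows "k \<in> ZR \<or> k \<in> subroutine H L a b c selP selI selR t h ZR ZN"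
  using assms unfolding subroutine_def Let_def by auto

lemma subroutine_Some:
  assumes "rates t h (selI t h) \<notin> Rset H L (selI t h) (emp h) (\<lambda>i. fexp b (Ncount h i))"
    and "selR t h = Some r" and "r$k > real (Ncount h k) / ln (real t)"
  shows "k \<in> ZR \<or> k \<in> subroutine H L a b c selP selI selR t h ZR ZN"
  using assms unfolding subroutine_def Let_def by auto

lemma subroutine_added:
  assumes "k \<in> subroutine H L a b c selP selI selR t h ZR ZN" "k \<notin> ZN"
  shows "k \<notin> ZR \<and> (k = selI t h
     \<or> selP t h \<notin> cell_margin L (selI t h) (alpha a t)
     \<or> (\<exists>i. KL (emp h i) (Smat H i *v selP t h) > ereal (fexp b (Ncount h i)))
     \<or> (\<exists>i. real (Ncount h i) < c * sqrt (ln (real t)))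
     \<or> (rates t h (selI t h) \<notin> Rset H L (selI t h) (emp h) (\<lambda>i. fexp b (Ncount h i)) \<and>
         (selR t h = None \<or> (\<exists>r. selR t h = Some r \<and> r$k > real (Ncount h k) / ln (real t)))))"
  using assms unfolding subroutine_def Let_def by (auto split: option.splits if_splits)

lemma Ncount_eq_filter: "Ncount h i = length (filter (\<lambda>x. x = i) (map fst h))"
  by (simp add: Ncount_def filter_map o_def)

context pm_run
begin

text \<open>\<open>q0\<close>, \<open>zr0\<close> and \<open>zn0\<close> are read before a possible
  restart of the for-loop; \<open>restR\<close> and \<open>znC\<close> are the values after it that
  the subroutine receives.\<close>

definition q0 where "q0 w n = fst (st w n)"
definition zr0 where "zr0 w n = fst (snd (st w n))"
definition zn0 where "zn0 w n = fst (snd (snd (st w n)))"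
definition restR where "restR w n = (if q0 w n = [] then zn0 w n else zr0 w n) - {act w n}"
definition znC where "znC w n = (if q0 w n = [] then {} else zn0 w n)"
definition newN where
  "newN w n = subroutine H L a b c selP selI selR (rnd n) (hist w n) (restR w n) (znC w n)"

lemma queue_eq: "queue w n = (if q0 w n = [] then filter (\<lambda>i. i \<in> zn0 w n) ordr else q0 w n)"
  by (simp add: queue_def q0_def zn0_def)

lemma st_Suc:
  "q0 w (Suc n) = tl (queue w n)" "zr0 w (Suc n) = restR w n" "zn0 w (Suc n) = newN w n"
proof -
  obtain Q0 ZR0 ZN0 h where e: "st w n = (Q0, ZR0, ZN0, h)" by (metis prod_cases4)
  then have s: "st w (Suc n) = alg_step ordr H L a b c selP selI selR w (rnd n) (Q0, ZR0, ZN0, h)"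
    by (simp add: st_def rnd_def)
  note defs = hist_def act_def queue_def newN_def restR_def znC_def q0_def zr0_def zn0_def e alg_step_def Let_def
  show "q0 w (Suc n) = tl (queue w n)" "zr0 w (Suc n) = restR w n" "zn0 w (Suc n) = newN w n"
    unfolding q0_def[of _ "Suc n"] zr0_def[of _ "Suc n"] zn0_def[of _ "Suc n"] s
    by (cases "Q0 = []"; simp add: defs)+
qed

text \<open>When the queue runs out, \<open>restR\<close> is empty, so the apparently optimal action
  is put into the next list. Hence a restart never yields an empty queue and \<open>hd\<close> is
  well defined.\<close>

lemma queue_inv:
  "distinct (q0 w n) \<and> set (q0 w n) = zr0 w n \<and> (q0 w n = [] \<longrightarrow> zn0 w n \<noteq> {})"
proof (induction n)
  case 0
  have "ordr \<noteq> []" using ordr(2) by auto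
  then show ?case using ordr by (simp add: q0_def zr0_def zn0_def st_def)
next
  case (Suc n)
  have Q: "distinct (queue w n)" "set (queue w n) = (if q0 w n = [] then zn0 w n else zr0 w n)" "queue w n \<noteq> []"
    using Suc ordr unfolding queue_eq by (auto simp: filter_empty_conv)
  obtain x xs where x: "queue w n = x # xs" using Q(3) by (cases "queue w n") auto
  have "set (tl (queue w n)) = restR w n" "distinct (tl (queue w n))"
    unfolding restR_def act_def Q(2)[symmetric] using Q(1) by (auto simp: x)
  moreover have "newN w n \<noteq> {}" if "restR w n = {}"
    using subroutine_best[of selI "rnd n" "hist w n" "restR w n"] that unfolding newN_def by blast
  ultimately show ?case unfolding st_Suc by auto
qed

lemma queue_facts:
  "distinct (queue w n)" "set (queue w n) = insert (act w n) (restR w n)" "queue w n \<noteq> []"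
  "act w n \<notin> restR w n" "set (tl (queue w n)) = restR w n" "length (queue w n) \<le> CARD('n)"
proof -
  have Q: "distinct (queue w n)" "set (queue w n) = (if q0 w n = [] then zn0 w n else zr0 w n)" "queue w n \<noteq> []"
    using queue_inv[of w n] ordr unfolding queue_eq by (auto simp: filter_empty_conv)
  obtain x xs where x: "queue w n = x # xs" using Q(3) by (cases "queue w n") auto
  show "distinct (queue w n)" "set (queue w n) = insert (act w n) (restR w n)" "queue w n \<noteq> []"
     "act w n \<notin> restR w n" "set (tl (queue w n)) = restR w n"
    unfolding restR_def act_def Q(2)[symmetric] using Q(1) by (auto simp: x)
  show "length (queue w n) \<le> CARD('n)"
    using Q(1) distinct_card[OF Q(1)] card_mono[of UNIV "set (queue w n)"] by simp
qed

lemma Ncount_hist_0: "Ncount (hist w 0) i = 1"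
proof -
  have "map fst (hist w 0) = map (\<lambda>k. ordr ! k) [0..<length ordr]"
    by (simp add: hist_def st_def o_def)
  then have "map fst (hist w 0) = ordr" by (simp add: map_nth)
  then show ?thesis
    using ordr by (simp add: Ncount_eq_filter distinct_length_filter)
qed

lemma Ncount_hist_Suc: "Ncount (hist w (Suc n)) i = Ncount (hist w n) i + (if act w n = i then 1 else 0)"
  by (simp add: hist_Suc)

lemma Ncount_hist_mono: "n \<le> n' \<Longrightarrow> Ncount (hist w n) i \<le> Ncount (hist w n') i"
  by (rule lift_Suc_mono_le[of "\<lambda>n. Ncount (hist w n) i"]) (auto simp: Ncount_hist_Suc)

lemma Ncount_hist_pos: "Ncount (hist w n) i > 0"
  using Ncount_hist_mono[of 0 n w i] by (simp add: Ncount_hist_0)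

section \<open>Counting rounds by sample sizes\<close>

definition pend where "pend w n k \<longleftrightarrow> k \<in> restR w n \<or> k \<in> newN w n"
definition added where "added w n k \<longleftrightarrow> k \<in> newN w n \<and> k \<notin> znC w n"

text \<open>A play moves one unit from the queue to the counter and a restart of the loop moves units
  from \<open>Z\<^sub>N\<close> to the queue, so \<open>pot\<close> grows exactly with the additions to \<open>Z\<^sub>N\<close>.\<close>

definition pot where
  "pot w n k = Ncount (hist w n) k + (if k \<in> set (q0 w n) then 1 else 0) + (if k \<in> zn0 w n then 1 else 0)"

lemma newN_superset: "znC w n \<subseteq> newN w n"
  unfolding newN_def by (rule subroutine_superset)

lemma added_not_restR: "added w n k \<Longrightarrow> k \<notin> restR w n"
  unfolding added_def newN_def using subroutine_added by blast

lemma pot_Suc: "pot w (Suc n) k = pot w n k + (if added w n k then 1 else 0)"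
proof -
  have "pot w n k = Ncount (hist w n) k + (if k \<in> set (queue w n) then 1 else 0) + (if k \<in> znC w n then 1 else 0)"
    unfolding pot_def queue_eq znC_def using ordr(2) by auto
  moreover have "pot w (Suc n) k = Ncount (hist w n) k + (if act w n = k then 1 else 0)
      + (if k \<in> restR w n then 1 else 0) + (if k \<in> newN w n then 1 else 0)"
    unfolding pot_def st_Suc Ncount_hist_Suc queue_facts(5) ..
  ultimately show ?thesis
    using queue_facts(2)[of w n] queue_facts(4)[of w n] newN_superset[of w n] by (auto simp: added_def)
qed

text \<open>An addition made while the count is at most \<open>x\<close> leaves the potential at
  most \<open>x + 2\<close>: the action is not waiting in the queue, so only the current play and
  its new entry are added. Later additions are counted one by one. Initially the single play and the
  queue entry also make 2.\<close>

lemma pot_le: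
  assumes "x \<ge> 0"
  shows "real (pot w M k) \<le> x + 2 + real (card {n. n < M \<and> added w n k \<and> real (Ncount (hist w n) k) > x})"
proof (induction M)
  case 0
  have "pot w 0 k = 2" using ordr(2) by (simp add: pot_def Ncount_hist_0) (simp add: q0_def zn0_def st_def)
  then show ?case using assms by simp
next
  case (Suc M)
  define S where "S M = {n. n < M \<and> added w n k \<and> real (Ncount (hist w n) k) > x}" for M
  have fin: "finite (S M)" for M by (simp add: S_def)
  have sub: "S M \<subseteq> S (Suc M)" by (auto simp: S_def)
  then have mono: "card (S M) \<le> card (S (Suc M))" by (intro card_mono fin)
  show ?case
  proof (cases "added w M k")
    case False
    then show ?thesis using Suc mono by (simp add: pot_Suc S_def)
  next
    case True
    show ?thesis
    proof (cases "real (Ncount (hist w M) k) > x")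
      case gt: True
      have "S (Suc M) = insert M (S M)" using True gt by (auto simp: S_def less_Suc_eq)
      then have "card (S (Suc M)) = Suc (card (S M))" using fin by (simp add: S_def)
      then show ?thesis using Suc True by (simp add: pot_Suc S_def)
    next
      case False
      have "pot w (Suc M) k \<le> Ncount (hist w M) k + 2"
        using added_not_restR[OF True] unfolding pot_def st_Suc Ncount_hist_Suc queue_facts(5) by simp
      then have "real (pot w (Suc M) k) \<le> x + 2" using False by linarith
      then show ?thesis by simp
    qed
  qed
qed

lemma Ncount_le:
  assumes "x \<ge> 0"
  shows "real (Ncount (hist w M) k) \<le> x + 2 + real (card {n. n < M \<and> added w n k \<and> real (Ncount (hist w n) k) > x})"
proof -
  have "Ncount (hist w M) k \<le> pot w M k" by (simp add: pot_def)
  then show ?thesis using pot_le[OF assms, of w M k] by linarith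
qed

text \<open>\<open>m\<close> bounds the waiting time: the rest of the current queue, and one more
  full pass if the action is only in the next list.\<close>

lemma catch_up_aux:
  assumes "k \<in> set (q0 w n) \<and> length (q0 w n) \<le> m \<or> k \<in> zn0 w n \<and> length (q0 w n) + CARD('n) \<le> m"
  shows "Ncount (hist w n) k < Ncount (hist w (n + m)) k"
  using assms
proof (induction m arbitrary: n)
  case 0
  then show ?case by auto
next
  case (Suc m)
  show ?case
  proof (cases "act w n = k")
    case True
    then have "Ncount (hist w n) k < Ncount (hist w (Suc n)) k" by (simp add: Ncount_hist_Suc)
    also have "\<dots> \<le> Ncount (hist w (n + Suc m)) k" by (rule Ncount_hist_mono) simp
    finally show ?thesis .
  next
    case False
    have "k \<in> set (q0 w (Suc n)) \<and> length (q0 w (Suc n)) \<le> m \<or>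
        k \<in> zn0 w (Suc n) \<and> length (q0 w (Suc n)) + CARD('n) \<le> m"
    proof (cases "k \<in> set (queue w n)")
      case True
      then have "k \<in> set (tl (queue w n))" using False queue_facts[of w n] by auto
      moreover have "length (queue w n) \<le> Suc m"
        using Suc.prems queue_facts(6)[of w n] unfolding queue_eq by (auto split: if_splits)
      ultimately show ?thesis unfolding st_Suc length_tl by (intro disjI1 conjI) auto
    next
      case notin: False
      then have ne: "q0 w n \<noteq> []" and "k \<notin> set (q0 w n)"
        using Suc.prems ordr(2) unfolding queue_eq by (auto split: if_splits)
      then have k: "k \<in> zn0 w n" "length (q0 w n) + CARD('n) \<le> Suc m" using Suc.prems by auto
      then have "k \<in> newN w n" using ne newN_superset[of w n] by (auto simp: znC_def)
      moreover have "length (tl (queue w n)) + CARD('n) \<le> m" using k ne unfolding queue_eq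
        by (cases "q0 w n") auto
      ultimately show ?thesis unfolding st_Suc by simp
    qed
    from Suc.IH[OF this] have "Ncount (hist w (Suc n)) k < Ncount (hist w (n + Suc m)) k" by simp
    moreover have "Ncount (hist w n) k \<le> Ncount (hist w (Suc n)) k" by (rule Ncount_hist_mono) simp
    ultimately show ?thesis by simp
  qed
qed

lemma catch_up:
  assumes "pend w n k"
  shows "Ncount (hist w n) k < Ncount (hist w (Suc n + 2 * CARD('n))) k"
proof -
  have len: "length (q0 w (Suc n)) \<le> CARD('n)" using queue_facts(6)[of w n] unfolding st_Suc by simp
  have "Ncount (hist w (Suc n)) k < Ncount (hist w (Suc n + 2 * CARD('n))) k"
    using assms len unfolding pend_def by (intro catch_up_aux) (auto simp: st_Suc queue_facts)
  moreover have "Ncount (hist w n) k \<le> Ncount (hist w (Suc n)) k" by (rule Ncount_hist_mono) simp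
  ultimately show ?thesis by simp
qed

text \<open>A pending action is played within \<open>2 * CARD('n) + 1\<close> rounds, so all rounds
  in which it is pending at the same count lie in one window of that length.\<close>

lemma card_rounds_single:
  assumes "finite R" "\<And>n. n \<in> R \<Longrightarrow> pend w n k \<and> Ncount (hist w n) k = v"
  shows "card R \<le> 2 * CARD('n) + 1"
proof (cases "R = {}")
  case False
  define m where "m = Min R"
  have m: "m \<in> R" unfolding m_def using assms(1) False by (rule Min_in)
  have "R \<subseteq> {m..<Suc m + 2 * CARD('n)}"
  proof
    fix n assume n: "n \<in> R"
    have "\<not> Suc m + 2 * CARD('n) \<le> n"
    proof
      assume "Suc m + 2 * CARD('n) \<le> n"
      from Ncount_hist_mono[OF this, of w k] catch_up[of w m k] assms(2)[OF m] assms(2)[OF n]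
      show False by simp
    qed
    then show "n \<in> {m..<Suc m + 2 * CARD('n)}" using n assms(1) by (simp add: m_def)
  qed
  from card_mono[OF _ this] show ?thesis by simp
qed simp

text \<open>Each round is charged to an action and its sample size, so the number of rounds is
  bounded without a factor that grows with the horizon.\<close>

lemma card_rounds:
  assumes "finite R" "\<And>k. finite (V k)" 
    and "\<And>n. n \<in> R \<Longrightarrow> \<exists>k. pend w n k \<and> Ncount (hist w n) k \<in> V k"
  shows "card R \<le> (2 * CARD('n) + 1) * (\<Sum>k\<in>UNIV. card (V k))"
proof -
  define S where "S k v = {n \<in> R. pend w n k \<and> Ncount (hist w n) k = v}" for k v
  have "R \<subseteq> (\<Union>k. \<Union>v\<in>V k. S k v)" using assms(3) by (fastforce simp: S_def)
  then have "card R \<le> card (\<Union>k. \<Union>v\<in>V k. S k v)"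
    using assms by (intro card_mono) (auto simp: S_def)
  also have "\<dots> \<le> (\<Sum>k\<in>UNIV. card (\<Union>v\<in>V k. S k v))" by (rule card_UN_le) simp
  also have "\<dots> \<le> (\<Sum>k\<in>UNIV. \<Sum>v\<in>V k. card (S k v))" by (intro sum_mono card_UN_le assms)
  also have "\<dots> \<le> (\<Sum>k\<in>UNIV. \<Sum>v\<in>V k. 2 * CARD('n) + 1)"
    using assms(1) by (intro sum_mono card_rounds_single) (auto simp: S_def)
  also have "\<dots> = (2 * CARD('n) + 1) * (\<Sum>k\<in>UNIV. card (V k))"
    unfolding sum_constant sum_distrib_left by (simp only: mult.commute of_nat_id)
  finally show ?thesis .
qed

end

section \<open>Deviation probabilities\<close>

locale pm_full =
  pm_game L H "pvec P" i1 rstar + pm_run L H P a b c ordr selP selI selR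
  for L :: "real^'m::finite^'n::finite" and H :: "'a::finite^'m^'n" and P :: "'m pmf"
    and i1 :: 'n and rstar :: "real^'n" and a b c :: real and ordr :: "'n list"
    and selP :: "nat \<Rightarrow> ('n \<times> 'a) list \<Rightarrow> real^'m"
    and selI :: "nat \<Rightarrow> ('n \<times> 'a) list \<Rightarrow> 'n"
    and selR :: "nat \<Rightarrow> ('n \<times> 'a) list \<Rightarrow> (real^'n) option" +
  assumes a: "a > 0" and b: "b > 0" and c: "c > 0"
    and sel: "valid_sel H L b selP selI selR"
begin

abbreviation cnt :: "(nat \<Rightarrow> 'm) \<Rightarrow> nat \<Rightarrow> 'n \<Rightarrow> nat" where "cnt w n i \<equiv> Ncount (hist w n) i"

abbreviation num where "num w n i \<equiv> real (cnt w n i)"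
abbreviation tm where "tm n \<equiv> real (rnd n)"

definition dvg :: "(nat \<Rightarrow> 'm) \<Rightarrow> nat \<Rightarrow> 'n \<Rightarrow> real" where
  "dvg w n i = klr (emp (hist w n) i) (S i (pvec P))"

definition dac :: "(nat \<Rightarrow> 'm) \<Rightarrow> nat \<Rightarrow> 'n \<Rightarrow> bool" where
  "dac w n i = ac (emp (hist w n) i) (S i (pvec P))"

definition dev :: "(nat \<Rightarrow> 'm) \<Rightarrow> nat \<Rightarrow> 'n \<Rightarrow> bool" where
  "dev w n i \<longleftrightarrow> \<not> (dac w n i \<and> dvg w n i \<le> fexp b (cnt w n i) / 2)"

text \<open>The value that the likelihood ratio reaches at a deviation with sample size
  \<open>v\<close>, since \<open>N * f(N) / 2 = b * sqrt N / 2\<close>.\<close>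

definition lev :: "nat \<Rightarrow> real" where
  "lev v = exp (b * sqrt (real v) / 2) / (real v + 1) ^ CARD('a)"

lemma lev_pos: "lev v > 0"
  unfolding lev_def by (intro divide_pos_pos zero_less_power) auto

lemma cnt_fexp: "num w n i * fexp b (cnt w n i) = b * sqrt (num w n i)"
  using Ncount_hist_pos[of w n i] by (simp add: fexp_def field_simps)

lemma evid_hist:
  "evid B H (pvec P) (hist w n) i = (if dac w n i then
     exp (num w n i * dvg w n i) / (num w n i + 1) ^ CARD('a) else B)"
  unfolding dvg_def dac_def by (rule evid_eq[OF pvec_probsimplex Ncount_hist_pos])

text \<open>The value given to histories with an impossible symbol is taken to be the threshold
  \<open>\<theta>\<close>, so that these histories count as exceedances.\<close>

lemma dev_evid:
  assumes "dev w n i" "\<theta> \<le> lev (cnt w n i)"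
  shows "\<theta> \<le> evid \<theta> H (pvec P) (hist w n) i"
proof (cases "dac w n i")
  case True
  then have "fexp b (cnt w n i) / 2 \<le> dvg w n i" using assms(1) by (auto simp: dev_def)
  then have "num w n i * (fexp b (cnt w n i) / 2) \<le> num w n i * dvg w n i"
    by (intro mult_left_mono) auto
  then have "b * sqrt (num w n i) / 2 \<le> num w n i * dvg w n i"
    using cnt_fexp[of w n i] by simp
  then have "lev (cnt w n i) \<le> evid \<theta> H (pvec P) (hist w n) i"
    unfolding evid_hist lev_def using True by (auto intro!: divide_right_mono)
  then show ?thesis using assms(2) by simp
qed (simp add: evid_hist)

lemma dep_hist_ex:
  "dep (length ordr + M) (\<lambda>w. \<exists>n\<le>M. Q n (hist w n))"
proof -
  have "(\<lambda>w. \<exists>n\<le>M. Q n (hist w n)) = (\<lambda>w. \<exists>n\<le>M. Q n (take (length ordr + n) (hist w M)))"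
    by (intro ext) (auto simp: hist_prefix)
  then show ?thesis using dep_comp[OF hist_dep[of M], of "\<lambda>h. \<exists>n\<le>M. Q n (take (length ordr + n) h)"] by simp
qed

definition devE :: "nat \<Rightarrow> 'n \<Rightarrow> nat set \<Rightarrow> (nat \<Rightarrow> 'm) \<Rightarrow> bool" where
  "devE M i V w \<longleftrightarrow> (\<exists>n\<le>M. dev w n i \<and> cnt w n i \<in> V)"

lemma dep_devE: "dep (length ordr + M) (devE M i V)"
  using dep_hist_ex[of M "\<lambda>_ h. \<not> (ac (emp h i) (S i (pvec P)) \<and> klr (emp h i) (S i (pvec P)) \<le> fexp b (Ncount h i) / 2) \<and> Ncount h i \<in> V"]
  unfolding devE_def[abs_def] dev_def dac_def dvg_def by simp

text \<open>Ville's inequality for a process starting at 1. One application covers all rounds up to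
  \<open>M\<close> and all sample sizes in \<open>V\<close>.\<close>

lemma prob_devE:
  assumes "\<theta> > 0" "\<And>v. v \<in> V \<Longrightarrow> \<theta> \<le> lev v"
  shows "Prob (devE M i V) \<le> 1 / \<theta>"
proof -
  define F where "F = stopped \<theta> (\<lambda>h. evid \<theta> H (pvec P) h i)"
  have step: "(\<Sum>j\<in>UNIV. pvec P $ j * evid \<theta> H (pvec P) (h @ [(i', H$i'$j)]) i) \<le> evid \<theta> H (pvec P) h i" for h i'
  proof (cases "i' = i")
    case True
    then show ?thesis using evid_supermartingale[OF pvec_probsimplex, of \<theta> P H h i] assms(1) by simp
  next
    case False
    then show ?thesis using probsimplex_sum[OF pvec_probsimplex[of P]]
      by (simp add: evid_other sum_distrib_right[symmetric])
  qed
  have F0: "0 \<le> F h" for h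
    using assms(1) evid_nonneg[OF _ pvec_probsimplex, of \<theta> H P h i] by (simp add: F_def stopped_def)
  have "E (\<lambda>w. F (hist w M)) \<le> F []"
    unfolding F_def by (intro expectation_hist_le stopped_supermartingale pvec_probsimplex step)
  also have "F [] \<le> 1" by (simp add: F_def stopped_def evid_Nil)
  finally have "E (\<lambda>w. F (hist w M)) \<le> 1" .
  then show ?thesis
  proof (rule dep_markov[OF dep_comp[OF hist_dep] F0 _ dep_devE _ assms(1)])
    fix w assume "devE M i V w"
    then obtain n where n: "n \<le> M" "dev w n i" "cnt w n i \<in> V" by (auto simp: devE_def)
    have "\<theta> \<le> evid \<theta> H (pvec P) (take (length ordr + n) (hist w M)) i"
      using dev_evid[OF n(2) assms(2)[OF n(3)]] n(1) by (simp add: hist_prefix)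
    moreover have "length ordr + n \<le> length (hist w M)" using n by (simp add: length_hist)
    ultimately show "\<theta> \<le> F (hist w M)" unfolding F_def stopped_def by auto
  qed
qed

text \<open>\<open>optE n k\<close> contains the event that action \<open>k\<close> wrongly appears optimal in round \<open>n\<close> while the
  rates are sufficient: it is the constraint of \<^const>\<open>Rset\<close> at the true outcome distribution.\<close>

definition optE :: "nat \<Rightarrow> 'n \<Rightarrow> (nat \<Rightarrow> 'm) \<Rightarrow> bool" where
  "optE n k w \<longleftrightarrow> (\<forall>i. c * sqrt (ln (tm n)) \<le> num w n i) \<and>
     ((\<forall>i. i \<noteq> k \<longrightarrow> dac w n i) \<longrightarrow>
       ln (tm n) \<le> (\<Sum>i\<in>UNIV - {k}. num w n i * max 0 (dvg w n i - fexp b (cnt w n i))))"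

lemma dep_optE: "dep (length ordr + n) (optE n k)"
  using dep_comp[OF hist_dep[of n], of "\<lambda>h. (\<forall>i. c * sqrt (ln (tm n)) \<le> real (Ncount h i)) \<and>
     ((\<forall>i. i \<noteq> k \<longrightarrow> ac (emp h i) (S i (pvec P))) \<longrightarrow>
       ln (tm n) \<le> (\<Sum>i\<in>UNIV - {k}. real (Ncount h i) * max 0 (klr (emp h i) (S i (pvec P)) - fexp b (Ncount h i))))"]
  unfolding optE_def[abs_def] dac_def dvg_def by simp

text \<open>The hinge lowers each exponent by \<open>N * f(N) = b * sqrt N\<close>, whereas the
  likelihood ratio keeps this amount. Every positive term therefore contributes an extra factor
  \<open>y\<close>, which is the gain over the bound \<open>1 / t\<close>; the constant is the
  initial value of \<open>joint_evid\<close>.\<close>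

lemma prob_optE:
  assumes "y \<ge> 1" "ln (tm n) > 0" "\<And>v. c * sqrt (ln (tm n)) \<le> real v \<Longrightarrow> y \<le> lev v"
  shows "Prob (optE n k) \<le> 2 ^ CARD('n) / (tm n * y)"
proof -
  define t where "t = tm n"
  define \<theta> where "\<theta> = t * y"
  have t: "t > 0" by (simp add: t_def rnd_def)
  then have \<theta>: "\<theta> > 0" using assms(1) by (simp add: \<theta>_def)
  define F where "F = joint_evid \<theta> H (pvec P)"
  have e0: "0 \<le> evid \<theta> H (pvec P) h i" for h i
    using \<theta> by (intro evid_nonneg pvec_probsimplex) auto
  have F0: "0 \<le> F h" for h
    unfolding F_def joint_evid_def using e0 by (intro prod_nonneg) (simp add: add_nonneg_nonneg)
  have "E (\<lambda>w. F (hist w n)) \<le> F []"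
    unfolding F_def using \<theta> by (intro expectation_hist_le joint_evid_supermartingale pvec_probsimplex) auto
  also have "F [] = 2 ^ CARD('n)" by (simp add: F_def joint_evid_def evid_Nil)
  finally have "E (\<lambda>w. F (hist w n)) \<le> 2 ^ CARD('n)" .
  then show ?thesis unfolding t_def[symmetric] \<theta>_def[symmetric]
  proof (rule dep_markov[OF dep_comp[OF hist_dep] F0 _ dep_optE _ \<theta>])
    fix w assume E: "optE n k w"
    define I where "I = {i. i \<noteq> k \<and> fexp b (cnt w n i) < dvg w n i}"
    have sub: "(\<Prod>i\<in>J. evid \<theta> H (pvec P) (hist w n) i) \<le> F (hist w n)" for J
    proof -
      have "(\<Prod>i\<in>J. evid \<theta> H (pvec P) (hist w n) i) \<le> (\<Prod>i\<in>J. 1 + evid \<theta> H (pvec P) (hist w n) i)"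
        using e0 by (intro prod_mono) auto
      also have "\<dots> \<le> F (hist w n)"
        unfolding F_def joint_evid_def using e0 by (intro prod_mono2) (auto intro: order_trans[of 0 1] simp: add_nonneg_nonneg)
      finally show ?thesis .
    qed
    show "\<theta> \<le> F (hist w n)"
    proof (cases "\<forall>i. i \<noteq> k \<longrightarrow> dac w n i")
      case False
      then obtain i where "\<not> dac w n i" by auto
      then show ?thesis using sub[of "{i}"] by (simp add: evid_hist)
    next
      case True
      have "ln t \<le> (\<Sum>i\<in>UNIV - {k}. num w n i * max 0 (dvg w n i - fexp b (cnt w n i)))"
        using E True by (simp add: optE_def t_def)
      also have "\<dots> = (\<Sum>i\<in>I. num w n i * max 0 (dvg w n i - fexp b (cnt w n i)))"
        by (rule sum.mono_neutral_right) (auto simp: I_def)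
      also have "\<dots> = (\<Sum>i\<in>I. num w n i * (dvg w n i - fexp b (cnt w n i)))"
        by (intro sum.cong) (auto simp: I_def)
      finally have lnt: "ln t \<le> (\<Sum>i\<in>I. num w n i * (dvg w n i - fexp b (cnt w n i)))" .
      \<comment> \<open>Positivity of \<open>ln t\<close> guarantees a positive term, hence at least
        one factor \<open>y\<close>.\<close>
      have "I \<noteq> {}"
      proof
        assume "I = {}"
        then show False using lnt assms(2) by (simp add: t_def)
      qed
      then have cI: "card I \<ge> 1" by (simp add: Suc_le_eq card_gt_0_iff)
      have "t \<le> exp (\<Sum>i\<in>I. num w n i * (dvg w n i - fexp b (cnt w n i)))"
        using lnt t by (metis exp_le_cancel_iff exp_ln)
      moreover have "y \<le> y ^ card I" using assms(1) cI power_increasing[of 1 "card I" y] by simp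
      ultimately have "\<theta> \<le> exp (\<Sum>i\<in>I. num w n i * (dvg w n i - fexp b (cnt w n i))) * y ^ card I"
        unfolding \<theta>_def using t assms(1) by (intro mult_mono) auto
      also have "\<dots> = (\<Prod>i\<in>I. exp (num w n i * (dvg w n i - fexp b (cnt w n i))) * y)"
        by (simp add: exp_sum prod.distrib)
      also have "\<dots> \<le> (\<Prod>i\<in>I. evid \<theta> H (pvec P) (hist w n) i)"
      proof (rule prod_mono, intro conjI)
        fix i assume i: "i \<in> I"
        then have "dac w n i" using True by (simp add: I_def)
        have "y \<le> lev (cnt w n i)" using E assms(3) by (simp add: optE_def)
        also have "\<dots> \<le> exp (b * sqrt (num w n i)) / (num w n i + 1) ^ CARD('a)"
          unfolding lev_def using b by (intro divide_right_mono) auto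
        finally have "exp (num w n i * (dvg w n i - fexp b (cnt w n i))) * y \<le>
           exp (num w n i * (dvg w n i - fexp b (cnt w n i))) * (exp (b * sqrt (num w n i)) / (num w n i + 1) ^ CARD('a))"
          by (intro mult_left_mono) auto
        also have "\<dots> = evid \<theta> H (pvec P) (hist w n) i"
          using \<open>dac w n i\<close> unfolding evid_hist right_diff_distrib cnt_fexp by (simp add: exp_diff)
        finally show "exp (num w n i * (dvg w n i - fexp b (cnt w n i))) * y \<le> evid \<theta> H (pvec P) (hist w n) i" .
        show "0 \<le> exp (num w n i * (dvg w n i - fexp b (cnt w n i))) * y" using assms(1) by simp
      qed
      also have "\<dots> \<le> F (hist w n)" by (rule sub)
      finally show ?thesis .
    qed
  qed
qed

text \<open>From \<open>exp x \<ge> (x / m) ^ m\<close> with \<open>m = 2 * (8 + A)\<close>, so that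
  \<open>sqrt v ^ m = v ^ (8 + A)\<close> also absorbs the normaliser. The exponent 8 turns a sample
  size of order \<open>sqrt (sqrt (ln T))\<close> into a factor of order
  \<open>(ln T)\<^sup>2\<close>.\<close>

lemma lev_ge:
  obtains C where "C > 0" "\<And>v. v \<ge> 1 \<Longrightarrow> real v ^ 8 / C \<le> lev v"
proof -
  define A where "A = CARD('a)"
  define m where "m = 2 * (8 + A)"
  define C where "C = 2 ^ A / (b / (2 * real m)) ^ m"
  have m: "m > 0" by (simp add: m_def)
  have C: "C > 0" unfolding C_def using b m by (intro divide_pos_pos zero_less_power) auto
  show ?thesis
  proof (rule that[OF C])
    fix v :: nat assume v: "v \<ge> 1"
    define x where "x = b * sqrt (real v) / 2"
    have "x / real m \<le> exp (x / real m)" using exp_ge_add_one_self[of "x / real m"] by linarith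
    then have "(x / real m) ^ m \<le> exp (x / real m) ^ m"
      using b by (intro power_mono) (auto simp: x_def)
    also have "\<dots> = exp x" using m by (simp add: exp_of_nat_mult[symmetric])
    finally have ex: "(x / real m) ^ m \<le> exp x" .
    have "x / real m = b / (2 * real m) * sqrt (real v)" by (simp add: x_def)
    then have "(x / real m) ^ m = (b / (2 * real m)) ^ m * sqrt (real v) ^ m"
      by (simp only: power_mult_distrib)
    also have "sqrt (real v) ^ m = real v ^ (8 + A)"
      unfolding m_def power_mult by simp
    finally have ex2: "(b / (2 * real m)) ^ m * real v ^ (8 + A) \<le> exp x" using ex by simp
    have "(real v + 1) ^ A \<le> (2 * real v) ^ A" using v by (intro power_mono) auto
    then have "real v ^ 8 * (real v + 1) ^ A \<le> real v ^ 8 * (2 ^ A * real v ^ A)"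
      by (intro mult_left_mono) (auto simp: power_mult_distrib)
    also have "\<dots> = C * ((b / (2 * real m)) ^ m * real v ^ (8 + A))"
      using b m by (simp add: C_def power_add)
    also have "\<dots> \<le> C * exp x" using ex2 C by (intro mult_left_mono) auto
    finally have "real v ^ 8 * (real v + 1) ^ A \<le> C * exp x" .
    then show "real v ^ 8 / C \<le> lev v"
      unfolding lev_def x_def[symmetric] A_def[symmetric] using C
      by (simp add: divide_simps mult.commute)
  qed
qed

subsection \<open>Reasons for adding a suboptimal action\<close>

abbreviation phat where "phat w n \<equiv> selP (rnd n) (hist w n)"
abbreviation ihat where "ihat w n \<equiv> selI (rnd n) (hist w n)"
abbreviation rhat where "rhat w n \<equiv> selR (rnd n) (hist w n)"
abbreviation emps where "emps w n \<equiv> emp (hist w n)"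
abbreviation tols where "tols w n \<equiv> (\<lambda>i. fexp b (cnt w n i))"

lemma sel_phat: "phat w n \<in> probsimplex"
    "q \<in> probsimplex \<Longrightarrow> pm_obj H b (hist w n) (phat w n) \<le> pm_obj H b (hist w n) q"
  and sel_ihat: "L$(ihat w n) \<bullet> phat w n \<le> L$i \<bullet> phat w n"
  and sel_None: "rhat w n = None \<Longrightarrow> Ropt H L (ihat w n) (phat w n) (emps w n) (tols w n) = {}"
  and sel_Some: "rhat w n = Some r \<Longrightarrow> r \<in> Ropt H L (ihat w n) (phat w n) (emps w n) (tols w n)"
proof -
  note s = sel[unfolded valid_sel_def]
  from s[THEN conjunct1, rule_format, of "rnd n" "hist w n"]
  show "phat w n \<in> probsimplex" "q \<in> probsimplex \<Longrightarrow> pm_obj H b (hist w n) (phat w n) \<le> pm_obj H b (hist w n) q"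
    by simp_all
  from s[THEN conjunct2, THEN conjunct1, rule_format, of "rnd n" "hist w n" i]
  show "L$(ihat w n) \<bullet> phat w n \<le> L$i \<bullet> phat w n" .
  from s[THEN conjunct2, THEN conjunct2, rule_format, of "rnd n" "hist w n"]
  show "rhat w n = None \<Longrightarrow> Ropt H L (ihat w n) (phat w n) (emps w n) (tols w n) = {}"
    "rhat w n = Some r \<Longrightarrow> r \<in> Ropt H L (ihat w n) (phat w n) (emps w n) (tols w n)"
    by simp_all
qed

lemma emps_probsimplex: "emps w n i \<in> probsimplex"
  by (rule emp_probsimplex[OF Ncount_hist_pos])

definition explored where
  "explored w n \<longleftrightarrow> (\<forall>i. c * sqrt (ln (tm n)) \<le> num w n i)"

text \<open>The hinge radius at the smallest sample size possible in an explored round.\<close>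

definition tol :: "real \<Rightarrow> real" where "tol t = b / sqrt (c * sqrt (ln t))"

lemma fexp_le_tol:
  assumes "explored w n" "ln (tm n) > 0"
  shows "fexp b (cnt w n i) \<le> tol (tm n)" "fexp b (cnt w n i) > 0"
proof -
  have pos: "c * sqrt (ln (tm n)) > 0" using c assms(2) by simp
  show "fexp b (cnt w n i) \<le> tol (tm n)"
    unfolding fexp_def tol_def using assms(1) b pos Ncount_hist_pos[of w n i]
    by (intro divide_left_mono) (auto simp: explored_def intro!: mult_pos_pos)
  show "fexp b (cnt w n i) > 0"
    using b Ncount_hist_pos[of w n i] by (simp add: fexp_def)
qed

lemma tol_eventually_less: "\<eta> > 0 \<Longrightarrow> eventually (\<lambda>t::nat. tol (real t) < \<eta>) sequentially"
proof -
  assume "\<eta> > 0"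
  have "((\<lambda>t::nat. tol (real t)) \<longlongrightarrow> 0) sequentially" unfolding tol_def using b c by real_asymp
  then show ?thesis using \<open>\<eta> > 0\<close> by (rule order_tendstoD(2))
qed

lemma linear_bound:
  obtains Lm where "Lm > 0" "\<And>i j p. p \<in> probsimplex \<Longrightarrow> (L$i - L$j) \<bullet> p \<le> Lm"
proof -
  define Lm where "Lm = 1 + (\<Sum>i\<in>UNIV. \<Sum>j\<in>UNIV. norm (L$i - L$j))"
  show ?thesis
  proof (rule that)
    show "Lm > 0" unfolding Lm_def by (intro add_pos_nonneg sum_nonneg) auto
    fix i j and p :: "real^'m" assume p: "p \<in> probsimplex"
    have "(L$i - L$j) \<bullet> p \<le> norm (L$i - L$j) * norm p" by (rule norm_cauchy_schwarz)
    also have "\<dots> \<le> norm (L$i - L$j)"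
      using probsimplex_norm_le_1[OF p] by (simp add: mult_left_le)
    also have "\<dots> \<le> (\<Sum>j\<in>UNIV. norm (L$i - L$j))" by (rule member_le_sum) auto
    also have "\<dots> \<le> (\<Sum>i\<in>UNIV. \<Sum>j\<in>UNIV. norm (L$i - L$j))"
      by (rule member_le_sum[of _ _ "\<lambda>i. \<Sum>j\<in>UNIV. norm (L$i - L$j)"]) (auto intro!: sum_nonneg)
    finally show "(L$i - L$j) \<bullet> p \<le> Lm" by (simp add: Lm_def)
  qed
qed

definition consistent where
  "consistent w n \<longleftrightarrow> phat w n \<in> cell_margin L (ihat w n) (alpha a (rnd n)) \<and>
     (\<forall>i. KL (emps w n i) (S i (phat w n)) \<le> ereal (tols w n i))"

definition sufficient where
  "sufficient w n \<longleftrightarrow> rates (rnd n) (hist w n) (ihat w n) \<in> Rset H L (ihat w n) (emps w n) (tols w n)"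

lemma pend_if_not_consistent: "\<not> consistent w n \<Longrightarrow> pend w n k"
  unfolding pend_def newN_def consistent_def not_le de_Morgan_conj not_all by (rule subroutine_uncertain) blast

lemma pend_if_not_explored: "\<not> explored w n \<Longrightarrow> pend w n k"
  unfolding pend_def newN_def explored_def not_le not_all by (rule subroutine_uncertain) blast

lemma added_reason:
  assumes "added w n k" "consistent w n" "explored w n"
  shows "k = ihat w n \<or> \<not> sufficient w n \<and>
    (rhat w n = None \<or> (\<exists>r. rhat w n = Some r \<and> r$k > num w n k / ln (tm n)))"
proof -
  have "\<not> (\<exists>i. KL (emps w n i) (S i (phat w n)) > ereal (tols w n i))"
    "\<not> (\<exists>i. num w n i < c * sqrt (ln (tm n)))"
    using assms(2,3) by (simp_all add: consistent_def explored_def not_less)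
  then show ?thesis
    using subroutine_added[of k H L a b c selP selI selR "rnd n" "hist w n" "restR w n" "znC w n"] assms
    unfolding added_def newN_def consistent_def sufficient_def by blast
qed

text \<open>The cube collects \<open>1 / \<alpha>\<^sup>2\<close> from
  \<open>uniform_in_Rset\<close> and one more \<open>1 / \<alpha>\<close> from
  \<open>Ropt_le\<close>.\<close>

definition late_bound :: "real \<Rightarrow> real \<Rightarrow> real" where
  "late_bound C t = C * (1 + ln (ln t) ^ 3) * ln t"

lemma late_bound_mono:
  assumes "C > 0" "ln (ln t) \<ge> 0" "ln t > 0" "t > 0" "t \<le> t'"
  shows "late_bound C t \<le> late_bound C t'" "0 \<le> late_bound C t"
proof -
  have l: "ln t \<le> ln t'" using assms by (intro ln_mono) auto
  then have ll: "ln (ln t) \<le> ln (ln t')" using assms by (intro ln_mono) auto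
  have p: "ln (ln t) ^ 3 \<le> ln (ln t') ^ 3" "0 \<le> ln (ln t) ^ 3"
    using power_mono[OF ll assms(2), of 3] zero_le_power[OF assms(2), of 3] by simp_all
  then have C: "C * (1 + ln (ln t) ^ 3) \<le> C * (1 + ln (ln t') ^ 3)" "0 \<le> C * (1 + ln (ln t) ^ 3)"
    using assms(1) by (intro mult_left_mono mult_nonneg_nonneg; linarith)+
  show "late_bound C t \<le> late_bound C t'"
    unfolding late_bound_def using l assms(3) C by (intro mult_mono[OF C(1) l]) linarith+
  show "0 \<le> late_bound C t" unfolding late_bound_def using C(2) assms(3) by simp
qed

text \<open>The disjuncts are the groups (1) to (4). In the first three, a pending action is
  included so that \<open>card_rounds\<close> applies.\<close>

definition reason where
  "reason C w n k \<longleftrightarrow> (\<exists>i. pend w n i \<and> num w n i < c * sqrt (ln (tm n))) \<or>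
      (\<exists>i. pend w n i \<and> dev w n i) \<or>
      explored w n \<and> (\<exists>i. dev w n i) \<and> (\<exists>i. pend w n i \<and> num w n i \<le> late_bound C (tm n)) \<or>
      optE n k w"

text \<open>The feasible set is upward closed, so insufficient rates lie below the demanded rates in
  some coordinate, and below the uniform rates in some coordinate. The first coordinate is listed if
  demanded rates exist; otherwise everything is listed.\<close>

lemma insufficient_pend:
  obtains C where "C > 0"
    "eventually (\<lambda>t. \<forall>w n. rnd n = t \<longrightarrow> explored w n \<longrightarrow> consistent w n \<longrightarrow> \<not> sufficient w n \<longrightarrow>
       (\<exists>k. pend w n k \<and> num w n k \<le> late_bound C (real t))) sequentially"
proof -
  obtain K where K: "K > 0"
    "\<And>i j q q'. \<bar>(L$i - L$j) \<bullet> (q - q')\<bar> \<le> K * (\<Sum>k\<in>UNIV. norm (Smat H k *v q - Smat H k *v q'))"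
    using glob_obs_bound[OF glob] by blast
  obtain Lm where Lm: "Lm > 0" "\<And>i j p. p \<in> probsimplex \<Longrightarrow> (L$i - L$j) \<bullet> p \<le> Lm" using linear_bound by blast
  define N where "N = real CARD('n)"
  have N: "N > 0" by (simp add: N_def)
  define \<kappa> where "\<kappa> = 64 * (K * real CARD('n))\<^sup>2"
  have \<kappa>: "\<kappa> > 0" unfolding \<kappa>_def using K(1) by auto
  define C where "C = \<kappa> / a\<^sup>2 + N * \<kappa> * Lm / a ^ 3"
  have C0: "C > 0" unfolding C_def using \<kappa> a N Lm(1) by (intro add_pos_pos) auto
  have "eventually (\<lambda>t::nat. ln (ln (real t)) \<ge> 1) sequentially" by real_asymp
  moreover have "eventually (\<lambda>t::nat. ln (real t) > 0) sequentially" by real_asymp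
  \<comment> \<open>The tolerance decays like \<open>(ln t)\<close> to the power -1/4, faster than
    the square of the margin, which is of order \<open>1 / (ln (ln t))\<^sup>2\<close>.\<close>
  moreover have "eventually (\<lambda>t::nat. tol (real t) \<le> (a / ln (ln (real t)))\<^sup>2 / \<kappa>) sequentially"
    unfolding tol_def using a b c \<kappa> by real_asymp
  ultimately have "eventually (\<lambda>t. \<forall>w n. rnd n = t \<longrightarrow> explored w n \<longrightarrow> consistent w n \<longrightarrow> \<not> sufficient w n \<longrightarrow>
       (\<exists>k. pend w n k \<and> num w n k \<le> late_bound C (real t))) sequentially"
  proof eventually_elim
    case (elim t)
    show ?case
    proof (intro allI impI)
      fix w n assume t: "rnd n = t" and ex: "explored w n" and co: "consistent w n" and su: "\<not> sufficient w n"
      define l where "l = ln (ln (real t))"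
      define j where "j = ihat w n"
      define \<alpha> where "\<alpha> = alpha a t"
      have l: "l \<ge> 1" using elim by (simp add: l_def)
      have \<alpha>: "\<alpha> = a / l" "\<alpha> > 0" using l a by (auto simp: \<alpha>_def alpha_def l_def)
      define u where "u = \<kappa> / \<alpha>\<^sup>2"
      have u: "u \<ge> 0" "u = \<kappa> * l\<^sup>2 / a\<^sup>2" using \<kappa> \<alpha> l by (auto simp: u_def power_divide)
      have margin: "phat w n \<in> cell_margin L j \<alpha>" using co t by (simp add: consistent_def j_def \<alpha>_def)
      have unif: "(\<chi> i. if i = j then 0 else u) \<in> Rset H L j (emps w n) (tols w n)"
        unfolding u_def
      proof (rule uniform_in_Rset[OF K(1) K(2) \<kappa>_def margin \<alpha>(2) emps_probsimplex])
        fix i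
        show "KL (emps w n i) (S i (phat w n)) \<le> ereal (tols w n i)"
          using co by (simp add: consistent_def)
        show "tols w n i \<le> \<alpha>\<^sup>2 / \<kappa>"
          using fexp_le_tol(1)[OF ex, of i] elim t by (simp add: \<alpha> l_def)
      qed
      have notin: "rates (rnd n) (hist w n) j \<notin> Rset H L j (emps w n) (tols w n)"
        using su by (simp add: sufficient_def j_def)
      have "\<exists>k. k \<noteq> j \<and> pend w n k \<and> num w n k / ln (real t) \<le> max u (N * u * Lm / \<alpha>)"
      proof (cases "rhat w n")
        case None
        have "\<exists>k. k \<noteq> j \<and> num w n k / ln (real t) \<le> u"
        proof (rule ccontr)
          assume *: "\<not> ?thesis"
          have "rates (rnd n) (hist w n) j \<in> Rset H L j (emps w n) (tols w n)"
          proof (rule Rset_upward[OF unif])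
            fix i
            show "(\<chi> i. if i = j then 0 else u) $ i \<le> rates (rnd n) (hist w n) j $ i"
              using * t by (cases "i = j") (auto simp: not_le dest!: spec[of _ i])
          qed simp
          then show False using notin by simp
        qed
        moreover have "pend w n k" for k
          unfolding pend_def newN_def using su None
          by (intro subroutine_None) (auto simp: sufficient_def)
        ultimately show ?thesis by (auto simp: le_max_iff_disj)
      next
        case (Some r)
        then have r: "r \<in> Ropt H L j (phat w n) (emps w n) (tols w n)"
          unfolding j_def by (rule sel_Some)
        have "\<exists>k. k \<noteq> j \<and> num w n k / ln (real t) < r$k"
        proof (rule ccontr)
          assume *: "\<not> ?thesis"
          have rR: "r \<in> Rset H L j (emps w n) (tols w n)" "r$j = 0" using r by (simp_all add: Ropt_iff Rset_iff)
          have "rates (rnd n) (hist w n) j \<in> Rset H L j (emps w n) (tols w n)"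
          proof (rule Rset_upward[OF rR(1)])
            fix i
            show "r $ i \<le> rates (rnd n) (hist w n) j $ i"
              using * t rR(2) by (cases "i = j") (auto simp: not_less dest!: spec[of _ i])
          qed simp
          then show False using notin by simp
        qed
        then obtain k where k: "k \<noteq> j" "num w n k / ln (real t) < r$k" by auto
        have "pend w n k"
          unfolding pend_def newN_def using su Some k t
          by (intro subroutine_Some[where r=r]) (auto simp: sufficient_def)
        moreover have "r$k \<le> N * u * Lm / \<alpha>"
          unfolding N_def
          by (rule Ropt_le[OF r margin \<alpha>(2) u(1) unif Lm(2)[OF sel_phat(1)] k(1)])
        ultimately show ?thesis using k by (intro exI[of _ k]) auto
      qed
      then obtain k where k: "pend w n k" "num w n k / ln (real t) \<le> max u (N * u * Lm / \<alpha>)" by auto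
      have l2: "l\<^sup>2 \<le> 1 + l ^ 3" "l ^ 3 \<le> 1 + l ^ 3" using power_increasing[of 2 3 l] l by auto
      have "u \<le> \<kappa> / a\<^sup>2 * (1 + l ^ 3)"
        using mult_left_mono[OF l2(1), of "\<kappa> / a\<^sup>2"] \<kappa> by (simp add: u(2))
      moreover have "N * u * Lm / \<alpha> \<le> N * \<kappa> * Lm / a ^ 3 * (1 + l ^ 3)"
      proof -
        have "N * u * Lm / \<alpha> = N * \<kappa> * Lm / a ^ 3 * l ^ 3"
          using a l by (simp add: u(2) \<alpha>(1) power2_eq_square power3_eq_cube)
        also have "\<dots> \<le> N * \<kappa> * Lm / a ^ 3 * (1 + l ^ 3)"
          using \<kappa> a N Lm(1) l2 by (intro mult_left_mono) auto
        finally show ?thesis .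
      qed
      moreover have "0 \<le> \<kappa> / a\<^sup>2 * (1 + l ^ 3)" "0 \<le> N * \<kappa> * Lm / a ^ 3 * (1 + l ^ 3)"
        using \<kappa> a N Lm(1) l by auto
      ultimately have "max u (N * u * Lm / \<alpha>) \<le> C * (1 + l ^ 3)"
        unfolding C_def distrib_right by linarith
      then have "num w n k / ln (real t) \<le> C * (1 + l ^ 3)" using k(2) by linarith
      then have "num w n k \<le> C * (1 + l ^ 3) * ln (real t)"
        using elim by (simp add: pos_divide_le_eq)
      then show "\<exists>k. pend w n k \<and> num w n k \<le> late_bound C (real t)"
        using k(1) by (auto simp: l_def late_bound_def)
    qed
  qed
  then show ?thesis using that[OF C0] by blast
qed

text \<open>The true distribution makes the objective 0, so the minimiser does too; as all counts
  are positive, every hinge term vanishes separately.\<close>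

lemma phat_fits:
  assumes "\<And>i. \<not> dev w n i"
  shows "KL (emps w n i) (S i (phat w n)) \<le> ereal (tols w n i)"
proof -
  have le: "KL (emps w n i) (S i (pvec P)) \<le> ereal (tols w n i)" for i
  proof -
    have "tols w n i \<ge> 0" using b by (simp add: fexp_def)
    then show ?thesis using assms[of i] by (auto simp: dev_def dac_def dvg_def KL_le_iff)
  qed
  have h0: "hinge (KL p q - ereal d) = 0 \<longleftrightarrow> KL p q \<le> ereal d" for p q :: "real^'a" and d
    unfolding hinge_KL KL_le_iff by (auto simp: zero_ereal_def max_def)
  have "pm_obj H b (hist w n) (pvec P) = 0"
    unfolding pm_obj_def by (simp add: h0[THEN iffD2, OF le])
  then have "pm_obj H b (hist w n) (phat w n) \<le> 0"
    using sel_phat(2)[OF pvec_probsimplex, where w = w and n = n] by metis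
  moreover have nn: "0 \<le> ereal (num w n i) * hinge x" for i x by (simp add: hinge_def)
  ultimately have "(\<Sum>i\<in>UNIV. ereal (num w n i) * hinge (KL (emps w n i) (S i (phat w n)) - ereal (tols w n i))) = 0"
    unfolding pm_obj_def by (intro antisym sum_nonneg) auto
  then have "ereal (num w n i) * hinge (KL (emps w n i) (S i (phat w n)) - ereal (tols w n i)) = 0"
    using sum_nonneg_eq_0_iff[of UNIV "\<lambda>i. ereal (num w n i) * hinge (KL (emps w n i) (S i (phat w n)) - ereal (tols w n i))"] nn
    by simp
  then show ?thesis using Ncount_hist_pos[of w n i] by (simp add: h0)
qed

text \<open>Empirical distributions lie near those of both the fitted and the true distribution;
  observability turns this into nearby loss differences, and half the radius into strict slack. So
  the computed problem satisfies \<open>pert\<close>.\<close>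

lemma good_round:
  assumes "\<epsilon> > 0"
  shows "eventually (\<lambda>t. \<forall>w n. rnd n = t \<longrightarrow> explored w n \<longrightarrow> (\<forall>i. \<not> dev w n i) \<longrightarrow>
    ihat w n = i1 \<and> consistent w n \<and> rhat w n \<noteq> None \<and>
    (\<forall>r k. rhat w n = Some r \<longrightarrow> r$k \<le> rstar$k + \<epsilon>)) sequentially"
proof -
  obtain K where K: "K > 0"
    "\<And>i j q q'. \<bar>(L$i - L$j) \<bullet> (q - q')\<bar> \<le> K * (\<Sum>k\<in>UNIV. norm (Smat H k *v q - Smat H k *v q'))"
    using glob_obs_bound[OF glob] by blast
  obtain \<eta>1 where \<eta>1: "\<eta>1 > 0" "\<And>p ps \<delta>. pert \<eta>1 p ps \<delta> \<Longrightarrow> Ropt H L i1 p ps \<delta> \<noteq> {}"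
    using Ropt_nonempty by blast
  obtain \<eta>2 where \<eta>2: "\<eta>2 > 0"
    "\<And>p ps \<delta> r k. pert \<eta>2 p ps \<delta> \<Longrightarrow> r \<in> Ropt H L i1 p ps \<delta> \<Longrightarrow> r$k \<le> rstar$k + \<epsilon>"
    using Ropt_upper[OF assms] by blast
  define \<eta> where "\<eta> = min (min \<eta>1 \<eta>2) (gap / 2)"
  have \<eta>: "\<eta> > 0" "\<eta> \<le> \<eta>1" "\<eta> \<le> \<eta>2" "\<eta> \<le> gap / 2" using \<eta>1(1) \<eta>2(1) gap_pos by (auto simp: \<eta>_def)
  define N where "N = real CARD('n)"
  have N: "N > 0" by (simp add: N_def)
  \<comment> \<open>Two triangle legs of length \<open>2 * sqrt (tol t)\<close> give the 4; with a
    tolerance below \<open>\<mu>\<close> the sum over actions, multiplied by \<open>K\<close>, stays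
    below \<open>\<eta>\<close>.\<close>
  define \<mu> where "\<mu> = (\<eta> / (4 * K * N))\<^sup>2"
  have \<mu>: "\<mu> > 0" using \<eta> K N by (simp add: \<mu>_def)
  have "eventually (\<lambda>t::nat. ln (real t) > 0) sequentially" by real_asymp
  moreover have "eventually (\<lambda>t::nat. ln (ln (real t)) > 0) sequentially" by real_asymp
  moreover have "eventually (\<lambda>t::nat. a / ln (ln (real t)) < gap / 2) sequentially"
    using gap_pos a by real_asymp
  ultimately show ?thesis
    using tol_eventually_less[OF \<eta>(1)] tol_eventually_less[OF \<mu>]
  proof eventually_elim
    case (elim t)
    show ?case
    proof (intro allI impI)
      fix w n assume t: "rnd n = t" and ex: "explored w n" and nd: "\<forall>i. \<not> dev w n i"
      let ?g = "tol (real t)"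
      have f: "tols w n i \<le> ?g" "tols w n i > 0" for i
        using fexp_le_tol[OF ex, of i] elim t by auto
      have g0: "?g > 0" using f(1) f(2) less_le_trans by blast
      have KLp: "KL (emps w n i) (S i (phat w n)) \<le> ereal (tols w n i)" for i
        using nd by (intro phat_fits) auto
      have sq: "sqrt (tols w n i) \<le> sqrt ?g" for i using f(1) by simp
      have d: "norm (S i (phat w n) - S i (pvec P)) \<le> 4 * sqrt ?g" for i
      proof -
        have "norm (emps w n i - S i (phat w n)) \<le> 2 * sqrt (tols w n i)"
          using KLp[of i] by (intro norm_le_of_klr emps_probsimplex Smat_probsimplex sel_phat) (auto simp: KL_le_iff)
        moreover have "norm (emps w n i - S i (pvec P)) \<le> 2 * sqrt (tols w n i)"
          using nd[rule_format, of i] f(2)[of i]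
          by (intro norm_le_of_klr emps_probsimplex S0) (auto simp: dev_def dac_def dvg_def)
        moreover have "norm (S i (phat w n) - S i (pvec P)) \<le>
            norm (emps w n i - S i (pvec P)) + norm (emps w n i - S i (phat w n))"
          using norm_triangle_ineq4[of "emps w n i - S i (pvec P)" "emps w n i - S i (phat w n)"]
          by simp
        ultimately show ?thesis using sq[of i] by linarith
      qed
      have close: "\<bar>(L$i - L$i1) \<bullet> (phat w n - pvec P)\<bar> < \<eta>" for i
      proof -
        have "(\<Sum>k\<in>UNIV. norm (S k (phat w n) - S k (pvec P))) \<le> (\<Sum>k\<in>(UNIV::'n set). 4 * sqrt ?g)"
          by (intro sum_mono d)
        also have "\<dots> = N * (4 * sqrt ?g)" by (simp add: N_def)
        finally have "\<bar>(L$i - L$i1) \<bullet> (phat w n - pvec P)\<bar> \<le> K * (N * (4 * sqrt ?g))"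
          using K(2)[of i i1 "phat w n" "pvec P"] K(1) by (meson mult_left_mono less_imp_le order_trans)
        also have "sqrt ?g < \<eta> / (4 * K * N)"
          using elim \<eta>(1) K(1) N by (intro real_less_lsqrt) (auto simp: \<mu>_def)
        then have "K * (N * (4 * sqrt ?g)) < K * (N * (4 * (\<eta> / (4 * K * N))))"
          using K(1) N by (intro mult_strict_left_mono) auto
        also have "\<dots> = \<eta>" using K(1) N by simp
        finally show ?thesis .
      qed
      have P: "pert \<eta> (phat w n) (emps w n) (tols w n)"
        unfolding pert_def
      proof (intro conjI allI close sel_phat emps_probsimplex f(2))
        fix i
        show "tols w n i < \<eta>" using f(1)[of i] elim by simp
        show "KL (emps w n i) (S i (pvec P)) < ereal (tols w n i)"
          using nd[rule_format, of i] f(2)[of i] by (auto simp: KL_less_iff dev_def dac_def dvg_def)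
      qed
      have g: "gap / 2 \<le> (L$i - L$i1) \<bullet> phat w n" if "i \<noteq> i1" for i
        by (rule pert_gap[OF P \<eta>(4) that])
      have ih: "ihat w n = i1"
      proof (rule ccontr)
        assume "ihat w n \<noteq> i1"
        from g[OF this] sel_ihat[where w = w and n = n and i = i1] gap_pos show False by (simp add: inner_diff_left)
      qed
      have "phat w n \<in> cell_margin L i1 (alpha a t)"
        unfolding cell_margin_def
      proof (intro CollectI conjI allI impI sel_phat(1))
        fix i assume "i \<noteq> i1"
        from g[OF this] elim(3) show "L$i1 \<bullet> phat w n + alpha a t \<le> L$i \<bullet> phat w n"
          unfolding alpha_def inner_diff_left by linarith
      qed
      then have "consistent w n" using KLp ih t by (simp add: consistent_def)
      moreover have "rhat w n \<noteq> None"
        using sel_None[where w = w and n = n] \<eta>1(2)[OF pert_mono[OF P \<eta>(2)]] ih by auto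
      moreover have "\<forall>r k. rhat w n = Some r \<longrightarrow> r$k \<le> rstar$k + \<epsilon>"
        using sel_Some[where w = w and n = n] \<eta>2(2)[OF pert_mono[OF P \<eta>(3)]] ih by auto
      ultimately show "ihat w n = i1 \<and> consistent w n \<and> rhat w n \<noteq> None \<and>
          (\<forall>r k. rhat w n = Some r \<longrightarrow> r$k \<le> rstar$k + \<epsilon>)" using ih by simp
    qed
  qed
qed

lemma sufficient_optE:
  assumes "k \<noteq> i1" "k = ihat w n" "sufficient w n" "explored w n" "\<not> dev w n k" "ln (tm n) > 0"
  shows "optE n k w"
  unfolding optE_def
proof (intro conjI impI)
  show "\<forall>i. c * sqrt (ln (tm n)) \<le> num w n i" using assms(4) by (simp add: explored_def)
  assume dac: "\<forall>i. i \<noteq> k \<longrightarrow> dac w n i"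
  have "pvec P \<in> cellc L k"
    unfolding cellc_iff using uniq[OF assms(1)] pvec_probsimplex[of P] assms(1)
    by (intro conjI exI[of _ i1]) auto
  then have "pvec P \<in> clP (cellc L k)" using clP_superset[OF cellc_subset] by blast
  moreover have "ac (emps w n k) (S k (pvec P))" "klr (emps w n k) (S k (pvec P)) \<le> tols w n k"
  proof -
    have "tols w n k \<ge> 0" using b by (simp add: fexp_def)
    then show "ac (emps w n k) (S k (pvec P))" "klr (emps w n k) (S k (pvec P)) \<le> tols w n k"
      using assms(5) by (auto simp: dev_def dac_def dvg_def)
  qed
  ultimately have "1 \<le> wsum H k (emps w n) (tols w n) (rates (rnd n) (hist w n) k) (pvec P)"
    using assms(2,3) dac unfolding sufficient_def Rset_iff dac_def by blast
  also have "\<dots> = (\<Sum>i\<in>UNIV - {k}. num w n i * max 0 (dvg w n i - fexp b (cnt w n i))) / ln (tm n)"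
    unfolding wsum_def sum_divide_distrib dvg_def by (intro sum.cong) auto
  finally show "ln (tm n) \<le> (\<Sum>i\<in>UNIV - {k}. num w n i * max 0 (dvg w n i - fexp b (cnt w n i)))"
    using assms(6) by (simp add: pos_le_divide_eq)
qed

lemma added_cases:
  assumes "\<epsilon> > 0"
  obtains C where "C > 0"
    "eventually (\<lambda>t. \<forall>w n k. rnd n = t \<longrightarrow> k \<noteq> i1 \<longrightarrow> added w n k \<longrightarrow> num w n k > (rstar$k + \<epsilon>) * ln (real t) \<longrightarrow> reason C w n k) sequentially"
proof -
  obtain C where C: "C > 0"
    "eventually (\<lambda>t. \<forall>w n. rnd n = t \<longrightarrow> explored w n \<longrightarrow> consistent w n \<longrightarrow> \<not> sufficient w n \<longrightarrow>
       (\<exists>k. pend w n k \<and> num w n k \<le> late_bound C (real t))) sequentially"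
    using insufficient_pend by blast
  have "eventually (\<lambda>t::nat. ln (real t) > 0) sequentially" by real_asymp
  with C(2) good_round[OF assms] have "eventually (\<lambda>t. \<forall>w n k. rnd n = t \<longrightarrow> k \<noteq> i1 \<longrightarrow> added w n k \<longrightarrow> num w n k > (rstar$k + \<epsilon>) * ln (real t) \<longrightarrow> reason C w n k) sequentially"
  proof eventually_elim
    case (elim t)
    show ?case
    proof (intro allI impI)
      fix w n k assume t: "rnd n = t" and k: "k \<noteq> i1" and ad: "added w n k"
        and big: "num w n k > (rstar$k + \<epsilon>) * ln (real t)"
      note R = reason_def[of C w n k, unfolded t]
      show "reason C w n k"
      proof (cases "explored w n")
        case False
        then obtain i where "num w n i < c * sqrt (ln (real t))"
          unfolding explored_def t by (auto simp: not_le)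
        then show ?thesis unfolding R using pend_if_not_explored[OF False] by blast
      next
        case ex: True
        show ?thesis
        proof (cases "\<exists>i. dev w n i")
          case False
          then have G: "ihat w n = i1" "consistent w n" "rhat w n \<noteq> None"
            "\<And>r. rhat w n = Some r \<Longrightarrow> r$k \<le> rstar$k + \<epsilon>"
            using elim(2) t ex by blast+
          from added_reason[OF ad G(2) ex] G k obtain r where
            "rhat w n = Some r" "r$k > num w n k / ln (real t)" using t by auto
          then have "num w n k / ln (real t) < rstar$k + \<epsilon>" using G(4) by force
          then have "num w n k < (rstar$k + \<epsilon>) * ln (real t)" using elim(3) by (simp add: pos_divide_less_eq)
          then show ?thesis using big by simp
        next
          case dv: True
          show ?thesis
          proof (cases "consistent w n")
            case False
            \<comment> \<open>An inconsistent round lists every action, in particular the deviating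
              one.\<close>
            then show ?thesis unfolding R using pend_if_not_consistent dv by blast
          next
            case co: True
            show ?thesis
            proof (cases "sufficient w n")
              case False
              then show ?thesis unfolding R using elim(1) t ex co dv by blast
            next
              case su: True
              then have "k = ihat w n" using added_reason[OF ad co ex] by blast
              \<comment> \<open>If \<open>k\<close> itself deviates, it is a listed deviating action
                and group (2) applies. Otherwise the true distribution satisfies the constraint for
                \<open>k\<close>, as \<open>sufficient_optE\<close> requires.\<close>
              moreover have "pend w n k" using ad by (simp add: pend_def added_def)
              ultimately show ?thesis unfolding R using sufficient_optE[OF k _ su ex] elim(3) t by blast
            qed
          qed
        qed
      qed
    qed
  qed
  then show ?thesis using that[OF C(1)] by blast
qed

end

section \<open>Regret\<close>

lemma card_nat_le:
  assumes "r \<ge> 0"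
  shows "finite {v::nat. real v \<le> r}" "real (card {v::nat. real v \<le> r}) \<le> r + 1"
proof -
  have "{v::nat. real v \<le> r} = {..nat \<lfloor>r\<rfloor>}" using assms by (auto simp: le_nat_floor nat_le_iff le_floor_iff) linarith
  then show "finite {v::nat. real v \<le> r}" "real (card {v::nat. real v \<le> r}) \<le> r + 1"
    using assms by (simp_all add: of_nat_floor)
qed

lemma sum_inverse_le_ln: "T \<ge> 1 \<Longrightarrow> (\<Sum>t=1..T. 1 / real t) \<le> 1 + ln (real T)"
  using euler_mascheroni_sequence_decreasing[of 1 T] by (simp add: harm_def inverse_eq_divide)

context pm_full
begin

lemma cnt_le: "cnt w n i \<le> length ordr + n"
  unfolding Ncount_def using length_filter_le[of _ "hist w n"] by (simp add: length_hist)

lemma integrable_ind: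
  "dep m Q \<Longrightarrow> integrable (outcomes P) (indicator {w. Q w} :: _ \<Rightarrow> real)"
proof -
  assume Q: "dep m Q"
  have "(indicator {w. Q w} :: _ \<Rightarrow> real) = (\<lambda>w. if Q w then 1 else 0)" by (auto simp: indicator_def)
  then show ?thesis using dep_integrable[OF dep_comp[OF Q, of "\<lambda>q. if q then 1 else (0::real)"], of P] by simp
qed

definition bad where
  "bad \<epsilon> T w k = {n. n < T - length ordr \<and> added w n k \<and> num w n k > (rstar$k + \<epsilon>) * ln (real T)}"

text \<open>The majorant \<open>J\<close> has deterministic terms for the initial rounds, group (1)
  and the early part of group (3), and the random terms \<open>Ja\<close> for group (2),
  \<open>Jb\<close> for the late part of group (3) and \<open>Jc\<close> for group (4).\<close>

lemma bad_additions:
  assumes "\<epsilon> > 0" "\<epsilon>' > 0" "k \<noteq> i1"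
  shows "eventually (\<lambda>T. \<exists>J. integrable (outcomes P) J \<and> E J \<le> \<epsilon>' * ln (real T) \<and>
    (\<forall>w. real (card (bad \<epsilon> T w k)) \<le> J w)) sequentially"
proof -
  interpret Pr: prob_space "outcomes P" by (rule prob_space_outcomes)
  obtain C where C: "C > 0" and cases: "eventually (\<lambda>t. \<forall>w n k. rnd n = t \<longrightarrow> k \<noteq> i1 \<longrightarrow> added w n k \<longrightarrow>
      num w n k > (rstar$k + \<epsilon>) * ln (real t) \<longrightarrow> reason C w n k) sequentially"
    using added_cases[OF assms(1)] by blast
  obtain C0 where C0: "C0 > 0" "\<And>v. v \<ge> 1 \<Longrightarrow> real v ^ 8 / C0 \<le> lev v" using lev_ge by blast
  define y where "y t = (c * sqrt (ln t)) ^ 8 / C0" for t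
  define N where "N = real CARD('n)"
  define D where "D = 2 * N + 1"
  define S where "S = C0 * (\<Sum>v. inverse (real v ^ 2))"
  have N: "N \<ge> 1" by (simp add: N_def Suc_le_eq)
  have D: "D > 0" using N by (simp add: D_def)
  \<comment> \<open>This makes the bound of \<open>prob_optE\<close> at most
    \<open>\<epsilon>' / (4 * t)\<close>, so that a harmonic sum contributes only a small multiple
    of \<open>ln T\<close>.\<close>
  have "eventually (\<lambda>t::nat. y (real t) \<ge> max 1 (2 ^ CARD('n) * 4 / \<epsilon>')) sequentially"
    unfolding y_def using c C0 by real_asymp
  moreover have "eventually (\<lambda>t::nat. ln (ln (real t)) \<ge> 0) sequentially" by real_asymp
  moreover have "eventually (\<lambda>t::nat. ln (real t) \<ge> 1) sequentially" by real_asymp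
  ultimately have "eventually (\<lambda>t. y (real t) \<ge> max 1 (2 ^ CARD('n) * 4 / \<epsilon>') \<and> ln (ln (real t)) \<ge> 0 \<and> ln (real t) \<ge> 1 \<and>
      (\<forall>w n k. rnd n = t \<longrightarrow> k \<noteq> i1 \<longrightarrow> added w n k \<longrightarrow>
      num w n k > (rstar$k + \<epsilon>) * ln (real t) \<longrightarrow> reason C w n k)) sequentially"
    using cases by eventually_elim blast
  then obtain t1 where t1all: "\<And>t. t \<ge> t1 \<Longrightarrow> y (real t) \<ge> max 1 (2 ^ CARD('n) * 4 / \<epsilon>') \<and> ln (ln (real t)) \<ge> 0 \<and> ln (real t) \<ge> 1 \<and>
      (\<forall>w n k. rnd n = t \<longrightarrow> k \<noteq> i1 \<longrightarrow> added w n k \<longrightarrow>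
      num w n k > (rstar$k + \<epsilon>) * ln (real t) \<longrightarrow> reason C w n k)"
    unfolding eventually_sequentially by blast
  have t1: "y (real t) \<ge> 1" "y (real t) \<ge> 2 ^ CARD('n) * 4 / \<epsilon>'" "ln (ln (real t)) \<ge> 0" "ln (real t) \<ge> 1"
    if "t \<ge> t1" for t using t1all[OF that] by simp_all
  have t1c: "reason C w n k" if "rnd n \<ge> t1" "added w n k" "num w n k > (rstar$k + \<epsilon>) * ln (tm n)" for w n
    using t1all[OF that(1)] that(2,3) assms(3) by blast
  \<comment> \<open>The split of group (3). Before \<open>u T\<close> the count bound is of order
    \<open>sqrt (ln T)\<close> up to powers of \<open>ln (ln T)\<close>. From then on explored
    actions have at least \<open>c * sqrt (sqrt (ln T))\<close> samples, and
    \<open>\<theta> T\<close> is the resulting lower bound for \<open>lev\<close>.\<close>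
  define u where "u T = exp (sqrt (ln T))" for T :: real
  define \<theta> where "\<theta> T = (c * sqrt (sqrt (ln T))) ^ 8 / C0" for T :: real
  have "eventually (\<lambda>T::nat. real t1 + D * (N * (c * sqrt (ln (real T)) + 1)) + D * (N * S) \<le> \<epsilon>' / 8 * ln (real T)) sequentially"
    using assms(2) by real_asymp
  moreover have "eventually (\<lambda>T::nat. D * (N * (late_bound C (N + 1 + u (real T)) + 1)) \<le> \<epsilon>' / 8 * ln (real T)) sequentially"
    unfolding u_def late_bound_def using assms(2) C D N by real_asymp
  moreover have "eventually (\<lambda>T::nat. D * (N * (late_bound C (real T) + 1)) * (N / \<theta> (real T)) \<le> \<epsilon>' / 8 * ln (real T)) sequentially"
    unfolding \<theta>_def late_bound_def using assms(2) C D N C0 c by real_asymp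
  moreover have "eventually (\<lambda>T::nat. \<epsilon>' / 4 * (1 + ln (real T)) \<le> \<epsilon>' / 2 * ln (real T)) sequentially"
    using assms(2) by real_asymp
  moreover have "eventually (\<lambda>T::nat. u (real T) \<ge> real t1) sequentially"
    unfolding u_def by real_asymp
  moreover have "eventually (\<lambda>T::nat. T \<ge> max t1 (length ordr)) sequentially" by (rule eventually_ge_at_top)
  ultimately show ?thesis
  proof eventually_elim
    case (elim T)
    define M where "M = T - length ordr"
    define n2 where "n2 = nat \<lfloor>u (real T)\<rfloor>"
    define t2 where "t2 = rnd n2"
    have Tt1: "T \<ge> t1" and TN: "length ordr \<le> T" using elim by auto
    have lnT: "ln (real T) \<ge> 1" using t1(4)[OF Tt1] .
    have rnd_le: "rnd n \<le> T" if "n < M" for n using that TN by (simp add: rnd_def M_def)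
    have n2: "u (real T) \<le> real n2 + 1" "real n2 \<le> u (real T)"
      unfolding n2_def by (auto simp: u_def of_nat_floor)
    have t2: "u (real T) \<le> real t2" "real t2 \<le> N + 1 + u (real T)"
      using n2 by (auto simp: t2_def rnd_def length_ordr N_def)
    have t2t1: "t1 \<le> t2" using t2(1) elim by linarith
    have lnt2: "sqrt (ln (real T)) \<le> ln (real t2)"
      using t2(1) by (subst ln_ge_iff) (auto simp: u_def t2_def rnd_def)
    have \<theta>0: "\<theta> (real T) > 0" unfolding \<theta>_def using c C0 lnT by simp
    define V where "V = {v. c * sqrt (ln (real t2)) \<le> real v}"
    define Ja where "Ja w = D * (\<Sum>i\<in>UNIV. \<Sum>v=1..T. indicator {w. devE M i {v} w} w)" for w
    define Jb where "Jb w = D * (N * (late_bound C (real T) + 1)) * (\<Sum>i\<in>UNIV. indicator {w. devE M i V w} w)" for w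
    define Jc where "Jc w = (\<Sum>n\<in>{n. n < M \<and> t1 \<le> rnd n}. indicator {w. optE n k w} w :: real)" for w
    define J where "J w = real t1 + D * (N * (c * sqrt (ln (real T)) + 1)) + D * (N * (late_bound C (N + 1 + u (real T)) + 1)) + Ja w + Jb w + Jc w" for w
    have int: "integrable (outcomes P) Ja" "integrable (outcomes P) Jb" "integrable (outcomes P) Jc"
      unfolding Ja_def Jb_def Jc_def
      by (intro integrable_mult_right Bochner_Integration.integrable_sum integrable_ind[OF dep_devE] integrable_ind[OF dep_optE])+
    have intJ: "integrable (outcomes P) J"
      unfolding J_def by (intro Bochner_Integration.integrable_add int Pr.integrable_const)
    have indm: "E (\<lambda>w. indicator {w. Q w} w) = Prob Q" for Q
      by simp
    have Vlev: "\<theta> (real T) \<le> lev v" if "v \<in> V" for v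
    proof -
      have "c * sqrt (sqrt (ln (real T))) \<le> c * sqrt (ln (real t2))" using lnt2 c by simp
      also have v: "\<dots> \<le> real v" using that by (simp add: V_def)
      finally have le: "c * sqrt (sqrt (ln (real T))) \<le> real v" .
      moreover have pos: "c * sqrt (sqrt (ln (real T))) > 0" using c lnT by simp
      ultimately have "v \<ge> 1" by (cases v) auto
      have "\<theta> (real T) \<le> real v ^ 8 / C0"
        unfolding \<theta>_def using le pos C0(1) by (intro divide_right_mono power_mono) auto
      then show ?thesis using C0(2)[OF \<open>v \<ge> 1\<close>] by simp
    qed
    have Ja: "E Ja \<le> D * (N * S)"
    proof -
      \<comment> \<open>Each sample size is charged once, however many rounds share it. Since
        \<open>lev v\<close> grows at least like \<open>v ^ 8\<close>, comparison with inverse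
        squares bounds the sum for all \<open>T\<close>.\<close>
      have summ: "summable (\<lambda>v. inverse (real v ^ 2))" by (rule inverse_power_summable) simp
      have one: "Prob (devE M i {v}) \<le> C0 * inverse (real v ^ 2)" if "v \<ge> 1" for i v
      proof -
        have "Prob (devE M i {v}) \<le> 1 / lev v"
          by (rule prob_devE) (auto simp: lev_pos)
        also have "\<dots> \<le> 1 / (real v ^ 8 / C0)"
          using C0 that lev_pos by (intro divide_left_mono mult_pos_pos) auto
        also have "\<dots> = C0 * inverse (real v ^ 8)" by (simp add: divide_simps)
        also have "\<dots> \<le> C0 * inverse (real v ^ 2)"
          using C0(1) that by (intro mult_left_mono le_imp_inverse_le power_increasing) auto
        finally show ?thesis .
      qed
      have "E Ja = D * (\<Sum>i\<in>UNIV. \<Sum>v=1..T. Prob (devE M i {v}))"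
        unfolding Ja_def
        by (simp add: Bochner_Integration.integral_sum integrable_ind[OF dep_devE] Bochner_Integration.integrable_sum)
      also have "\<dots> \<le> D * (\<Sum>i\<in>(UNIV::'n set). S)"
      proof (intro mult_left_mono sum_mono)
        fix i :: 'n
        have "(\<Sum>v=1..T. Prob (devE M i {v})) \<le> (\<Sum>v=1..T. C0 * inverse (real v ^ 2))"
          by (intro sum_mono one) auto
        also have "\<dots> \<le> S"
          unfolding S_def sum_distrib_left[symmetric] using C0(1)
          by (intro mult_left_mono sum_le_suminf[OF summ]) auto
        finally show "(\<Sum>v=1..T. Prob (devE M i {v})) \<le> S" .
      qed (use D in auto)
      finally show ?thesis by (simp add: N_def)
    qed
    have lbT: "late_bound C (real T) \<ge> 0"
    proof -
      have "T > 1" using lnT by (cases "T \<le> 1") (auto simp: le_Suc_eq)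
      then show ?thesis using late_bound_mono(2)[OF C t1(3)[OF Tt1] _ _ order_refl] by simp
    qed
    have Jb: "E Jb \<le> D * (N * (late_bound C (real T) + 1)) * (N / \<theta> (real T))"
    proof -
      have "E Jb = D * (N * (late_bound C (real T) + 1)) * (\<Sum>i\<in>UNIV. Prob (devE M i V))"
        unfolding Jb_def by (simp add: Bochner_Integration.integral_sum integrable_ind[OF dep_devE])
      also have "\<dots> \<le> D * (N * (late_bound C (real T) + 1)) * (\<Sum>i\<in>(UNIV::'n set). 1 / \<theta> (real T))"
        using D N lbT by (intro mult_left_mono sum_mono prob_devE \<theta>0 Vlev) auto
      finally show ?thesis by (simp add: N_def)
    qed
    have Jc: "E Jc \<le> \<epsilon>' / 4 * (1 + ln (real T))"
    proof -
      have one: "Prob (optE n k) \<le> \<epsilon>' / 4 * (1 / tm n)" if n: "t1 \<le> rnd n" for n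
      proof -
        have ylev: "y (tm n) \<le> lev v" if "c * sqrt (ln (tm n)) \<le> real v" for v
        proof -
          have pos: "c * sqrt (ln (tm n)) > 0" using c t1(4)[OF n] by simp
          then have "v \<ge> 1" using that by (cases v) auto
          have "y (tm n) \<le> real v ^ 8 / C0"
            unfolding y_def using that pos C0(1) by (intro divide_right_mono power_mono) auto
          then show ?thesis using C0(2)[OF \<open>v \<ge> 1\<close>] by simp
        qed
        have "Prob (optE n k) \<le> 2 ^ CARD('n) / (tm n * y (tm n))"
          using t1(1,4)[OF n] by (intro prob_optE ylev) auto
        also have "\<dots> = 2 ^ CARD('n) / y (tm n) * (1 / tm n)" by simp
        also have "\<dots> \<le> \<epsilon>' / 4 * (1 / tm n)"
          using t1(1,2)[OF n] assms(2) by (intro mult_right_mono) (simp_all add: divide_simps mult.commute)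
        finally show ?thesis .
      qed
      have "E Jc = (\<Sum>n\<in>{n. n < M \<and> t1 \<le> rnd n}. Prob (optE n k))"
        unfolding Jc_def by (simp add: Bochner_Integration.integral_sum integrable_ind[OF dep_optE])
      also have "\<dots> \<le> (\<Sum>n\<in>{n. n < M \<and> t1 \<le> rnd n}. \<epsilon>' / 4 * (1 / tm n))"
        by (intro sum_mono one) auto
      also have "\<dots> = \<epsilon>' / 4 * (\<Sum>t\<in>rnd ` {n. n < M \<and> t1 \<le> rnd n}. 1 / real t)"
        by (subst sum.reindex) (auto simp: inj_on_def rnd_def sum_distrib_left)
      also have "\<dots> \<le> \<epsilon>' / 4 * (\<Sum>t=1..T. 1 / real t)"
        using rnd_le assms(2) by (intro mult_left_mono sum_mono2) (auto simp: rnd_def)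
      also have "\<dots> \<le> \<epsilon>' / 4 * (1 + ln (real T))"
        using assms(2) lnT by (intro mult_left_mono sum_inverse_le_ln) (auto simp: Suc_le_eq intro!: gr0I)
      finally show ?thesis .
    qed
    have "E J = real t1 + D * (N * (c * sqrt (ln (real T)) + 1)) + D * (N * (late_bound C (N + 1 + u (real T)) + 1))
        + E Ja + E Jb + E Jc"
      unfolding J_def using int by (simp add: Pr.prob_space[unfolded space_outcomes])
    also have "\<dots> \<le> \<epsilon>' * ln (real T)"
    proof -
      have "\<epsilon>' * ln (real T) \<ge> 0" using assms(2) lnT by simp
      then show ?thesis using elim(1-4) Ja Jb Jc by linarith
    qed
    finally have "E J \<le> \<epsilon>' * ln (real T)" .
    moreover have "real (card (bad \<epsilon> T w k)) \<le> J w" for w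
    proof -
      define B where "B = bad \<epsilon> T w k"
      define R0 where "R0 = {n. rnd n < t1}"
      define R1 where "R1 = {n. n < M \<and> (\<exists>i. pend w n i \<and> num w n i \<le> c * sqrt (ln (real T)))}"
      define R2 where "R2 = {n. n < M \<and> (\<exists>i. pend w n i \<and> dev w n i)}"
      define R3 where "R3 = {n. n < M \<and> (\<exists>i. pend w n i \<and> num w n i \<le> late_bound C (N + 1 + u (real T)))}"
      define R4 where "R4 = {n. n < M \<and> n2 \<le> n \<and> explored w n \<and> (\<exists>i. dev w n i) \<and> (\<exists>i. pend w n i \<and> num w n i \<le> late_bound C (real T))}"
      define R5 where "R5 = {n. n < M \<and> t1 \<le> rnd n \<and> optE n k w}"
      have r0: "rstar$k \<ge> 0" using rstar(1) by (simp add: Rset_iff)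
      have "B \<subseteq> R0 \<union> R1 \<union> R2 \<union> R3 \<union> R4 \<union> R5"
      proof
        fix n assume "n \<in> B"
        then have n: "n < M" "added w n k" "num w n k > (rstar$k + \<epsilon>) * ln (real T)" by (auto simp: B_def bad_def M_def)
        show "n \<in> R0 \<union> R1 \<union> R2 \<union> R3 \<union> R4 \<union> R5"
        proof (cases "rnd n < t1")
          case False
          have rpos: "tm n > 0" by (simp add: rnd_def)
          have lnle: "ln (tm n) \<le> ln (real T)" using rnd_le[OF n(1)] rpos by (intro ln_mono) auto
          have lpos: "ln (tm n) \<ge> 1" "ln (ln (tm n)) \<ge> 0" using t1(3,4) False by auto
          then have lpos0: "ln (tm n) > 0" by linarith
          have "(rstar$k + \<epsilon>) * ln (tm n) \<le> (rstar$k + \<epsilon>) * ln (real T)"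
            using lnle r0 assms(1) by (intro mult_left_mono) auto
          then have "reason C w n k" using n False by (intro t1c) auto
          then consider (1) "\<exists>i. pend w n i \<and> num w n i < c * sqrt (ln (tm n))"
            | (2) "\<exists>i. pend w n i \<and> dev w n i"
            | (3) "explored w n \<and> (\<exists>i. dev w n i) \<and> (\<exists>i. pend w n i \<and> num w n i \<le> late_bound C (tm n))"
            | (4) "optE n k w"
            unfolding reason_def by blast
          then show ?thesis
          proof cases
            case 1
            then obtain i where i: "pend w n i" "num w n i < c * sqrt (ln (tm n))" by auto
            have "c * sqrt (ln (tm n)) \<le> c * sqrt (ln (real T))" using lnle c by simp
            then have "num w n i \<le> c * sqrt (ln (real T))" using i by linarith
            then show ?thesis using i n by (auto simp: R1_def)
          next
            case 2
            then show ?thesis using n by (auto simp: R2_def)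
          next
            case 3
            then obtain i where i: "pend w n i" "num w n i \<le> late_bound C (tm n)" by auto
            show ?thesis
            proof (cases "n2 \<le> n")
              case True
              have "late_bound C (tm n) \<le> late_bound C (real T)"
                by (rule late_bound_mono(1)[OF C lpos(2) lpos0 rpos]) (use rnd_le[OF n(1)] in simp)
              then have "num w n i \<le> late_bound C (real T)" using i by linarith
              then show ?thesis using 3 i n True by (auto simp: R4_def)
            next
              case False
              then have "tm n \<le> N + 1 + u (real T)" using t2(2) by (simp add: t2_def rnd_def)
              then have "late_bound C (tm n) \<le> late_bound C (N + 1 + u (real T))"
                by (rule late_bound_mono(1)[OF C lpos(2) lpos0 rpos])
              then have "num w n i \<le> late_bound C (N + 1 + u (real T))" using i by linarith
              then show ?thesis using i n by (auto simp: R3_def)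
            qed
          next
            case 4
            then show ?thesis using n False by (auto simp: R5_def)
          qed
        qed (simp add: R0_def)
      qed
      moreover have fin: "finite R0" "finite R1" "finite R2" "finite R3" "finite R4" "finite R5"
      proof -
        have "R0 \<subseteq> {..<t1}" by (auto simp: R0_def rnd_def)
        then show "finite R0" by (rule finite_subset) simp
      qed (simp_all add: R1_def R2_def R3_def R4_def R5_def)
      ultimately have "card B \<le> card (R0 \<union> R1 \<union> R2 \<union> R3 \<union> R4 \<union> R5)" by (intro card_mono) auto
      also have "\<dots> \<le> card R0 + card R1 + card R2 + card R3 + card R4 + card R5"
        by (meson add_mono card_Un_le order_refl order_trans)
      finally have cB: "real (card B) \<le> real (card R0) + real (card R1) + real (card R2) + real (card R3) + real (card R4) + real (card R5)"
        by (simp flip: of_nat_add)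
      have rounds: "real (card R) \<le> D * (\<Sum>i\<in>UNIV. real (card (V i)))"
        if "finite R" "\<And>i. finite (V i)" "\<And>n. n \<in> R \<Longrightarrow> \<exists>i. pend w n i \<and> cnt w n i \<in> V i" for R V
      proof -
        have "real (card R) \<le> real ((2 * CARD('n) + 1) * (\<Sum>i\<in>UNIV. card (V i)))"
          using card_rounds[OF that] by (simp only: of_nat_le_iff)
        then show ?thesis by (simp add: D_def N_def algebra_simps)
      qed
      have rounds_le: "real (card R) \<le> D * (N * (r + 1))"
        if "finite R" "r \<ge> 0" "\<And>n. n \<in> R \<Longrightarrow> \<exists>i. pend w n i \<and> num w n i \<le> r" for R r
      proof -
        have "real (card R) \<le> D * (\<Sum>i\<in>(UNIV::'n set). real (card {v::nat. real v \<le> r}))"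
          using that card_nat_le[OF that(2)] by (intro rounds) auto
        also have "\<dots> \<le> D * (\<Sum>i\<in>(UNIV::'n set). r + 1)"
          using D card_nat_le[OF that(2)] by (intro mult_left_mono sum_mono) auto
        finally show ?thesis by (simp add: N_def)
      qed
      have "card R0 \<le> card {..<t1}" by (intro card_mono) (auto simp: R0_def rnd_def)
      then have c0: "real (card R0) \<le> real t1" by simp
      have c1: "real (card R1) \<le> D * (N * (c * sqrt (ln (real T)) + 1))"
        using c lnT by (intro rounds_le fin) (auto simp: R1_def)
      have c2: "real (card R2) \<le> Ja w"
      proof -
        have "real (card R2) \<le> D * (\<Sum>i\<in>UNIV. real (card {v \<in> {1..T}. devE M i {v} w}))"
        proof (intro rounds fin)
          fix n assume "n \<in> R2"
          then obtain i where i: "n < M" "pend w n i" "dev w n i" by (auto simp: R2_def)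
          have "cnt w n i \<le> T" using cnt_le[of w n i] rnd_le[OF i(1)] by (simp add: rnd_def)
          moreover have "1 \<le> cnt w n i" using Ncount_hist_pos[of w n i] by simp
          ultimately have "cnt w n i \<in> {v \<in> {1..T}. devE M i {v} w}" using i by (auto simp: devE_def intro!: exI[of _ n])
          then show "\<exists>i. pend w n i \<and> cnt w n i \<in> {v \<in> {1..T}. devE M i {v} w}" using i by blast
        qed simp
        also have "\<dots> = Ja w"
          unfolding Ja_def by (simp add: indicator_def sum.If_cases Int_def conj_commute)
        finally show ?thesis .
      qed
      have lb2: "late_bound C (N + 1 + u (real T)) \<ge> 0"
      proof -
        have "real t1 \<le> N + 1 + u (real T)" using elim N by linarith
        moreover have "real t1 > 0" using t1(4)[of t1] by (cases t1) auto
        moreover have "ln (real t1) > 0" using t1(4)[of t1] by linarith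
        ultimately show ?thesis
          using late_bound_mono[OF C t1(3)[OF order_refl], of "N + 1 + u (real T)"] by linarith
      qed
      have c3: "real (card R3) \<le> D * (N * (late_bound C (N + 1 + u (real T)) + 1))"
        by (intro rounds_le fin lb2) (auto simp: R3_def)
      \<comment> \<open>If \<open>R4\<close> is nonempty, a deviation has occurred at a sample size
        in \<open>V\<close>, so some indicator equals 1 and may multiply the deterministic bound on
        the number of rounds.\<close>
      have c4: "real (card R4) \<le> Jb w"
      proof (cases "R4 = {}")
        case True
        then show ?thesis unfolding Jb_def using D N lbT by (auto intro!: mult_nonneg_nonneg sum_nonneg)
      next
        case False
        then obtain n i where n: "n < M" "n2 \<le> n" "explored w n" "dev w n i" by (auto simp: R4_def)
        have "ln (real t2) \<le> ln (tm n)" using n(2) by (intro ln_mono) (auto simp: t2_def rnd_def)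
        then have "c * sqrt (ln (real t2)) \<le> c * sqrt (ln (tm n))" using c by simp
        also have "\<dots> \<le> num w n i" using n(3) by (simp add: explored_def)
        finally have "devE M i V w" using n by (auto simp: devE_def V_def intro!: exI[of _ n])
        then have "(1::real) \<le> indicator {w. devE M i V w} w" by simp
        also have "\<dots> \<le> (\<Sum>i\<in>UNIV. indicator {w. devE M i V w} w)" by (rule member_le_sum) auto
        finally have one: "(1::real) \<le> (\<Sum>i\<in>UNIV. indicator {w. devE M i V w} w)" .
        have "real (card R4) \<le> D * (N * (late_bound C (real T) + 1)) * 1"
          unfolding mult_1_right by (intro rounds_le fin lbT) (auto simp: R4_def)
        also have "\<dots> \<le> Jb w"
          unfolding Jb_def using D N lbT by (intro mult_left_mono one) auto
        finally show ?thesis .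
      qed
      have c5: "real (card R5) \<le> Jc w"
      proof -
        have "R5 = {n. n < M \<and> t1 \<le> rnd n} \<inter> {n. optE n k w}" by (auto simp: R5_def)
        then have "Jc w = real (card R5)" unfolding Jc_def by (simp add: indicator_def sum.If_cases)
        then show ?thesis by simp
      qed
      show ?thesis using cB c0 c1 c2 c3 c4 c5 unfolding J_def B_def by linarith
    qed
    ultimately show ?case using intJ by blast
  qed
qed

end

section \<open>From play counts to regret\<close>

lemma regret_eq_sum:
  fixes L :: "real^'m::finite^'n::finite"
  shows "regret L i1 p h = (\<Sum>k\<in>UNIV. ((L$k - L$i1) \<bullet> p) * real (Ncount h k))"
proof (induction h)
  case Nil
  then show ?case by (simp add: regret_def Ncount_def)
next
  case (Cons x h)
  have N: "real (Ncount (x # h) k) = real (Ncount h k) + (if k = fst x then 1 else 0)" for k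
    by (simp add: Ncount_def)
  have "regret L i1 p (x # h) = (L$(fst x) - L$i1) \<bullet> p + regret L i1 p h" by (simp add: regret_def)
  also have "\<dots> = (\<Sum>k\<in>UNIV. ((L$k - L$i1) \<bullet> p) * real (Ncount (x # h) k))"
    unfolding Cons.IH N distrib_left sum.distrib by (simp add: if_distrib cong: if_cong)
  finally show ?case .
qed

context pm_full
begin

lemma alg_hist_eq:
  "length ordr \<le> T \<Longrightarrow> alg_hist ordr H L a b c selP selI selR w T = hist w (T - length ordr)"
  unfolding alg_hist_def hist_def[unfolded st_def, symmetric] by (simp add: length_hist)

lemma Cval_eq: "Cval H L i1 (pvec P) (\<lambda>i. Smat H i *v pvec P) (\<lambda>_. 0) = ereal (cost L i1 (pvec P) rstar)"
proof -
  have "rstar \<in> Ropt H L i1 (pvec P) (\<lambda>i. Smat H i *v pvec P) (\<lambda>_. 0)" using opt by simp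
  then show ?thesis by (simp add: Ropt_def cost_def)
qed

text \<open>Both the excess rate and the expected number of bad additions are at most
  \<open>e * ln T\<close> per action. The choice of \<open>e\<close> keeps their weighted sum below
  \<open>\<epsilon> / 2 * ln T\<close>, and the other half absorbs the constant 2 of
  \<open>Ncount_le\<close>.\<close>

lemma regret_bound:
  assumes "\<epsilon> > 0"
  shows "eventually (\<lambda>T. E (\<lambda>w. regret L i1 (pvec P) (alg_hist ordr H L a b c selP selI selR w T))
     \<le> (cost L i1 (pvec P) rstar + \<epsilon>) * ln (real T)) sequentially"
proof -
  interpret Pr: prob_space "outcomes P" by (rule prob_space_outcomes)
  define \<Delta> where "\<Delta> k = (L$k - L$i1) \<bullet> pvec P" for k
  have \<Delta>: "\<Delta> k \<ge> 0" for k using uniq[of k] by (cases "k = i1") (auto simp: \<Delta>_def)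
  define W where "W = (\<Sum>k\<in>UNIV. \<Delta> k)"
  have W: "W \<ge> 0" unfolding W_def using \<Delta> by (intro sum_nonneg) auto
  define e where "e = \<epsilon> / (4 * (W + 1))"
  have e: "e > 0" "2 * e * W \<le> \<epsilon> / 2" using assms W by (auto simp: e_def divide_simps)
  have "eventually (\<lambda>T. \<forall>k. k \<noteq> i1 \<longrightarrow> (\<exists>J. integrable (outcomes P) J \<and> E J \<le> e * ln (real T) \<and>
    (\<forall>w. real (card (bad e T w k)) \<le> J w))) sequentially"
  proof (rule eventually_all_finite)
    fix k
    show "eventually (\<lambda>T. k \<noteq> i1 \<longrightarrow> (\<exists>J. integrable (outcomes P) J \<and> E J \<le> e * ln (real T) \<and>
      (\<forall>w. real (card (bad e T w k)) \<le> J w))) sequentially"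
      using bad_additions[OF e(1) e(1), of k] by (cases "k = i1") simp_all
  qed
  moreover have "eventually (\<lambda>T::nat. 2 * W \<le> \<epsilon> / 2 * ln (real T)) sequentially" using assms by real_asymp
  moreover have "eventually (\<lambda>T. T \<ge> length ordr) sequentially" by (rule eventually_ge_at_top)
  moreover have "eventually (\<lambda>T::nat. ln (real T) \<ge> 0) sequentially" by real_asymp
  ultimately show ?thesis
  proof eventually_elim
    case (elim T)
    define M where "M = T - length ordr"
    have "\<forall>k. \<exists>J. k \<noteq> i1 \<longrightarrow> integrable (outcomes P) J \<and> E J \<le> e * ln (real T) \<and>
      (\<forall>w. real (card (bad e T w k)) \<le> J w)"
      using elim(1) by blast
    from choice[OF this] obtain J where Jall: "\<forall>k. k \<noteq> i1 \<longrightarrow> integrable (outcomes P) (J k) \<and>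
      E (\<lambda>w. J k w) \<le> e * ln (real T) \<and>
      (\<forall>w. real (card (bad e T w k)) \<le> J k w)"
      by blast
    have J: "integrable (outcomes P) (J k)" "E (\<lambda>w. J k w) \<le> e * ln (real T)"
      "real (card (bad e T w k)) \<le> J k w"
      if "k \<noteq> i1" for k w
      using Jall that by blast+
    have r0: "rstar$k \<ge> 0" for k using rstar(1) by (simp add: Rset_iff)
    have Nle: "num w M k \<le> (rstar$k + e) * ln (real T) + 2 + J k w" if "k \<noteq> i1" for w k
    proof -
      have "(rstar$k + e) * ln (real T) \<ge> 0" using r0 e elim(4) by (intro mult_nonneg_nonneg) auto
      from Ncount_le[OF this, of w M k] J(3)[OF that, of w] show ?thesis by (simp add: bad_def M_def)
    qed
    have reg_eq: "regret L i1 (pvec P) (alg_hist ordr H L a b c selP selI selR w T) = (\<Sum>k\<in>UNIV - {i1}. \<Delta> k * num w M k)" for w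
      unfolding regret_eq_sum alg_hist_eq[OF elim(3)] M_def[symmetric] \<Delta>_def
      by (subst sum.remove[of _ i1]) auto
    have "E (\<lambda>w. regret L i1 (pvec P) (alg_hist ordr H L a b c selP selI selR w T))
        \<le> E (\<lambda>w. (\<Sum>k\<in>UNIV - {i1}. \<Delta> k * ((rstar$k + e) * ln (real T) + 2 + J k w)))"
      unfolding reg_eq
    proof (rule integral_mono)
      show "integrable (outcomes P) (\<lambda>w. \<Sum>k\<in>UNIV - {i1}. \<Delta> k * num w M k)"
        by (rule dep_integrable[OF dep_comp[OF hist_dep]])
      show "integrable (outcomes P) (\<lambda>w. \<Sum>k\<in>UNIV - {i1}. \<Delta> k * ((rstar$k + e) * ln (real T) + 2 + J k w))"
        using J(1) by (intro Bochner_Integration.integrable_sum integrable_mult_right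
          Bochner_Integration.integrable_add Pr.integrable_const) auto
      show "(\<Sum>k\<in>UNIV - {i1}. \<Delta> k * num w M k) \<le> (\<Sum>k\<in>UNIV - {i1}. \<Delta> k * ((rstar$k + e) * ln (real T) + 2 + J k w))" for w
        using Nle \<Delta> by (intro sum_mono mult_left_mono) auto
    qed
    also have "\<dots> = (\<Sum>k\<in>UNIV - {i1}. \<Delta> k * ((rstar$k + e) * ln (real T) + 2 + E (\<lambda>w. J k w)))"
      using J(1) by (subst Bochner_Integration.integral_sum) (auto simp: Pr.prob_space[unfolded space_outcomes])
    also have "\<dots> \<le> (\<Sum>k\<in>UNIV - {i1}. \<Delta> k * ((rstar$k + e) * ln (real T) + 2 + e * ln (real T)))"
      using J(2) \<Delta> by (intro sum_mono mult_left_mono add_left_mono) auto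
    also have "\<dots> = (\<Sum>k\<in>UNIV - {i1}. rstar$k * \<Delta> k * ln (real T) + \<Delta> k * (2 * e * ln (real T) + 2))"
      by (intro sum.cong) (auto simp: algebra_simps)
    also have "\<dots> = cost L i1 (pvec P) rstar * ln (real T) + (\<Sum>k\<in>UNIV - {i1}. \<Delta> k) * (2 * e * ln (real T) + 2)"
      by (simp add: sum.distrib cost_def \<Delta>_def sum_distrib_right)
    also have "(\<Sum>k\<in>UNIV - {i1}. \<Delta> k) = W" unfolding W_def by (subst (2) sum.remove[of _ i1]) (auto simp: \<Delta>_def)
    also have "W * (2 * e * ln (real T) + 2) = 2 * e * W * ln (real T) + 2 * W" by (simp add: algebra_simps)
    also have "2 * e * W * ln (real T) + 2 * W \<le> \<epsilon> / 2 * ln (real T) + \<epsilon> / 2 * ln (real T)"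
      using e elim(2,4) by (intro add_mono mult_right_mono) auto
    finally show ?case by (simp add: algebra_simps)
  qed
qed

end

text \<open>The remainder of lower order is expressed by an arbitrary \<open>\<epsilon>\<close>
  added to the leading constant, with the bound for all sufficiently large \<open>T\<close>.\<close>

theorem theorem3:
  fixes L :: "real^'m::finite^'n::finite" and H :: "'a::finite^'m^'n" and P :: "'m pmf"
    and i1 :: 'n and a b c :: real and ordr :: "'n list"
    and selP :: "nat \<Rightarrow> ('n \<times> 'a) list \<Rightarrow> real^'m"
    and selI :: "nat \<Rightarrow> ('n \<times> 'a) list \<Rightarrow> 'n"
    and selR :: "nat \<Rightarrow> ('n \<times> 'a) list \<Rightarrow> (real^'n) option"
  assumes "glob_obs L H"
    and "\<forall>i. i \<noteq> i1 \<longrightarrow> L$i1 \<bullet> pvec P < L$i \<bullet> pvec P"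
    and "\<exists>r. Ropt H L i1 (pvec P) (\<lambda>i. Smat H i *v pvec P) (\<lambda>_. 0) = {r}"
    and "\<exists>\<epsilon>>0. \<forall>\<delta>. 0 \<le> \<delta> \<and> \<delta> < \<epsilon> \<longrightarrow>
           clP (intP (cellc L i1) \<inter> Sdelta H i1 (pvec P) \<delta>)
         = clP (clP (cellc L i1) \<inter> Sdelta H i1 (pvec P) \<delta>)"
    and "a > 0" and "b > 0" and "c > 0"
    and "distinct ordr" and "set ordr = UNIV"
    and "valid_sel H L b selP selI selR"
  shows "\<forall>\<epsilon>>0. eventually (\<lambda>T.
           ereal (\<integral>\<omega>. regret L i1 (pvec P) (alg_hist ordr H L a b c selP selI selR \<omega> T)
                     \<partial>(Pi\<^sub>M UNIV (\<lambda>_::nat. measure_pmf P)))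
         \<le> (Cval H L i1 (pvec P) (\<lambda>i. Smat H i *v pvec P) (\<lambda>_. 0) + ereal \<epsilon>) * ereal (ln (real T)))
         sequentially"
proof -
  obtain r where r: "Ropt H L i1 (pvec P) (\<lambda>i. Smat H i *v pvec P) (\<lambda>_. 0) = {r}" using assms(3) by blast
  interpret pm_full L H P i1 r a b c ordr selP selI selR
  proof
    show "(L$i - L$i1) \<bullet> pvec P > 0" if "i \<noteq> i1" for i
      using assms(2) that by (simp add: inner_diff_left)
    show "clP (intP (cellc L i1) \<inter> Sdelta H i1 (pvec P) 0) = clP (clP (cellc L i1) \<inter> Sdelta H i1 (pvec P) 0)"
      using assms(4) by blast
  qed (use assms r pvec_probsimplex in auto)
  show ?thesis
  proof (intro allI impI)
    fix \<epsilon> :: real assume "\<epsilon> > 0"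
    from regret_bound[OF this]
    show "eventually (\<lambda>T.
           ereal (\<integral>\<omega>. regret L i1 (pvec P) (alg_hist ordr H L a b c selP selI selR \<omega> T)
                     \<partial>(Pi\<^sub>M UNIV (\<lambda>_::nat. measure_pmf P)))
         \<le> (Cval H L i1 (pvec P) (\<lambda>i. Smat H i *v pvec P) (\<lambda>_. 0) + ereal \<epsilon>) * ereal (ln (real T)))
         sequentially"
      by eventually_elim (simp add: Cval_eq)
  qed
qed

end
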